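(* For every $n\ge 1$, the following three sets are pairwise in bijection (equivalently, have the same cardinality): (i) the set of binary generalized de Bruijn words of length $2n$; (ii) the set of binary invertible necklaces of length $n$; (iii) the set of unordered normal bases of $\mathrm{GF}_{2^n}$ over $\mathrm{GF}_2$.
   Context: Binary words are over $\{0,1\}$ with $0<1$. A necklace is the set of rotations of a word. The Burrows–Wheeler matrix of a necklace $[w]$ of length $N$ is the $N\times N$ matrix whose rows are the $N$ rotations of $w$ (with multiplicity) in ascending lexicographic order; $\mathrm{BWT}([w])$ is its last column. A binary generalized de Bruijn word is a necklace of length $2n$ over $\{0,1\}$ whose BWT is a concatenation of $n$ words each equal to $01$ or $10$. A binary necklace of length $n$ is invertible if its Burrows–Wheeler matrix is nonsingular over $\mathrm{GF}_2$. A normal basis of $\mathrm{GF}_{2^n}$ is a basis over $\mathrm{GF}_2$ of the form $\{\gamma,\gamma^2,\gamma^{4},\ldots,\gamma^{2^{n-1}}\}$. *)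

theory Defs
  imports
    "HOL-Library.Z2"
    "HOL-Library.List_Lexorder"
    "HOL-Algebra.Embedded_Algebras"
    "Jordan_Normal_Form.Determinant"
begin

text \<open>
  Binary words are lists over the two-element field \<^typ>\<open>bit\<close>, which serves both as the
  alphabet, ordered by \<open>0 < 1\<close>, and as the field of the entries of Burrows--Wheeler matrices.
  The library does not order \<^typ>\<open>bit\<close>.
\<close>

instantiation bit :: linorder
begin

definition less_eq_bit :: "bit \<Rightarrow> bit \<Rightarrow> bool"
  where "(x :: bit) \<le> y \<longleftrightarrow> x = 0 \<or> y = 1"

definition less_bit :: "bit \<Rightarrow> bit \<Rightarrow> bool"
  where "(x :: bit) < y \<longleftrightarrow> x = 0 \<and> y = 1"

instance
proof
  fix x y z :: bit
  show "x < y \<longleftrightarrow> x \<le> y \<and> \<not> y \<le> x"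
    by (cases x; cases y) (simp_all add: less_eq_bit_def less_bit_def)
  show "x \<le> x"
    by (cases x) (simp_all add: less_eq_bit_def)
  show "x \<le> z" if "x \<le> y" "y \<le> z"
    using that by (cases x; cases y; cases z) (simp_all add: less_eq_bit_def)
  show "x = y" if "x \<le> y" "y \<le> x"
    using that by (cases x; cases y) (simp_all add: less_eq_bit_def)
  show "x \<le> y \<or> y \<le> x"
    by (cases x; cases y) (simp_all add: less_eq_bit_def)
qed

end

definition rotations :: "'a list \<Rightarrow> 'a list list"
  where "rotations w = map (\<lambda>k. rotate k w) [0..<length w]"

definition necklace :: "'a list \<Rightarrow> 'a list set"
  where "necklace w = {rotate k w | k. True}"

definition necklaces :: "nat \<Rightarrow> bit list set set"
  where "necklaces N = {necklace w | w. length w = N}"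

text \<open>
  The rows of the Burrows--Wheeler matrix, with multiplicity, are read off from a chosen
  representative; lemma \<open>bw_rows_necklace\<close> below shows that the choice is immaterial.
  The order on words is the lexicographic one of \<^theory>\<open>HOL-Library.List_Lexorder\<close>.
\<close>

definition bw_rows :: "bit list set \<Rightarrow> bit list list"
  where "bw_rows C = sort (rotations (SOME w. w \<in> C))"

definition bw_matrix :: "bit list set \<Rightarrow> bit mat"
  where "bw_matrix C = (let rows = bw_rows C; N = length rows in mat N N (\<lambda>(i, j). rows ! i ! j))"

definition BWT :: "bit list set \<Rightarrow> bit list"
  where "BWT C = map last (bw_rows C)"

lemma mset_rotations_rotate1: "mset (rotations (rotate1 w)) = mset (rotations w)"
proof (cases "w = []")
  case True
  then show ?thesis by simp
next
  case False
  then obtain m where m: "length w = Suc m"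
    by (cases w) auto
  have "rotations (rotate1 w) = map (\<lambda>k. rotate (Suc k) w) [0..<Suc m]"
    by (simp add: rotations_def m rotate1_rotate_swap del: upt_Suc)
  also have "\<dots> = map (\<lambda>k. rotate k w) [Suc 0..<Suc (Suc m)]"
    by (simp only: map_Suc_upt[symmetric] map_map o_def)
  also have "\<dots> = map (\<lambda>k. rotate k w) [Suc 0..<Suc m] @ [rotate 0 w]"
    using rotate_id[of "Suc m" w] m by simp
  finally have "mset (rotations (rotate1 w)) = mset (rotate 0 w # map (\<lambda>k. rotate k w) [Suc 0..<Suc m])"
    by (simp del: upt_Suc)
  also have "rotate 0 w # map (\<lambda>k. rotate k w) [Suc 0..<Suc m] = rotations w"
    by (simp add: rotations_def m upt_rec[of 0] del: upt_Suc)
  finally show ?thesis .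
qed

lemma mset_rotations_rotate: "mset (rotations (rotate k w)) = mset (rotations w)"
  by (induction k) (simp_all add: mset_rotations_rotate1)

lemma bw_rows_necklace: "bw_rows (necklace w) = sort (rotations w)"
proof -
  have "rotate 0 w \<in> necklace w"
    unfolding necklace_def by blast
  then have "(SOME v. v \<in> necklace w) \<in> necklace w"
    by (rule someI)
  then obtain k where "(SOME v. v \<in> necklace w) = rotate k w"
    by (auto simp: necklace_def)
  then show ?thesis
    unfolding bw_rows_def
    by (intro properties_for_sort) (simp_all add: mset_rotations_rotate)
qed

definition generalized_de_bruijn_words :: "nat \<Rightarrow> bit list set set"
  where "generalized_de_bruijn_words n =
    {C \<in> necklaces (2 * n).
       \<exists>xs. length xs = n \<and> set xs \<subseteq> {[0, 1], [1, 0]} \<and> BWT C = concat xs}"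

definition invertible_necklaces :: "nat \<Rightarrow> bit list set set"
  where "invertible_necklaces n = {C \<in> necklaces n. invertible_mat (bw_matrix C)}"

text \<open>
  For \<open>F\<close> a field with \<open>2 ^ n\<close> elements, \<open>{\<zero>, \<one>}\<close> is its prime subfield, that is, the copy of
  the two-element field inside \<open>F\<close>. A normal basis is an unordered basis, hence a set;
  independence of the list forces its entries to be distinct.
\<close>

definition normal_bases :: "nat \<Rightarrow> ('a, 'b) ring_scheme \<Rightarrow> 'a set set"
  where "normal_bases n F =
    {set us | us \<gamma>. \<gamma> \<in> carrier F \<and>
       us = map (\<lambda>i. \<gamma> [^]\<^bsub>F\<^esub> ((2 :: nat) ^ i)) [0..<n] \<and>
       ring.independent F {\<zero>\<^bsub>F\<^esub>, \<one>\<^bsub>F\<^esub>} us \<and>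
       ring.Span F {\<zero>\<^bsub>F\<^esub>, \<one>\<^bsub>F\<^esub>} us = carrier F}"

end

theory Submission
  imports Defs
    "HOL-Computational_Algebra.Field_as_Ring"
    "HOL-Algebra.Algebraic_Closure_Type"
    "HOL-Algebra.Multiplicative_Group"
begin

text \<open>
  Each of the three sets, taken n times, has as many elements as there are units in the ring of
  polynomials over the two-element field modulo \<open>x^n - 1\<close>.

  A word of length n is the first row of a circulant matrix, which is nonsingular iff the word is
  a unit; the rotations of a unit are distinct. A finite field of order \<open>2^n\<close> is a cyclic module
  over this ring, with x acting as the Frobenius map; the normal elements are the units times a
  fixed generator, and each normal basis consists of n of them.

  The BWT of a generalized de Bruijn word chooses 01 or 10 in each of n blocks, and a choice
  occurs iff the permutation of the \<open>2n\<close> rows that it induces is a single cycle. For a permutation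
  f with cycle lengths \<open>c\<^sub>1, \<dots>, c\<^sub>k\<close> the determinant of x minus the permutation matrix is the
  product of the \<open>x^c\<^sub>i - 1\<close>, so divided by \<open>x - 1\<close> it tends to \<open>2n\<close> or to 0 as x tends to 1,
  according to whether f is a single cycle. The sum of these determinants over all choices is, by
  multilinearity, a multiple of the determinant of \<open>2x - A\<close>, where A is the adjacency matrix of
  the graph with edges \<open>j \<rightarrow> 2j, 2j + 1\<close> modulo \<open>2n\<close>. Up to a rational factor this is the
  determinant of \<open>2x - D\<close> for the doubling map D on the integers modulo \<open>2n\<close>. At \<open>x = 1\<close>, for odd
  modulus m, this counts the nowhere vanishing functions v on the integers modulo m, with values in
  an algebraic closure, such that \<open>v(2i) = v(i)^2\<close>; by the discrete Fourier transform these are the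
  value vectors of the units. Passing from m to \<open>2m\<close> multiplies both counts by \<open>2^m\<close>.
\<close>

section \<open>Polynomials over the two-element field and annihilators\<close>

text \<open>The families are compared by size: the units count words and field elements directly,
  whereas choices of blocks are reached only through real determinants. A limit is unavoidable
  there, since at \<open>x = 1\<close> every determinant vanishes and only the order of vanishing
  tells a single cycle from several. The rational factor has a zero at \<open>x = 1\<close> that
  absorbs the division by \<open>x - 1\<close>. The doubling determinant is left at the argument 2,
  because averaging the two choices of a block produces entries 1/2. This 2 then meets the order of
  the field: a cycle of length c contributes \<open>2 ^ c - 1\<close> to the determinant, which is
  also the number of nonzero solutions of \<open>z ^ (2 ^ c) = z\<close>. Even moduli are treated
  apart because \<open>x^n - 1\<close> then has repeated roots, so that values at roots of unity no
  longer determine a residue. Repeated rows could spoil the passage from a transform to a cycle. The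
  first block excludes them: it gives the two smallest rows different last letters.\<close>

instantiation bit ::
  "{unique_euclidean_ring, normalization_euclidean_semiring, normalization_semidom_multiplicative}"
begin

definition [simp]: "normalize_bit = (normalize_field :: bit \<Rightarrow> _)"
definition [simp]: "unit_factor_bit = (unit_factor_field :: bit \<Rightarrow> _)"
definition [simp]: "euclidean_size_bit = (euclidean_size_field :: bit \<Rightarrow> _)"
definition [simp]: "division_segment (x :: bit) = 1"

instance
  by standard
    (simp_all add: dvd_field_iff field_split_simps split: if_splits)

end

instantiation bit :: euclidean_ring_gcd
begin

definition gcd_bit :: "bit \<Rightarrow> bit \<Rightarrow> bit" where
  "gcd_bit = Euclidean_Algorithm.gcd"
definition lcm_bit :: "bit \<Rightarrow> bit \<Rightarrow> bit" where
  "lcm_bit = Euclidean_Algorithm.lcm"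
definition Gcd_bit :: "bit set \<Rightarrow> bit" where
 "Gcd_bit = Euclidean_Algorithm.Gcd"
definition Lcm_bit :: "bit set \<Rightarrow> bit" where
 "Lcm_bit = Euclidean_Algorithm.Lcm"

instance by standard (simp_all add: gcd_bit_def lcm_bit_def Gcd_bit_def Lcm_bit_def)

end

text \<open>Membership in this class is what provides polynomials over \<open>bit\<close> with gcds,
  Bezout coefficients and prime factorizations.\<close>

instance bit :: field_gcd ..

text \<open>Common ground of two existence proofs: a primitive root of unity, where exponents act on
  a multiplicative group, and a cyclic vector, where polynomials act on a finite field.
  \<open>kills r v\<close> reads "r annihilates v". A locale over a carrier set serves both the
  type-class group and the field given as a record.\<close>

locale annihilation =
  fixes V :: "'v set" and kills :: "'r :: factorial_semiring_gcd \<Rightarrow> 'v \<Rightarrow> bool"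
    and plus :: "'v \<Rightarrow> 'v \<Rightarrow> 'v" and scale :: "'r \<Rightarrow> 'v \<Rightarrow> 'v"
  assumes plus_closed: "v \<in> V \<Longrightarrow> w \<in> V \<Longrightarrow> plus v w \<in> V"
    and scale_closed: "v \<in> V \<Longrightarrow> scale r v \<in> V"
    and kills_dvd: "v \<in> V \<Longrightarrow> kills r v \<Longrightarrow> r dvd s \<Longrightarrow> kills s v"
    and kills_gcd: "v \<in> V \<Longrightarrow> kills r v \<Longrightarrow> kills s v \<Longrightarrow> kills (gcd r s) v"
    and kills_scale: "v \<in> V \<Longrightarrow> kills s (scale r v) \<longleftrightarrow> kills (r * s) v"
    and kills_plus_left: "v \<in> V \<Longrightarrow> w \<in> V \<Longrightarrow> kills r v \<Longrightarrow> kills r (plus v w) \<longleftrightarrow> kills r w"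
    and kills_plus_right: "v \<in> V \<Longrightarrow> w \<in> V \<Longrightarrow> kills r w \<Longrightarrow> kills r (plus v w) \<longleftrightarrow> kills r v"
begin

text \<open>
  If v deals with the primes in P and u with the prime p, then v or v + r u deals with all of
  them, where r is the part of N prime to p: N/q kills the summand r u for all q in P.
\<close>

lemma exists_exact_annihilator:
  assumes N: "N \<noteq> 0" "\<And>v. v \<in> V \<Longrightarrow> kills N v" and V: "V \<noteq> {}"
    and ex: "\<And>p. normalization_semidom_class.prime p \<Longrightarrow> p dvd N \<Longrightarrow> \<exists>v\<in>V. \<not> kills (N div p) v"
  shows "\<exists>v\<in>V. \<forall>r. kills r v \<longleftrightarrow> N dvd r"
proof -
  have "\<exists>v\<in>V. \<forall>p\<in>P. \<not> kills (N div p) v"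
    if "finite P" "P \<subseteq> prime_factors N" for P
    using that
  proof (induction P rule: finite_induct)
    case empty
    then show ?case using V by auto
  next
    case (insert p P)
    then obtain v where v: "v \<in> V" "\<And>q. q \<in> P \<Longrightarrow> \<not> kills (N div q) v"
      by auto
    have p: "normalization_semidom_class.prime p" "p dvd N" using insert.prems N
        by (auto simp: in_prime_factors_iff)
    obtain u where u: "u \<in> V" "\<not> kills (N div p) u" using ex[OF p] by auto
    show ?case
    proof (cases "kills (N div p) v")
      case False
      then show ?thesis using v by auto
    next
      case True
      define e where "e = multiplicity p N"
      obtain r where r: "N = p ^ e * r" "\<not> p dvd r"
        using multiplicity_decompose'[of N p] p N unfolding e_def by (metis not_prime_unit)
      have e0: "e > 0" using p N unfolding e_def by (simp add: prime_multiplicity_gt_zero_iff)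
      have p0: "p \<noteq> 0" using p by auto
      have Np: "N div p = p ^ (e - 1) * r"
        using e0 p0 r(1) by (cases e) (auto simp: mult.assoc)
      define w where "w = scale r u"
      have w: "w \<in> V" using u scale_closed w_def by auto
      have *: "\<not> kills (N div p) w"
      proof
        assume "kills (N div p) w"
        then have "kills (r * (N div p)) u" using u kills_scale w_def by auto
        \<comment> \<open>As \<open>N\<close> kills \<open>u\<close> too, so does the gcd, which is
          \<open>N div p\<close> up to a unit because \<open>p\<close> does not divide
          \<open>r\<close>.\<close>
        then have k: "kills (gcd (r * (N div p)) N) u" using u N by (intro kills_gcd) auto
        have "N = p * (N div p)" using p by simp
        then have "gcd (r * (N div p)) N = gcd (r * (N div p)) (p * (N div p))" by simp
        also have "\<dots> = normalize (gcd r p * (N div p))"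
          by (simp only: gcd_mult_right gcd.commute)
        also have "gcd r p = 1"
          using p(1) r(2) by (metis gcd.commute prime_imp_coprime coprime_iff_gcd_eq_1)
        finally show False using k u(2) kills_dvd[OF u(1)]
            by (metis dvd_refl mult_1 normalize_dvd_iff)
      qed
      have **: "kills (N div q) w" if "q \<in> P" for q
      proof -
        have q: "normalization_semidom_class.prime q" "q dvd N" "q \<noteq> p"
            using insert.prems insert.hyps that
          by (auto simp: in_prime_factors_iff)
        have "coprime q (p ^ e)" using primes_coprime[OF q(1) p(1) q(3)] by simp
        then have "q dvd r" using q(2) r(1) by (simp add: coprime_dvd_mult_right_iff)
        then obtain s where s: "r = q * s" by auto
        have "N div q = p ^ e * s" using q(1) r(1) s
          by (metis mult.left_commute nonzero_mult_div_cancel_left not_prime_0)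
        then have "N dvd r * (N div q)" using r(1) by (metis dvd_triv_left mult.assoc mult.commute)
        then show ?thesis using kills_scale[OF u(1)] kills_dvd[OF u(1) N(2)[OF u(1)]] w_def by blast
      qed
      have "plus v w \<in> V" "\<not> kills (N div p) (plus v w)" 
        "\<And>q. q \<in> P \<Longrightarrow> \<not> kills (N div q) (plus v w)"
        using plus_closed v w kills_plus_left[OF v(1) w True] kills_plus_right[OF v(1) w] * **
            by auto
      then show ?thesis by auto
    qed
  qed
  from this[OF finite_set_mset subset_refl] obtain v
    where v: "v \<in> V" "\<And>p. p \<in> prime_factors N \<Longrightarrow> \<not> kills (N div p) v" by auto
  \<comment> \<open>Otherwise the gcd of \<open>r\<close> and \<open>N\<close> kills
    \<open>v\<close> and is a proper divisor of \<open>N\<close>. It then divides some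
    \<open>N div p\<close>, which would kill \<open>v\<close> as well.\<close>
  have "N dvd r" if "kills r v" for r
  proof (rule ccontr)
    assume nd: "\<not> N dvd r"
    define g where "g = gcd r N"
    have k: "kills g v" using that v N kills_gcd g_def by auto
    obtain s where s: "N = g * s" unfolding g_def by (metis dvdE gcd_dvd2)
    have "\<not> is_unit s"
    proof
      assume "is_unit s"
      then have "N dvd g" using s by (metis dvd_refl mult_unit_dvd_iff)
      then show False using nd g_def by (metis dvd_trans gcd_dvd1)
    qed
    moreover have "s \<noteq> 0" using s N by auto
    ultimately obtain p where p: "normalization_semidom_class.prime p" "p dvd s"
        using prime_divisorE by metis
    then obtain t where t: "s = p * t" by auto
    have "N div p = g * t" using s t p
      by (metis mult.left_commute nonzero_mult_div_cancel_left not_prime_0)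
    then have "kills (N div p) v" using k v kills_dvd by (metis dvd_triv_left)
    then show False using v(2)[of p] p s N by (auto simp: in_prime_factors_iff)
  qed
  then show ?thesis using v(1) N(2)[OF v(1)] kills_dvd[OF v(1)] by blast
qed

end

section \<open>Determinants indexed by finite sets\<close>

text \<open>Removing points from a cycle leaves arbitrary index sets, for which matrices indexed by
  an initial segment of the naturals are awkward. The list enumerates the indices.\<close>

definition ldet :: "'i list \<Rightarrow> ('i \<Rightarrow> 'i \<Rightarrow> 'a :: comm_ring_1) \<Rightarrow> 'a"
  where "ldet xs M = det (mat (length xs) (length xs) (\<lambda>(i, j). M (xs ! i) (xs ! j)))"

lemma ldet_transpose: "ldet xs (\<lambda>i j. M j i) = ldet xs M"
proof -
  have "mat (length xs) (length xs) (\<lambda>(i, j). M (xs ! j) (xs ! i)) =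
    transpose_mat (mat (length xs) (length xs) (\<lambda>(i, j). M (xs ! i) (xs ! j)))"
    by (rule eq_matI) auto
  then show ?thesis unfolding ldet_def by (simp add: det_transpose[OF mat_carrier])
qed

text \<open>Rows and columns are permuted alike, so the sign enters twice and cancels. The columns
  are treated as rows of the transpose.\<close>

lemma ldet_permute:
  assumes "mset xs = mset ys"
  shows "ldet xs M = ldet ys M"
proof -
  define n where "n = length ys"
  obtain p where p: "p permutes {..<n}" "permute_list p ys = xs"
    using mset_eq_permutation[OF assms] n_def by auto
  then have p0: "p permutes {0..<n}" by (simp add: atLeast0LessThan)
  have n: "length xs = n" using assms n_def by (metis size_mset)
  have nth: "xs ! i = ys ! p i" if "i < n" for i
    using permute_list_nth[of p ys] p that n_def by auto
  have pn: "p i < n" if "i < n" for i using permutes_in_image[OF p(1)] that by auto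
  define A where "A = mat n n (\<lambda>(i, j). M (ys ! i) (ys ! j))"
  have A: "A \<in> carrier_mat n n" by (simp add: A_def)
  define B where "B = mat n n (\<lambda>(i, j). A $$ (p i, j))"
  have B: "B \<in> carrier_mat n n" by (simp add: B_def)
  have "mat n n (\<lambda>(i, j). M (xs ! j) (xs ! i)) = mat n n (\<lambda>(i, j). transpose_mat B $$ (p i, j))"
    by (rule eq_matI) (auto simp: nth pn B_def A_def)
  then have "ldet xs M = det (mat n n (\<lambda>(i, j). transpose_mat B $$ (p i, j)))"
    using ldet_transpose[of xs M] by (simp add: ldet_def n)
  also have "\<dots> = signof p * det B"
    using det_permute_rows[OF _ p0, of "transpose_mat B"] B det_transpose[OF B] by simp
  also have "det B = signof p * det A" unfolding B_def using det_permute_rows[OF A p0] .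
  also have "signof p * (signof p * det A) = det A"
    by (simp add: sign_def)
  finally show ?thesis by (simp add: A_def ldet_def n_def)
qed

lemma ldet_mult:
  assumes "distinct xs"
  shows "ldet xs (\<lambda>i j. \<Sum>k\<in>set xs. A i k * B k j) = ldet xs A * ldet xs B"
proof -
  define n where "n = length xs"
  have "mat n n (\<lambda>(i, j). \<Sum>k\<in>set xs. A (xs ! i) k * B k (xs ! j)) =
     mat n n (\<lambda>(i, j). A (xs ! i) (xs ! j)) * mat n n (\<lambda>(i, j). B (xs ! i) (xs ! j))"
  proof (rule eq_matI, goal_cases)
    case (1 i j)
    have "bij_betw ((!) xs) {0..<n} (set xs)" by (rule bij_betw_nth[OF assms]) (auto simp: n_def)
    then have "(\<Sum>k\<in>set xs. A (xs ! i) k * B k (xs ! j)) =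
       (\<Sum>k\<in>{0..<n}. A (xs ! i) (xs ! k) * B (xs ! k) (xs ! j))"
      by (rule sum.reindex_bij_betw[symmetric])
    then show ?case using 1 by (simp add: scalar_prod_def)
  qed auto
  then show ?thesis unfolding ldet_def n_def[symmetric]
    using det_mult[of "mat n n (\<lambda>(i, j). A (xs ! i) (xs ! j))" n "mat n n (\<lambda>(i, j). B (xs ! i) (xs
        ! j))"] by simp
qed

lemma ldet_snoc:
  assumes "\<And>i. i \<in> set xs \<Longrightarrow> M i s = 0"
  shows "ldet (xs @ [s]) M = ldet xs M * M s s"
proof -
  define n where "n = length xs"
  define A1 where "A1 = mat n n (\<lambda>(i, j). M (xs ! i) (xs ! j))"
  define A3 where "A3 = mat 1 n (\<lambda>(i, j). M s (xs ! j))"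
  define A4 where "A4 = mat 1 1 (\<lambda>(i, j). M s s)"
  have "mat (Suc n) (Suc n) (\<lambda>(i, j). M ((xs @ [s]) ! i) ((xs @ [s]) ! j)) =
     four_block_mat A1 (0\<^sub>m n 1) A3 A4"
    by (rule eq_matI) (auto simp: A1_def A3_def A4_def nth_append n_def assms less_Suc_eq)
  moreover have "det (four_block_mat A1 (0\<^sub>m n 1) A3 A4) = det A1 * det A4"
    by (rule det_four_block_mat_upper_right_zero_col) (auto simp: A1_def A3_def A4_def)
  moreover have "det A4 = M s s" using det_single[of A4] by (simp add: A4_def)
  ultimately show ?thesis by (simp add: ldet_def n_def A1_def)
qed

section \<open>Determinants over unordered finite index sets\<close>

definition sdet :: "'i set \<Rightarrow> ('i \<Rightarrow> 'i \<Rightarrow> 'a :: comm_ring_1) \<Rightarrow> 'a"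
  where "sdet S M = ldet (SOME xs. distinct xs \<and> set xs = S) M"

lemma sdet_eq_ldet:
  assumes "distinct xs" "set xs = S"
  shows "sdet S M = ldet xs M"
proof -
  let ?ys = "SOME xs. distinct xs \<and> set xs = S"
  have "distinct ?ys \<and> set ?ys = S" using someI[of "\<lambda>xs. distinct xs \<and> set xs
      = S", OF conjI[OF assms]] .
  then have "mset ?ys = mset xs" using assms set_eq_iff_mset_eq_distinct by blast
  then show ?thesis unfolding sdet_def by (rule ldet_permute)
qed

lemma sdet_eq_det: "sdet {..<n} M = det (mat n n (\<lambda>(i, j). M i j))"
proof -
  have "mat n n (\<lambda>(i, j). M ([0..<n] ! i) ([0..<n] ! j)) = mat n n (\<lambda>(i, j). M i j)"
    by (rule eq_matI) auto
  then show ?thesis using sdet_eq_ldet[of "[0..<n]" "{..<n}" M]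
    by (simp only: ldet_def distinct_upt set_upt length_upt minus_nat.diff_0 atLeast0LessThan
        simp_thms)
qed

lemma sdet_empty [simp]: "sdet {} M = 1"
  using sdet_eq_ldet[of "[]" "{}" M] by (simp add: ldet_def)

lemma sdet_cong:
  assumes "finite S" "\<And>i j. i \<in> S \<Longrightarrow> j \<in> S \<Longrightarrow> M i j = M' i j"
  shows "sdet S M = sdet S M'"
proof -
  obtain xs where xs: "distinct xs" "set xs = S" using finite_distinct_list[OF assms(1)] by auto
  have "mat (length xs) (length xs) (\<lambda>(i, j). M (xs ! i) (xs ! j)) =
     mat (length xs) (length xs) (\<lambda>(i, j). M' (xs ! i) (xs ! j))"
    by (rule eq_matI) (use xs assms in auto)
  then show ?thesis by (simp add: sdet_eq_ldet[OF xs] ldet_def)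
qed

lemma sdet_mult:
  assumes "finite S"
  shows "sdet S (\<lambda>i j. \<Sum>k\<in>S. A i k * B k j) = sdet S A * sdet S B"
proof -
  obtain xs where xs: "distinct xs" "set xs = S" using finite_distinct_list[OF assms(1)] by auto
  show ?thesis using ldet_mult[OF xs(1), of A B] by (simp add: sdet_eq_ldet[OF xs] xs(2))
qed

lemma sdet_transpose: "sdet S (\<lambda>i j. M j i) = sdet S M"
  unfolding sdet_def by (rule ldet_transpose)

lemma sdet_reindex:
  assumes "finite S" "inj_on h S"
  shows "sdet (h ` S) M = sdet S (\<lambda>i j. M (h i) (h j))"
proof -
  obtain xs where xs: "distinct xs" "set xs = S" using finite_distinct_list[OF assms(1)] by auto
  have "distinct (map h xs)" "set (map h xs) = h ` S" using xs assms by (auto simp: distinct_map)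
  then have "sdet (h ` S) M = ldet (map h xs) M" by (rule sdet_eq_ldet)
  also have "\<dots> = ldet xs (\<lambda>i j. M (h i) (h j))"
    unfolding ldet_def by (rule arg_cong[where f = det], rule eq_matI) auto
  finally show ?thesis by (simp add: sdet_eq_ldet[OF xs])
qed

lemma sdet_insert:
  assumes "finite S" "s \<notin> S" "\<And>i. i \<in> S \<Longrightarrow> M i s = 0"
  shows "sdet (insert s S) M = M s s * sdet S M"
proof -
  obtain xs where xs: "distinct xs" "set xs = S" using finite_distinct_list[OF assms(1)] by auto
  have "sdet (insert s S) M = ldet (xs @ [s]) M"
    by (rule sdet_eq_ldet) (use xs assms in auto)
  then show ?thesis using ldet_snoc[of xs M s] assms xs
      by (simp add: sdet_eq_ldet[OF xs] mult.commute)
qed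

lemma sdet_diag:
  assumes "finite S" "\<And>i j. i \<in> S \<Longrightarrow> j \<in> S \<Longrightarrow> i \<noteq> j \<Longrightarrow> M i j = 0"
  shows "sdet S M = (\<Prod>i\<in>S. M i i)"
  using assms
proof (induction S rule: finite_induct)
  case (insert x F)
  have "sdet (insert x F) M = M x x * sdet F M"
    using insert.hyps insert.prems by (intro sdet_insert) auto
  then show ?case using insert by simp
qed simp

text \<open>A Gaussian elimination step without division. Column \<open>s\<close> has only its
  diagonal entry and the entry -1 in row \<open>p\<close>, so \<open>M s s\<close> times row
  \<open>p\<close> plus row \<open>s\<close> clears it. The row operation multiplies the determinant
  by \<open>M s s\<close>, expansion along the cleared column yields the same factor, and an
  integral domain allows cancelling it.\<close>

lemma sdet_eliminate:
  fixes M :: "'i \<Rightarrow> 'i \<Rightarrow> 'a :: idom"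
  assumes S: "finite S" "s \<notin> S" "p \<in> S" and c: "M s s \<noteq> 0"
    and M: "M p s = - 1" "\<And>i. i \<in> S \<Longrightarrow> i \<noteq> p \<Longrightarrow> M i s = 0"
  shows "sdet (insert s S) M = sdet S (\<lambda>i j. if i = p then M s s * M p j + M s j else M i j)"
proof -
  let ?c = "M s s" and ?R = "insert s S"
  define T where "T i j = (if i = j then if i = p then ?c else 1 else if i = p \<and> j
      = s then 1 else 0)" for i j
  define M' where "M' i j = (if i = p then ?c * M p j + M s j else M i j)" for i j
  have ps: "p \<noteq> s" using S by auto
  have "sdet ?R T = sdet ?R (\<lambda>i j. T j i)" by (rule sdet_transpose[symmetric])
  \<comment> \<open>The only off-diagonal entry of \<open>T\<close> lies in column \<open>s\<close>;
    in the transpose that column is diagonal, as \<open>sdet_insert\<close> requires.\<close>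
  also have "\<dots> = T s s * sdet S (\<lambda>i j. T j i)"
    using S ps by (subst sdet_insert) (auto simp: T_def)
  also have "sdet S (\<lambda>i j. T j i) = (\<Prod>i\<in>S. T i i)"
    using S by (subst sdet_diag) (auto simp: T_def)
  also have "\<dots> = ?c" using S by (simp add: T_def)
  finally have T: "sdet ?R T = ?c" using ps by (simp add: T_def[of s s])
  have prod: "(\<Sum>k\<in>?R. T i k * M k j) = M' i j" if "i \<in> ?R" for i j
  proof (cases "i = p")
    case True
    have "(\<Sum>k\<in>?R. T i k * M k j) = (\<Sum>k\<in>{p, s}. T i k * M k j)"
      by (rule sum.mono_neutral_right) (use S True in \<open>auto simp: T_def\<close>)
    then show ?thesis using True ps by (simp add: T_def M'_def)
  next
    case False
    have "(\<Sum>k\<in>?R. T i k * M k j) = (\<Sum>k\<in>{i}. T i k * M k j)"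
      by (rule sum.mono_neutral_right) (use S False that in \<open>auto simp: T_def\<close>)
    then show ?thesis using False by (simp add: T_def M'_def)
  qed
  have "?c * sdet ?R M = sdet ?R T * sdet ?R M" using T by simp
  also have "\<dots> = sdet ?R (\<lambda>i j. \<Sum>k\<in>?R. T i k * M k j)" using S
      by (simp only: sdet_mult finite_insert)
  also have "\<dots> = sdet ?R M'" using S prod by (intro sdet_cong) auto
  also have "\<dots> = M' s s * sdet S M'" using S M by (intro sdet_insert) (auto simp: M'_def)
  also have "M' s s = ?c" using ps by (simp add: M'_def)
  finally show ?thesis using c by (simp add: M'_def[abs_def])
qed

section \<open>Permutations with weighted points\<close>

text \<open>
  \<open>wcycles S f a cs\<close>: f permutes S, and cs lists the sums of the weights a along its cycles. The
  rule \<open>merge\<close> takes s out of its cycle and hands its weight to its predecessor p.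
\<close>

inductive wcycles :: "'i set \<Rightarrow> ('i \<Rightarrow> 'i) \<Rightarrow> ('i \<Rightarrow> nat) \<Rightarrow> nat list \<Rightarrow> bool" where
  empty: "wcycles {} f a []"
| fixed: "s \<notin> S \<Longrightarrow> f s = s \<Longrightarrow> f ` S \<subseteq> S \<Longrightarrow> wcycles S f a cs \<Longrightarrow> wcycles (insert s S) f a (a s # cs)"
| merge: "s \<notin> S \<Longrightarrow> p \<in> S \<Longrightarrow> f p = s \<Longrightarrow> f s \<in> S \<Longrightarrow> f ` (S - {p}) \<subseteq> S \<Longrightarrow>
    wcycles S (f(p := f s)) (a(p := a p + a s)) cs \<Longrightarrow> wcycles (insert s S) f a cs"

lemma wcycles_exists:
  assumes "finite S" "inj_on f S" "f ` S \<subseteq> S"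
  shows "\<exists>cs. wcycles S f a cs"
  using assms
proof (induction S arbitrary: f a rule: finite_induct)
  case empty
  then show ?case using wcycles.empty by blast
next
  case (insert s S)
  have surj: "f ` insert s S = insert s S" using insert by (intro endo_inj_surj) auto
  show ?case
  proof (cases "f s = s")
    case True
    have "f ` S \<subseteq> S" using insert.prems insert.hyps True by (force simp: inj_on_def)
    moreover have "inj_on f S" using insert.prems by (simp add: inj_on_def)
    ultimately obtain cs where "wcycles S f a cs" using insert.IH by blast
    then show ?thesis using wcycles.fixed[of s S f a cs] insert.hyps(2) True \<open>f ` S \<subseteq> S\<close> by blast
  next
    case False
    obtain p where p: "p \<in> insert s S" "f p = s" using surj by (metis imageE insertI1)
    then have p': "p \<in> S" using False by auto
    have fs: "f s \<in> S" using insert.prems False by auto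
    have im: "f ` (S - {p}) \<subseteq> S"
    proof
      fix y assume "y \<in> f ` (S - {p})"
      then obtain x where x: "x \<in> S" "x \<noteq> p" "y = f x" by auto
      then have "y \<in> insert s S" using insert.prems by auto
      moreover have "y \<noteq> s" using x p p' insert.prems by (auto simp: inj_on_def)
      ultimately show "y \<in> S" by auto
    qed
    let ?f = "f(p := f s)"
    have "inj_on ?f S" using insert.prems insert.hyps p p' unfolding inj_on_def
      by (metis fun_upd_apply insertCI)
    moreover have "?f ` S \<subseteq> S" using im fs by auto
    ultimately obtain cs where "wcycles S ?f (a(p := a p + a s)) cs" using insert.IH by blast
    then show ?thesis using wcycles.merge[OF insert.hyps(2) p' p(2) fs im] by blast
  qed
qed

lemma wcycles_finite: "wcycles S f a cs \<Longrightarrow> finite S"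
  by (induction rule: wcycles.induct) auto

lemma wcycles_pos:
  assumes "wcycles S f a cs" "\<And>i. i \<in> S \<Longrightarrow> a i > 0" "c \<in> set cs"
  shows "c > 0"
  using assms
proof (induction rule: wcycles.induct)
  case (merge s S p f a cs)
  have "0 < (a(p := a p + a s)) i" if "i \<in> S" for i
    using merge.prems(1)[of i] merge.prems(1)[of s] that by simp
  then show ?case using merge.IH merge.prems(2) by blast
qed auto

lemma wcycles_sum: "wcycles S f a cs \<Longrightarrow> sum_list cs = (\<Sum>i\<in>S. a i)"
proof (induction rule: wcycles.induct)
  case (fixed s S f a cs)
  then show ?case using wcycles_finite[OF fixed(4)] by simp
next
  case (merge s S p f a cs)
  have fin: "finite S" using wcycles_finite[OF merge(6)] .
  have "(\<Sum>i\<in>S. (a(p := a p + a s)) i) = (\<Sum>i\<in>S - {p}. a i) + (a p + a s)"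
    using merge(2) fin by (subst sum.remove[of _ p]) auto
  also have "\<dots> = (\<Sum>i\<in>S. a i) + a s"
    using merge(2) fin by (subst (2) sum.remove[of _ p]) auto
  finally show ?case using merge fin by simp
qed simp

lemma wcycles_Nil_iff: "wcycles S f a cs \<Longrightarrow> cs = [] \<longleftrightarrow> S = {}"
  by (induction rule: wcycles.induct) auto

text \<open>The weights make the induction close: eliminating \<open>s\<close> multiplies the
  diagonal entry of its predecessor by \<open>x ^ a s\<close>, so the weights add up, and a fixed
  point of weight c contributes \<open>x ^ c - 1\<close>. The pivot \<open>x ^ a s\<close> is
  nonzero because x is. With all weights 1 this is the characteristic polynomial of a permutation
  matrix.\<close>

lemma wcycles_det:
  fixes x :: "'a :: idom"
  assumes "wcycles S f a cs" "x \<noteq> 0"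
  shows "sdet S (\<lambda>i j. (if i = j then x ^ a i else 0) - (if j = f i then 1 else 0)) =
    (\<Prod>c\<leftarrow>cs. x ^ c - 1)"
  using assms(1)
proof (induction rule: wcycles.induct)
  case (fixed s S f a cs)
  have "finite S" using wcycles_finite[OF fixed(4)] .
  with fixed show ?case by (subst sdet_insert) auto
next
  case (merge s S p f a cs)
  have fin: "finite S" using wcycles_finite[OF merge(6)] .
  define M where "M i j = (if i = j then x ^ a i else 0) - (if j = f i then 1 else 0)" for i j
  have fs: "f s \<noteq> s" using merge by auto
  then have ss: "M s s = x ^ a s" by (simp add: M_def)
  have "sdet (insert s S) M = sdet S (\<lambda>i j. if i = p then M s s * M p j + M s j else M i j)"
  proof (rule sdet_eliminate)
    show "M s s \<noteq> 0" using ss assms(2) by simp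
    show "M p s = - 1" using merge by (auto simp: M_def)
    show "M i s = 0" if "i \<in> S" "i \<noteq> p" for i
      using that merge by (auto simp: M_def)
  qed (use fin merge in auto)
  also have "\<dots> = sdet S (\<lambda>i j. (if i = j then x ^ (a(p := a p + a s)) i else 0) - (if j
      = (f(p := f s)) i then 1 else 0))"
  proof (rule sdet_cong[OF fin])
    fix i j assume ij: "i \<in> S" "j \<in> S"
    show "(if i = p then M s s * M p j + M s j else M i j) =
      (if i = j then x ^ (a(p := a p + a s)) i else 0) - (if j = (f(p := f s)) i then 1 else 0)"
      unfolding ss using ij merge(1,3) by (auto simp: M_def power_add)
  qed
  finally show ?case using merge.IH by (simp only: M_def[abs_def])
qed simp

text \<open>In the case \<open>merge\<close>, a set closed under the shortened map becomes closed
  under \<open>f\<close> by adding \<open>s\<close> if it contains \<open>p\<close>, and removing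
  \<open>s\<close> leads back. In the case \<open>fixed\<close>, the singleton of \<open>s\<close>
  is closed, so it must be everything.\<close>

lemma wcycles_single:
  assumes "wcycles S f a cs" "S \<noteq> {}"
  shows "(\<forall>T\<subseteq>S. T \<noteq> {} \<longrightarrow> f ` T \<subseteq> T \<longrightarrow> T = S) \<longleftrightarrow> length cs = 1"
  using assms
proof (induction rule: wcycles.induct)
  case (fixed s S f a cs)
  show ?case
  proof
    assume "\<forall>T\<subseteq>insert s S. T \<noteq> {} \<longrightarrow> f ` T \<subseteq> T \<longrightarrow> T = insert s S"
    from this[rule_format, of "{s}"] have "S = {}" using fixed by auto
    then show "length (a s # cs) = 1" using wcycles_Nil_iff[OF fixed(4)] by simp
  next
    assume "length (a s # cs) = 1"
    then have "S = {}" using wcycles_Nil_iff[OF fixed(4)] by simp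
    then show "\<forall>T\<subseteq>insert s S. T \<noteq> {} \<longrightarrow> f ` T \<subseteq> T \<longrightarrow> T = insert s S" by auto
  qed
next
  case (merge s S p f a cs)
  let ?f = "f(p := f s)"
  have IH: "(\<forall>T\<subseteq>S. T \<noteq> {} \<longrightarrow> ?f ` T \<subseteq> T \<longrightarrow> T = S) \<longleftrightarrow> length cs = 1" using merge by auto
  have "(\<forall>T\<subseteq>insert s S. T \<noteq> {} \<longrightarrow> f ` T \<subseteq> T \<longrightarrow> T = insert s S) \<longleftrightarrow>
    (\<forall>T\<subseteq>S. T \<noteq> {} \<longrightarrow> ?f ` T \<subseteq> T \<longrightarrow> T = S)"
  proof (intro iffI allI impI)
    fix T assume *: "\<forall>T\<subseteq>insert s S. T \<noteq> {} \<longrightarrow> f ` T \<subseteq> T \<longrightarrow> T = insert s S"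
      and T: "T \<subseteq> S" "T \<noteq> {}" "?f ` T \<subseteq> T"
    show "T = S"
    proof (cases "p \<in> T")
      case True
      have "f ` (insert s T) \<subseteq> insert s T"
      proof
        fix y assume "y \<in> f ` insert s T"
        then obtain x where x: "x \<in> insert s T" "y = f x" by auto
        have "?f p \<in> T" using True T(3) by blast
        then have "f s \<in> T" by simp
        moreover have "f x \<in> T" if "x \<in> T" "x \<noteq> p" for x using T(3) that
            by (metis fun_upd_apply image_subset_iff)
        ultimately show "y \<in> insert s T" using x merge(3) by (cases "x = p") auto
      qed
      then have "insert s T = insert s S" using *[rule_format, of "insert s T"] T by auto
      then show ?thesis using T merge(1) by auto
    next
      case False
      then have "f ` T \<subseteq> T" using T(3) by auto
      then have "T = insert s S" using *[rule_format, of T] T by auto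
      then show ?thesis using T(1) merge(1) by auto
    qed
  next
    fix T assume *: "\<forall>T\<subseteq>S. T \<noteq> {} \<longrightarrow> ?f ` T \<subseteq> T \<longrightarrow> T = S"
      and T: "T \<subseteq> insert s S" "T \<noteq> {}" "f ` T \<subseteq> T"
    have "T - {s} \<noteq> {}" using T merge(1,4) by (metis Diff_eq_empty_iff image_subset_iff insertCI
        singletonD subset_singletonD)
    moreover have "?f ` (T - {s}) \<subseteq> T - {s}"
    proof
      fix y assume "y \<in> ?f ` (T - {s})"
      then obtain x where x: "x \<in> T" "x \<noteq> s" "y = ?f x" by blast
      show "y \<in> T - {s}"
      proof (cases "x = p")
        case True
        then have "s \<in> T" using x(1) T(3) merge(3) by blast
        then have "f s \<in> T" using T(3) by blast
        then show ?thesis using True x(3) merge(1,4) by auto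
      next
        case False
        have "x \<in> S" using x T by auto
        then have "f x \<in> S" using merge(5) False by auto
        then show ?thesis using False x T(3) merge(1) by auto
      qed
    qed
    ultimately have eq: "T - {s} = S" using *[rule_format, of "T - {s}"] T by auto
    then have "p \<in> T" using merge(2) by auto
    then have "s \<in> T" using T(3) merge(3) by blast
    then show "T = insert s S" using eq by auto
  qed
  then show ?case using IH by simp
qed simp

text \<open>Along a cycle of total weight c all values follow from a single one, which has to
  satisfy \<open>z ^ (2 ^ c) = z\<close>. The product is the one of \<open>wcycles_det\<close> at
  \<open>x = 2\<close>; this is how a determinant comes to count units.\<close>

lemma wcycles_card_solutions:
  assumes "wcycles S f a cs"
    and roots: "\<And>c. c > 0 \<Longrightarrow> card {z :: 'k :: field. z \<noteq> 0 \<and> z ^ (2 ^ c) = z} = 2 ^ c - 1"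
    and "\<And>i. i \<in> S \<Longrightarrow> a i > 0"
  shows "card {v \<in> S \<rightarrow>\<^sub>E (UNIV - {0 :: 'k}). \<forall>i\<in>S. v (f i) = v i ^ (2 ^ a i)} = (\<Prod>c\<leftarrow>cs. 2 ^ c - 1)"
  using assms(1,3)
proof (induction rule: wcycles.induct)
  case (empty f a)
  then show ?case by simp
next
  case (fixed s S f a cs)
  let ?Z = "{z :: 'k. z \<noteq> 0 \<and> z ^ (2 ^ a s) = z}"
  let ?V = "{v \<in> S \<rightarrow>\<^sub>E (UNIV - {0 :: 'k}). \<forall>i\<in>S. v (f i) = v i ^ (2 ^ a i)}"
  let ?W = "{v \<in> insert s S \<rightarrow>\<^sub>E (UNIV - {0 :: 'k}). \<forall>i\<in>insert s S. v (f i) = v i ^ (2 ^ a i)}"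
  have fS: "f i \<in> S" "f i \<noteq> s" "i \<noteq> s" if "i \<in> S" for i using fixed that by auto
  have "bij_betw (\<lambda>(z, v). v(s := z)) (?Z \<times> ?V) ?W"
  \<comment> \<open>Functions in \<open>PiE\<close> are \<open>undefined\<close> off their domain,
    so forgetting the value at \<open>s\<close> means resetting it.\<close>
  proof (rule bij_betwI[where g = "\<lambda>v. (v s, v(s := undefined))"], goal_cases)
    case 1
    then show ?case using fS fixed(1,2) by (auto simp: PiE_iff extensional_def)
  next
    case 2
    then show ?case using fS fixed(1,2) by (auto simp: PiE_iff extensional_def)
  next
    case (3 x)
    then show ?case using fixed(1) by (auto simp: PiE_iff extensional_def fun_eq_iff)
  next
    case (4 v)
    then show ?case by auto
  qed
  then have "card ?W = card (?Z \<times> ?V)" by (simp add: bij_betw_same_card)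
  also have "\<dots> = (2 ^ a s - 1) * card ?V" using roots[of "a s"] fixed.prems
      by (simp add: card_cartesian_product)
  also have "card ?V = (\<Prod>c\<leftarrow>cs. 2 ^ c - 1)" using fixed by auto
  finally show ?case by simp
next
  case (merge s S p f a cs)
  let ?a = "a(p := a p + a s)" and ?f = "f(p := f s)"
  let ?V = "{v \<in> S \<rightarrow>\<^sub>E (UNIV - {0 :: 'k}). \<forall>i\<in>S. v (?f i) = v i ^ (2 ^ ?a i)}"
  let ?W = "{v \<in> insert s S \<rightarrow>\<^sub>E (UNIV - {0 :: 'k}). \<forall>i\<in>insert s S. v (f i) = v i ^ (2 ^ a i)}"
  have fS: "f i \<in> S" "f i \<noteq> s" if "i \<in> S" "i \<noteq> p" for i using merge that by auto
  have fs: "f s \<noteq> s" "p \<noteq> s" using merge by auto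
  have "bij_betw (\<lambda>v. v(s := v p ^ 2 ^ a p)) ?V ?W"
  proof (rule bij_betwI[where g = "\<lambda>v. v(s := undefined)"], goal_cases)
    case 1
    show ?case
    proof (rule Pi_I)
      fix v assume v: "v \<in> ?V"
      let ?w = "v(s := v p ^ 2 ^ a p)"
      have "?w \<in> insert s S \<rightarrow>\<^sub>E (UNIV - {0})" using v merge(1,2)
          by (auto simp: PiE_iff extensional_def)
      moreover have "?w (f i) = ?w i ^ 2 ^ a i" if i: "i \<in> insert s S" for i
      proof -
        have vp: "v (f s) = v p ^ (2 ^ (a p + a s))" using v merge(2) by fastforce
        consider "i = s" | "i = p" | "i \<in> S" "i \<noteq> p" "i \<noteq> s" using i by blast
        then show ?thesis
        proof cases
          case 1
          then show ?thesis using vp fs by (simp add: power_add power_mult)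
        next
          case 2
          then show ?thesis using fs merge(3) by simp
        next
          case 3
          then have "v (?f i) = v i ^ 2 ^ ?a i" using v by blast
          then show ?thesis using 3 fS[of i] by simp
        qed
      qed
      ultimately show "?w \<in> ?W" by auto
    qed
  next
    case 2
    show ?case
    proof (rule Pi_I)
      fix v assume v: "v \<in> ?W"
      let ?w = "v(s := undefined)"
      have "?w \<in> S \<rightarrow>\<^sub>E (UNIV - {0})" using v merge(1,2) by (auto simp: PiE_iff extensional_def)
      moreover have "?w (?f i) = ?w i ^ 2 ^ ?a i" if "i \<in> S" for i
      proof (cases "i = p")
        case True
        have "v (f s) = v s ^ 2 ^ a s" "v s = v p ^ 2 ^ a p" using v merge(2,3) by auto
        then show ?thesis using True fs by (simp add: power_add power_mult)
      next
        case False
        then show ?thesis using v fS[OF that] that merge(1) by auto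
      qed
      ultimately show "?w \<in> ?V" by auto
    qed
  next
    case (3 v)
    then show ?case using merge(1) by (auto simp: PiE_iff extensional_def fun_eq_iff)
  next
    case (4 v)
    then have "v s = v p ^ 2 ^ a p" using merge(2,3) by auto
    then show ?case using fs by auto
  qed
  then have "card ?W = card ?V" by (simp add: bij_betw_same_card)
  also have "\<dots> = (\<Prod>c\<leftarrow>cs. 2 ^ c - 1)" using merge by (intro merge.IH) auto
  finally show ?case .
qed

section \<open>The sum of the determinants over all choices of blocks\<close>

lemma sdet_lower_triangular:
  fixes M :: "nat \<Rightarrow> nat \<Rightarrow> 'a :: comm_ring_1"
  assumes "\<And>i j. i < j \<Longrightarrow> j < n \<Longrightarrow> M i j = 0"
  shows "sdet {..<n} M = (\<Prod>i<n. M i i)"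
  using assms
proof (induction n)
  case (Suc n)
  have "sdet (insert n {..<n}) M = M n n * sdet {..<n} M"
    using Suc.prems by (intro sdet_insert) auto
  then show ?case using Suc by (simp add: lessThan_Suc mult.commute)
qed simp

lemma prod_lessThan_add: "(\<Prod>i<n + m. f i) = (\<Prod>i<n. f i) * (\<Prod>i<m. f (n + i))"
  for f :: "nat \<Rightarrow> 'a :: comm_monoid_mult"
  by (induction m) (simp_all add: mult.assoc)

lemma sdet_leibniz:
  "sdet {..<n} M = (\<Sum>p | p permutes {0..<n}. signof p * (\<Prod>i<n. M i (p i)))"
proof -
  have "sdet {..<n} M = (\<Sum>p | p permutes {0..<n}. signof p * (\<Prod>i
      = 0..<n. mat n n (\<lambda>(i, j). M i j) $$ (i, p i)))"
    unfolding sdet_eq_det by (rule det_def') simp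
  also have "\<dots> = (\<Sum>p | p permutes {0..<n}. signof p * (\<Prod>i<n. M i (p i)))"
  proof (rule sum.cong[OF refl], goal_cases)
    case (1 p)
    then have "p i < n" if "i < n" for i using permutes_in_image[of p "{0..<n}" i] that by auto
    then show ?case by (simp add: atLeast0LessThan)
  qed
  finally show ?thesis .
qed

text \<open>Row \<open>i\<close> depends on \<open>\<sigma> i\<close> alone, so in each Leibniz term
  the sum over all choices distributes over the first \<open>n\<close> factors. The other rows have
  to be the same for every choice; \<open>sum_det_bw_succ\<close> arranges this.\<close>

lemma sum_sdet_choices:
  fixes R :: "nat \<Rightarrow> nat \<Rightarrow> 'a :: comm_ring_1"
  assumes B: "finite B"
  shows "(\<Sum>\<sigma>\<in>{..<n} \<rightarrow>\<^sub>E B. sdet {..<n + m} (\<lambda>i j. if i < n then r i (\<sigma> i) j else R i j)) =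
    sdet {..<n + m} (\<lambda>i j. if i < n then \<Sum>s\<in>B. r i s j else R i j)"
proof -
  let ?N = "n + m" and ?P = "{p. p permutes {0..<n + m}}" and ?S = "{..<n} \<rightarrow>\<^sub>E B"
  have "(\<Sum>\<sigma>\<in>?S. sdet {..<?N} (\<lambda>i j. if i < n then r i (\<sigma> i) j else R i j)) =
    (\<Sum>\<sigma>\<in>?S. \<Sum>p\<in>?P. signof p * ((\<Prod>i<n. r i (\<sigma> i) (p i)) * (\<Prod>i<m. R (n + i) (p (n + i)))))"
    unfolding sdet_leibniz prod_lessThan_add by simp
  also have "\<dots> = (\<Sum>p\<in>?P. \<Sum>\<sigma>\<in>?S. signof p * ((\<Prod>i<n. r i (\<sigma> i) (p i)) * (\<Prod>i<m. R (n + i) (p (n +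
      i)))))"
    by (rule sum.swap)
  also have "\<dots> = (\<Sum>p\<in>?P. signof p * ((\<Sum>\<sigma>\<in>?S. \<Prod>i<n. r i (\<sigma> i) (p i)) * (\<Prod>i<m. R (n + i) (p (n +
      i)))))"
    by (simp add: sum_distrib_left sum_distrib_right)
  also have "\<dots> = (\<Sum>p\<in>?P. signof p * ((\<Prod>i<n. \<Sum>s\<in>B. r i s (p i)) * (\<Prod>i<m. R (n + i) (p (n + i)))))"
    using B by (simp add: prod_sum_PiE)
  also have "\<dots> = sdet {..<?N} (\<lambda>i j. if i < n then \<Sum>s\<in>B. r i s j else R i j)"
    unfolding sdet_leibniz prod_lessThan_add by simp
  finally show ?thesis .
qed

text \<open>
  The block i of the transform is 01 if \<open>\<sigma> i = 0\<close> and 10 if \<open>\<sigma> i = 1\<close>. The row \<open>j < n\<close> of the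
  Burrows--Wheeler matrix starts with 0, the row \<open>n + j\<close> with 1, and their left rotations are the
  two rows of block j, ending with that letter: \<open>bw_succ\<close> is the inverse of the LF mapping.
\<close>

definition bw_succ :: "nat \<Rightarrow> (nat \<Rightarrow> nat) \<Rightarrow> nat \<Rightarrow> nat"
  where "bw_succ n \<sigma> j = (if j < n then 2 * j + \<sigma> j else 2 * (j - n) + (1 - \<sigma> (j - n)))"

text \<open>Rows \<open>j\<close> and \<open>n + j\<close> of the permutation matrix both depend on
  \<open>\<sigma> j\<close>, but together they always hit both places of block \<open>j\<close>.
  Hence adding row \<open>j\<close> to row \<open>n + j\<close> leaves the latter independent of the
  choice. Summing the two candidates for a row \<open>i < n\<close> gives twice their average,
  whence \<open>2 ^ n\<close>.\<close>

lemma sum_det_bw_succ: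
  fixes x :: real
  shows "(\<Sum>\<sigma>\<in>{..<n} \<rightarrow>\<^sub>E {0, 1}. sdet {..<2 * n} (\<lambda>i j. (if i = j then x else 0) - (if j
      = bw_succ n \<sigma> i then 1 else 0))) =
    2 ^ n * sdet {..<2 * n} (\<lambda>i j. (if i = j then x else 0) - (if j div 2
        = i mod n then 1 / 2 else 0))"
    (is "(\<Sum>\<sigma>\<in>?S. sdet ?R (?M \<sigma>)) = _ * sdet ?R ?A")
proof -
  \<comment> \<open>Multiplication by \<open>T c\<close> scales each row \<open>i < n\<close> by
    \<open>c\<close> and adds the unscaled row \<open>i\<close> to row \<open>n + i\<close>. It is
    used with \<open>c = 1\<close> for a single choice and with \<open>c = 2\<close> for the
    average.\<close>
  define T where "T c i j = (if i < n then if i = j then c else 0 else if j = i \<or> j + n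
      = i then 1 else 0)"
    for c :: real and i j :: nat
  have T: "sdet ?R (T c) = c ^ n" for c
  proof -
    have "sdet ?R (T c) = (\<Prod>i<n + n. T c i i)" unfolding mult_2
      by (rule sdet_lower_triangular) (auto simp: T_def)
    also have "\<dots> = c ^ n" unfolding prod_lessThan_add by (simp add: T_def)
    finally show ?thesis .
  qed
  have mult: "(\<Sum>k\<in>?R. T c i k * M k j) = (if i < n then c * M i j else M i j + M (i - n) j)"
    if "i \<in> ?R" for c i j and M :: "nat \<Rightarrow> nat \<Rightarrow> real"
  proof (cases "i < n")
    case True
    then have "(\<Sum>k\<in>?R. T c i k * M k j) = (\<Sum>k\<in>{i}. T c i k * M k j)"
      by (intro sum.mono_neutral_right) (auto simp: T_def)
    then show ?thesis using True by (simp add: T_def)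
  next
    case False
    then have "(\<Sum>k\<in>?R. T c i k * M k j) = (\<Sum>k\<in>{i, i - n}. T c i k * M k j)"
      using that by (intro sum.mono_neutral_right) (auto simp: T_def)
    moreover have "i \<noteq> i - n" using that False by auto
    ultimately show ?thesis using False by (simp add: T_def)
  qed
  define r where "r i s j = (if i = j then x else 0) - (if j
      = 2 * i + s then 1 else 0)" for i s j :: nat
  define R where "R i j = (if i = j then x else 0) + (if i - n = j then x else 0) - (if j div 2
      = i - n then 1 else 0)"
    for i j :: nat
  have 1: "sdet ?R (?M \<sigma>) = sdet {..<n + n} (\<lambda>i j. if i < n then r i (\<sigma> i) j else R i j)" if \<sigma>: "\<sigma>
      \<in> ?S" for \<sigma>
  proof -
    have "sdet ?R (?M \<sigma>) = sdet ?R (T 1) * sdet ?R (?M \<sigma>)" by (simp add: T)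
    also have "\<dots> = sdet ?R (\<lambda>i j. \<Sum>k\<in>?R. T 1 i k * ?M \<sigma> k j)"
        by (simp only: sdet_mult finite_lessThan)
    also have "\<dots> = sdet ?R (\<lambda>i j. if i < n then r i (\<sigma> i) j else R i j)"
    proof (rule sdet_cong[OF finite_lessThan], goal_cases)
      case (1 i j)
      show ?case
      proof (cases "i < n")
        case True
        then show ?thesis unfolding mult[OF 1(1), of 1 "?M \<sigma>" j] by (simp add: r_def bw_succ_def)
      next
        case False
        then have "i - n < n" using 1 by auto
        then have "\<sigma> (i - n) = 0 \<or> \<sigma> (i - n) = 1" using \<sigma> by (auto simp: PiE_iff)
        moreover have "j div 2 = i - n \<longleftrightarrow> j = 2 * (i - n) \<or> j = Suc (2 * (i - n))" by presburger
        ultimately have "(if j = bw_succ n \<sigma> i then 1 else 0) + (if j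
            = bw_succ n \<sigma> (i - n) then 1 else 0) =
            (if j div 2 = i - n then 1 else 0 :: real)"
          using False \<open>i - n < n\<close> by (auto simp: bw_succ_def)
        then show ?thesis unfolding mult[OF 1(1), of 1 "?M \<sigma>" j] R_def
          by (simp only: False if_False)
      qed
    qed
    finally show ?thesis by (simp only: mult_2)
  qed
  have "2 ^ n * sdet ?R ?A = sdet ?R (T 2) * sdet ?R ?A" by (simp add: T)
  also have "\<dots> = sdet ?R (\<lambda>i j. \<Sum>k\<in>?R. T 2 i k * ?A k j)" by (simp only: sdet_mult finite_lessThan)
  also have "\<dots> = sdet ?R (\<lambda>i j. if i < n then \<Sum>s\<in>{0, 1}. r i s j else R i j)"
  proof (rule sdet_cong[OF finite_lessThan], goal_cases)
    case (1 i j)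
    show ?case
    proof (cases "i < n")
      case True
      have "j div 2 = i \<longleftrightarrow> j = 2 * i \<or> j = Suc (2 * i)" by presburger
      then show ?thesis unfolding mult[OF 1(1), of 2 ?A j] using True by (auto simp: r_def)
    next
      case False
      then have "i mod n = i - n" "(i - n) mod n = i - n" using 1 by (auto simp: mod_if)
      then show ?thesis unfolding mult[OF 1(1), of 2 ?A j] using False by (auto simp: R_def)
    qed
  qed
  finally show ?thesis using sum_sdet_choices[of "{0, 1}" n n r R] 1
      by (simp only: mult_2 finite.intros cong: sum.cong)
qed

text \<open>
  With \<open>(G f) i = f i - f (i + 1) + f 0\<close> and \<open>(J f) i = f 0\<close>, the adjacency matrix A and the
  doubling map D satisfy \<open>A G = G (D + J)\<close>; moreover \<open>D J = J\<close>, and G is nonsingular.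
\<close>

lemma sdet_doubling:
  fixes x :: real and N :: nat
  assumes N: "N > 0" and x: "x \<noteq> 1"
  shows "sdet {..<N} (\<lambda>i j. (if i = j then x else 0) - ((if j = 2 * i mod N then 1 else 0) + (if j
      = (2 * i + 1) mod N then 1 else 0)))
     = (x - 2) / (x - 1) * sdet {..<N} (\<lambda>i j. (if i = j then x else 0) - (if j
         = 2 * i mod N then 1 else 0))"
    (is "sdet ?R ?A = _ * sdet ?R ?D")
proof -
  \<comment> \<open>Differences make the two edges telescope: \<open>A G f\<close> at i is f(2i) -
    f(2i + 2) + 2 f(0), with indices modulo \<open>N\<close>. The plain difference operator kills
    the constants; the summand f(0) repairs this at the price of \<open>J\<close>.\<close>
  define G where "G i j = ((if i = j then 1 else 0) - (if j = Suc i mod N then 1 else 0)) + (if j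
      = 0 then 1 else 0 :: real)" for i j
  \<comment> \<open>By \<open>D J = J\<close>, the product of \<open>x - D\<close> and
    \<open>E\<close> is \<open>x - D - J\<close>, so the rank-one term splits off with the
    determinant 1 - 1/(x - 1).\<close>
  define E where "E i j = (if i = j then 1 else 0) - (if j
      = 0 then 1 / (x - 1) else 0 :: real)" for i j :: nat
  define D' where "D' i j = ?D i j - (if j = 0 then 1 else 0)" for i j
  have delta: "(\<Sum>k<N. (if k = a then c else 0) * f k)
      = c * f a" if "a < N" for a c and f :: "nat \<Rightarrow> real"
  proof -
    have "(\<Sum>k<N. (if k = a then c else 0) * f k) = (\<Sum>k<N. if k = a then c * f k else 0)"
      by (rule sum.cong) auto
    then show ?thesis using that by simp
  qed
  have delta': "(\<Sum>k<N. (if a = k then c else 0) * f k)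
      = c * f a" if "a < N" for a c and f :: "nat \<Rightarrow> real"
    using delta[OF that, of c f] by (simp only: eq_commute[of a])
  have mN: "a mod N < N" for a using N by simp
  have comm: "sdet ?R ?A * sdet ?R G = sdet ?R G * sdet ?R D'"
  proof -
    have "sdet ?R (\<lambda>i j. \<Sum>k\<in>?R. ?A i k * G k j) = sdet ?R (\<lambda>i j. \<Sum>k\<in>?R. G i k * D' k j)"
    proof (rule sdet_cong[OF finite_lessThan], goal_cases)
      case (1 i j)
      have i: "i < N" using 1 by simp
      have "(\<Sum>k\<in>?R. ?A i k * G k j) = x * G i j - G (2 * i mod N) j - G ((2 * i + 1) mod N) j"
        by (simp only: left_diff_distrib distrib_right sum.distrib sum_subtractf delta[OF mN]
            delta'[OF i])
      moreover have "(\<Sum>k\<in>?R. G i k * D' k j) = D' i j - D' (Suc i mod N) j + D' 0 j"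
        by (simp only: G_def left_diff_distrib distrib_right sum.distrib sum_subtractf delta[OF
            mN] delta'[OF i] delta[OF N] mult_1)
      moreover have "Suc (2 * i mod N) mod N = (2 * i + 1) mod N" "Suc ((2 * i + 1) mod N) mod N
          = 2 * (Suc i mod N) mod N"
        by (simp_all add: mod_Suc_eq mod_mult_right_eq)
      ultimately show ?case
        by (auto simp: G_def D'_def)
    qed
    then show ?thesis by (simp only: sdet_mult finite_lessThan)
  qed
  have "sdet ?R ?D * sdet ?R E = sdet ?R D'"
  proof -
    have "sdet ?R (\<lambda>i j. \<Sum>k\<in>?R. ?D i k * E k j) = sdet ?R D'"
    proof (rule sdet_cong[OF finite_lessThan], goal_cases)
      case (1 i j)
      have i: "i < N" using 1 by simp
      have "(\<Sum>k\<in>?R. ?D i k * E k j) = x * E i j - E (2 * i mod N) j"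
        by (simp only: left_diff_distrib distrib_right sum.distrib sum_subtractf delta[OF mN]
            delta'[OF i] mult_1)
      moreover have "x / (x - 1) = 1 + 1 / (x - 1)" using x by (simp add: divide_simps)
      ultimately show ?case by (auto simp: E_def D'_def right_diff_distrib)
    qed
    then show ?thesis by (simp only: sdet_mult finite_lessThan)
  qed
  moreover have "sdet ?R E = (x - 2) / (x - 1)"
  proof -
    obtain m where m: "N = Suc m" using N by (cases N) auto
    have "sdet ?R E = (\<Prod>i<N. E i i)" by (rule sdet_lower_triangular) (auto simp: E_def)
    also have "\<dots> = E 0 0" unfolding m prod.lessThan_Suc_shift by (simp add: E_def)
    finally show ?thesis using x by (simp add: E_def field_simps)
  qed
  moreover have "sdet ?R G \<noteq> 0"
  proof
    assume "sdet ?R G = 0"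
    then obtain v where v: "v \<in> carrier_vec N" "v \<noteq> 0\<^sub>v N" "mat N N (\<lambda>(i, j). G i j) *\<^sub>v v = 0\<^sub>v N"
      unfolding sdet_eq_det using det_0_iff_vec_prod_zero[of "mat N N (\<lambda>(i, j). G i j)" N] by auto
    have eq: "v $ i - v $ (Suc i mod N) + v $ 0 = 0" if i: "i < N" for i
    proof -
      have "0 = (mat N N (\<lambda>(i, j). G i j) *\<^sub>v v) $ i" using v(3) i by simp
      also have "\<dots> = (\<Sum>k<N. G i k * v $ k)"
        using i v(1) by (simp add: scalar_prod_def atLeast0LessThan)
      also have "\<dots> = v $ i - v $ (Suc i mod N) + v $ 0"
        by (simp only: G_def left_diff_distrib distrib_right sum.distrib sum_subtractf delta[OF
            mN] delta'[OF i] delta[OF N] mult_1)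
      finally show ?thesis by simp
    qed
    \<comment> \<open>A kernel vector grows linearly, and the wrap-around at \<open>N - 1\<close>
      then says that \<open>N\<close> times its first entry is zero. In characteristic 0 this kills
      it.\<close>
    have lin: "v $ i = real (Suc i) * v $ 0" if "i < N" for i
      using that
    proof (induction i)
      case (Suc i)
      then show ?case using eq[of i] by (simp add: algebra_simps)
    qed simp
    have "v $ (N - 1) = 0" using eq[of "N - 1"] N by simp
    moreover have "real (Suc (N - 1)) = real N" using N by simp
    ultimately have "v $ 0 = 0" using lin[of "N - 1"] N by simp
    then have "v = 0\<^sub>v N" using v(1) lin by (intro eq_vecI) auto
    then show False using v(2) by simp
  qed
  ultimately show ?thesis using comm by (simp add: mult.commute)
qed

text \<open>For a permutation of a finite nonempty set, this says that it is a single cycle.\<close>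

definition irreducible_on :: "'i set \<Rightarrow> ('i \<Rightarrow> 'i) \<Rightarrow> bool"
  where "irreducible_on S f \<longleftrightarrow> (\<forall>T\<subseteq>S. T \<noteq> {} \<longrightarrow> f ` T \<subseteq> T \<longrightarrow> T = S)"

section \<open>The limit at 1 and the number of irreducible choices\<close>

lemma tendsto_power_quotient: "((\<lambda>x :: real. (x ^ c - 1) / (x - 1)) \<longlongrightarrow> real c) (at 1)"
proof -
  have "((\<lambda>x :: real. x ^ c) has_field_derivative real c) (at 1)"
    by (rule derivative_eq_intros refl | simp)+
  then show ?thesis by (simp add: has_field_derivative_iff)
qed

text \<open>Each cycle contributes a simple zero at 1 and the division removes one zero. For a
  single cycle the limit is the derivative of \<open>x ^ c\<close> at 1, with c the size of the
  whole set.\<close>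

lemma tendsto_permutation_det:
  fixes f :: "'i \<Rightarrow> 'i"
  assumes S: "finite S" "S \<noteq> {}" "inj_on f S" "f ` S \<subseteq> S"
  shows "((\<lambda>x :: real. sdet S (\<lambda>i j. (if i = j then x else 0) - (if j
      = f i then 1 else 0)) / (x - 1))
    \<longlongrightarrow> (if irreducible_on S f then real (card S) else 0)) (at 1)"
proof -
  obtain cs where cs: "wcycles S f (\<lambda>_. 1) cs" using wcycles_exists S by blast
  have ne: "cs \<noteq> []" using wcycles_Nil_iff[OF cs] S by simp
  have single: "irreducible_on S f \<longleftrightarrow> length cs = 1" unfolding irreducible_on_def
      using wcycles_single[OF cs S(2)] .
  have sum: "sum_list cs = card S" using wcycles_sum[OF cs] by simp
  have pos: "c > 0" if "c \<in> set cs" for c using wcycles_pos[OF cs _ that] by simp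
  have "((\<lambda>x :: real. (\<Prod>c\<leftarrow>cs. x ^ c - 1) / (x - 1))
      \<longlongrightarrow> (if irreducible_on S f then real (card S) else 0)) (at 1)"
  \<comment> \<open>This rule distinguishes lists with no, one, and at least two entries.\<close>
  proof (cases cs rule: remdups_adj.cases)
    case 1
    then show ?thesis using ne by simp
  next
    case (2 c)
    then show ?thesis using single sum tendsto_power_quotient[of c] by simp
  next
    case (3 c d cs')
    have "((\<lambda>x :: real. (x ^ c - 1) / (x - 1) * ((x ^ d - 1) * (\<Prod>c\<leftarrow>cs'. x ^ c - 1))) \<longlongrightarrow>
      real c * ((1 ^ d - 1) * (\<Prod>c\<leftarrow>cs'. 1 ^ c - 1))) (at 1)"
    proof (intro tendsto_mult tendsto_power_quotient)
      show "((\<lambda>x :: real. \<Prod>c\<leftarrow>cs'. x ^ c - 1) \<longlongrightarrow> (\<Prod>c\<leftarrow>cs'. 1 ^ c - 1)) (at 1)"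
      proof (induction cs')
        case (Cons a cs')
        then show ?case unfolding list.map prod_list.Cons by (intro tendsto_intros)
      qed simp
      show "((\<lambda>x :: real. x ^ d - 1) \<longlongrightarrow> 1 ^ d - 1) (at 1)" by (intro tendsto_intros)
    qed
    then show ?thesis using single 3 by simp
  qed
  moreover have "eventually (\<lambda>x :: real. (\<Prod>c\<leftarrow>cs. x ^ c - 1) / (x - 1) =
     sdet S (\<lambda>i j. (if i = j then x else 0) - (if j = f i then 1 else 0)) / (x - 1)) (at 1)"
  proof -
    \<comment> \<open>\<open>wcycles_det\<close> asks for nonzero x.\<close>
    have "eventually (\<lambda>x :: real. x > 0) (at 1)"
      by (rule order_tendstoD[OF tendsto_ident_at]) simp
    then show ?thesis
    proof eventually_elim
      case (elim x)
      then show ?case using wcycles_det[OF cs, of x, unfolded power_one_right] by simp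
    qed
  qed
  ultimately show ?thesis by (rule Lim_transform_eventually)
qed

lemma bw_succ_less:
  assumes "\<sigma> \<in> {..<n} \<rightarrow>\<^sub>E {0, 1}" "j < 2 * n"
  shows "bw_succ n \<sigma> j < 2 * n"
proof (cases "j < n")
  case True
  then have "\<sigma> j \<in> {0, 1}" using assms(1) by (simp add: PiE_iff)
  then show ?thesis using True by (auto simp: bw_succ_def)
next
  case False
  then have "\<sigma> (j - n) \<in> {0, 1}" using assms by (simp add: PiE_iff)
  then show ?thesis using assms(2) False by (auto simp: bw_succ_def)
qed

text \<open>Halving the image recovers the block, and within block \<open>j\<close> the rows
  \<open>j\<close> and \<open>n + j\<close> take different places.\<close>

lemma inj_on_bw_succ:
  assumes "\<sigma> \<in> {..<n} \<rightarrow>\<^sub>E {0, 1}"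
  shows "inj_on (bw_succ n \<sigma>) {..<2 * n}"
proof (rule inj_onI)
  fix i j assume ij: "i \<in> {..<2 * n}" "j \<in> {..<2 * n}" "bw_succ n \<sigma> i = bw_succ n \<sigma> j"
  have \<sigma>: "\<sigma> k = 0 \<or> \<sigma> k = 1" if "k < n" for k
    using assms that by (auto simp: PiE_iff)
  have div: "bw_succ n \<sigma> k div 2 = (if k < n then k else k - n)" if "k < 2 * n" for k
    using \<sigma>[of k] \<sigma>[of "k - n"] that by (cases "k < n") (auto simp: bw_succ_def)
  have eq: "(if i < n then i else i - n) = (if j < n then j else j - n)"
    using div[of i] div[of j] ij by simp
  show "i = j"
  proof (rule ccontr)
    assume "i \<noteq> j"
    then consider "i < n" "j = i + n" | "j < n" "i = j + n"
      using eq ij by (auto split: if_splits)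
    then show False
    proof cases
      case 1
      then show False using ij(3) \<sigma>[of i] by (auto simp: bw_succ_def)
    next
      case 2
      then show False using ij(3) \<sigma>[of j] by (auto simp: bw_succ_def)
    qed
  qed
qed

lemma sdet_smult: "sdet {..<n} (\<lambda>i j. c * M i j) = c ^ n * sdet {..<n} M"
  unfolding sdet_leibniz prod.distrib by (simp add: sum_distrib_left mult.left_commute)

definition doubling_det :: "nat \<Rightarrow> real \<Rightarrow> real"
  where "doubling_det N x = sdet {..<N} (\<lambda>i j. (if i = j then x else 0) - (if j
      = 2 * i mod N then 1 else 0))"

lemma doubling_det_cont: "isCont (doubling_det N) x"
  unfolding doubling_det_def sdet_leibniz
proof (intro continuous_intros)
  fix p and i :: nat
  show "isCont (\<lambda>x. if i = p i then x else 0) x" for x :: real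
    by (cases "i = p i") simp_all
qed

text \<open>The limit of \<open>G x / (x - 1)\<close> is computed twice. Term by term it is
  \<open>2 * n\<close> for each irreducible choice. Through \<open>sum_det_bw_succ\<close> and
  \<open>sdet_doubling\<close> at \<open>2 * x\<close>, the factor \<open>2 * x - 2\<close> cancels
  against \<open>x - 1\<close>, leaving 2/(2x - 1) and the doubling determinant. The powers
  \<open>2 ^ n\<close> from averaging and \<open>(1 / 2) ^ (2 * n)\<close> from clearing the halves
  combine to \<open>(1 / 2) ^ n\<close>.\<close>

lemma card_irreducible_bw_succ:
  assumes n: "n > 0"
  shows "real (n * card {\<sigma> \<in> {..<n} \<rightarrow>\<^sub>E {0, 1}. irreducible_on {..<2 * n} (bw_succ n \<sigma>)}) * 2 ^ n
      = doubling_det (2 * n) 2"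
proof -
  let ?S = "{..<n} \<rightarrow>\<^sub>E {0, 1 :: nat}" and ?R = "{..<2 * n}"
  define E where "E = card {\<sigma> \<in> ?S. irreducible_on ?R (bw_succ n \<sigma>)}"
  define G where "G x = (\<Sum>\<sigma>\<in>?S. sdet ?R (\<lambda>i j. (if i = j then x else 0) - (if j
      = bw_succ n \<sigma> i then 1 else 0)))" for x :: real
  have "((\<lambda>x. \<Sum>\<sigma>\<in>?S. sdet ?R (\<lambda>i j. (if i = j then x else 0) - (if j
      = bw_succ n \<sigma> i then 1 else 0)) / (x - 1)) \<longlongrightarrow>
    (\<Sum>\<sigma>\<in>?S. if irreducible_on ?R (bw_succ n \<sigma>) then real (card ?R) else 0)) (at 1)"
  proof (rule tendsto_sum, rule tendsto_permutation_det)
    fix \<sigma> assume "\<sigma> \<in> ?S"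
    then show "inj_on (bw_succ n \<sigma>) ?R" "bw_succ n \<sigma> ` ?R \<subseteq> ?R"
      using inj_on_bw_succ[of \<sigma> n] bw_succ_less[of \<sigma> n]
          by (simp_all only: image_subset_iff lessThan_iff simp_thms) blast
  qed (use n in \<open>auto simp: lessThan_empty_iff\<close>)
  moreover have "(\<Sum>\<sigma>\<in>?S. if irreducible_on ?R (bw_succ n \<sigma>) then real (card ?R) else 0)
      = real (2 * n * E)"
  proof -
    have "finite ?S" by (simp add: finite_PiE)
    then show ?thesis unfolding E_def by (subst sum.inter_filter[symmetric]) simp_all
  qed
  ultimately have lim1: "((\<lambda>x. G x / (x - 1)) \<longlongrightarrow> real (2 * n * E)) (at 1)"
    by (simp only: G_def sum_divide_distrib)
  have G: "G x / (x - 1) = (1 / 2) ^ n * (2 / (2 * x - 1) * doubling_det (2 * n) (2 * x))"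
    if x: "x \<noteq> 1" "x \<noteq> 1 / 2" for x :: real
  proof -
    let ?A = "\<lambda>i j. (if i = j then x else 0) - (if j div 2 = i mod n then 1 / 2 else 0)"
    have x': "2 * x \<noteq> 1" using x by auto
    have "G x = 2 ^ n * sdet ?R ?A" unfolding G_def by (rule sum_det_bw_succ)
    \<comment> \<open>Modulo \<open>2 * n\<close> the successors of \<open>i\<close> under the edges
      to \<open>2 * i\<close> and \<open>2 * i + 1\<close> are exactly the \<open>j\<close> with
      \<open>j div 2 = i mod n\<close>.\<close>
    also have "sdet ?R ?A = sdet ?R (\<lambda>i j. 1 / 2 * ((if i = j then 2 * x else 0)
        - ((if j = 2 * i mod (2 * n) then 1 else 0) + (if j
            = (2 * i + 1) mod (2 * n) then 1 else 0))))"
    proof (rule sdet_cong[OF finite_lessThan], goal_cases)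
      case (1 i j)
      have "2 * i mod (2 * n) = 2 * (i mod n)" by simp
      moreover have "(2 * i + 1) mod (2 * n) = 2 * (i mod n) + 1"
      proof -
        have "Suc (2 * (i mod n)) \<noteq> 2 * n" by (rule Suc_double_not_eq_double)
        then show ?thesis by (simp add: mod_Suc)
      qed
      moreover have "j div 2 = k \<longleftrightarrow> j = 2 * k \<or> j = 2 * k + 1" for k by presburger
      ultimately show ?case by auto
    qed
    also have "\<dots> = (1 / 2) ^ (2 * n) * ((2 * x - 2) / (2 * x - 1) * doubling_det (2 * n) (2 * x))"
      unfolding sdet_smult doubling_det_def using n x' by (subst sdet_doubling) auto
    finally have "G x = 2 ^ n * ((1 / 2) ^ (2 * n) * ((2 * x - 2) / (2 * x - 1) * doubling_det (2
        * n) (2 * x)))" .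
    moreover have "(2 :: real) ^ n * (1 / 2) ^ (2 * n) = (1 / 2) ^ n"
      by (simp add: mult_2 power_add power_mult_distrib[symmetric])
    ultimately have "G x = (1 / 2) ^ n * ((2 * x - 2) / (2 * x - 1) * doubling_det (2 * n) (2 * x))"
      by (simp only: mult.assoc[symmetric])
    moreover have "2 * x - 2 = 2 * (x - 1)" by simp
    moreover have "a * (2 * y / c * d) / y = a * (2 / c * d)" if "y \<noteq> 0" for a c d y :: real
        using that by simp
    moreover have "x - 1 \<noteq> 0" using x(1) by simp
    ultimately show ?thesis by (simp only:)
  qed
  have "((\<lambda>x. (1 / 2) ^ n * (2 / (2 * x - 1) * doubling_det (2 * n) (2 * x))) \<longlongrightarrow>
     (1 / 2) ^ n * (2 / (2 * 1 - 1) * doubling_det (2 * n) (2 * 1))) (at 1)"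
    by (intro tendsto_intros isCont_tendsto_compose[OF doubling_det_cont]) auto
  moreover have "eventually (\<lambda>x. (1 / 2) ^ n * (2 / (2 * x - 1) * doubling_det (2 * n) (2 * x))
      = G x / (x - 1)) (at 1)"
  proof -
    \<comment> \<open>This keeps x away from the pole at 1/2.\<close>
    have "eventually (\<lambda>x :: real. x > 1 / 2) (at 1)"
      by (rule order_tendstoD[OF tendsto_ident_at]) simp
    moreover have "eventually (\<lambda>x :: real. x \<noteq> 1) (at 1)" by (simp add: eventually_at_filter)
    ultimately show ?thesis by eventually_elim (simp add: G)
  qed
  ultimately have "((\<lambda>x. G x / (x - 1)) \<longlongrightarrow> (1 / 2) ^ n * (2 / (2 * 1 - 1) * doubling_det (2 * n) (2
      * 1))) (at 1)"
    by (rule Lim_transform_eventually)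
  from tendsto_unique[OF _ lim1 this] have "real (2 * n * E)
      = (1 / 2) ^ n * 2 * doubling_det (2 * n) 2" by simp
  then have "real (n * E) = (1 / 2) ^ n * doubling_det (2 * n) 2" by simp
  then show ?thesis by (simp add: E_def power_one_over field_simps)
qed

text \<open>Doubling modulo \<open>2 * n\<close> hits even residues only, so each of the
  \<open>n\<close> odd columns is zero off its diagonal entry \<open>x\<close>. On the even
  residues, halved, it is doubling modulo \<open>n\<close>.\<close>

lemma doubling_det_even:
  assumes n: "n > 0"
  shows "doubling_det (2 * n) x = x ^ n * doubling_det n x"
proof -
  define M where "M i j = (if i = j then x else 0) - (if j
      = 2 * i mod (2 * n) then 1 else 0)" for i j
  define Ev where "Ev = (\<lambda>i. 2 * i) ` {..<n}"
  define Od where "Od m = (\<lambda>i. Suc (2 * i)) ` {..<m}" for m :: nat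
  have odd: "Suc (2 * m) \<noteq> 2 * i mod (2 * n)" for i m :: nat
    using Suc_double_not_eq_double[of m "i mod n"] by simp
  have M_odd: "M i (Suc (2 * m)) = (if i = Suc (2 * m) then x else 0)" for i m
    unfolding M_def if_not_P[OF odd] by simp
  have "sdet (Ev \<union> Od m) M = x ^ m * sdet Ev M" for m
  proof (induction m)
    case 0
    then show ?case by (simp add: Od_def)
  next
    case (Suc m)
    have new: "Suc (2 * m) \<notin> Ev \<union> Od m"
      using Suc_double_not_eq_double by (fastforce simp: Ev_def Od_def)
    have "Ev \<union> Od (Suc m) = insert (Suc (2 * m)) (Ev \<union> Od m)"
      by (simp add: Od_def lessThan_Suc)
    also have "sdet \<dots> M = M (Suc (2 * m)) (Suc (2 * m)) * sdet (Ev \<union> Od m) M"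
    proof (rule sdet_insert)
      show "M i (Suc (2 * m)) = 0" if "i \<in> Ev \<union> Od m" for i
        unfolding M_odd using that new by (cases "i = Suc (2 * m)") simp_all
    qed (use new in \<open>simp_all add: Ev_def Od_def\<close>)
    finally show ?case using Suc.IH by (simp add: M_odd)
  qed
  moreover have "Ev \<union> Od n = {..<2 * n}"
  proof (intro equalityI subsetI)
    fix k assume k: "k \<in> {..<2 * n}"
    show "k \<in> Ev \<union> Od n"
    proof (cases "even k")
      case True
      then show ?thesis using k by (auto simp: Ev_def elim!: evenE)
    next
      case False
      then show ?thesis using k by (auto simp: Od_def elim!: oddE)
    qed
  qed (auto simp: Ev_def Od_def)
  ultimately have "doubling_det (2 * n) x = x ^ n * sdet Ev M"
    unfolding doubling_det_def M_def[abs_def] by metis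
  also have "sdet Ev M = sdet {..<n} (\<lambda>i j. M (2 * i) (2 * j))"
    unfolding Ev_def by (rule sdet_reindex) (auto simp: inj_on_def)
  also have "\<dots> = doubling_det n x" unfolding doubling_det_def
  proof (rule sdet_cong[OF finite_lessThan])
    fix i j
    have "2 * (2 * i) mod (2 * n) = 2 * (2 * i mod n)" by (rule mod_mult_mult1)
    then show "M (2 * i) (2 * j) = (if i = j then x else 0) - (if j = 2 * i mod n then 1 else 0)"
      by (simp add: M_def)
  qed
  finally show ?thesis .
qed

section \<open>Counting the units modulo a cyclic polynomial\<close>

type_synonym ac_bit = "bit alg_closure"

lemma ac_bit_add_self [simp]: "x + x = (0 :: ac_bit)"
proof -
  have "to_ac (1 + 1 :: bit) = (1 + 1 :: ac_bit)" by (simp only: to_ac_add to_ac_1)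
  then have "(1 + 1 :: ac_bit) = 0" by simp
  then show ?thesis by (metis distrib_left mult_1_right mult_zero_right)
qed

lemma ac_bit_uminus [simp]: "- x = (x :: ac_bit)"
  using ac_bit_add_self[of x] by (metis minus_unique)

lemma ac_bit_diff [simp]: "x - y = x + (y :: ac_bit)"
  using diff_conv_add_uminus[of x y] by simp

lemma ac_bit_add_eq_0_iff [simp]: "x + y = 0 \<longleftrightarrow> x = (y :: ac_bit)"
  by (metis ac_bit_uminus add_eq_0_iff)

lemma ac_bit_square_add: "(x + y) ^ 2 = x ^ 2 + (y :: ac_bit) ^ 2"
proof -
  have "(x + y) ^ 2 = x ^ 2 + (x * y + x * y) + y ^ 2"
    by (simp only: power2_eq_square distrib_left distrib_right ac_simps)
  then show ?thesis by (simp only: ac_bit_add_self add_0_right)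
qed

lemma ac_bit_square_sum: "(\<Sum>i\<in>A. f i) ^ 2 = (\<Sum>i\<in>A. (f i :: ac_bit) ^ 2)"
  by (induction A rule: infinite_finite_induct) (simp_all add: ac_bit_square_add)

lemma ac_bit_of_nat_odd: "odd m \<Longrightarrow> of_nat m = (1 :: ac_bit)"
  by (elim oddE) (simp add: mult_2)

text \<open>For odd \<open>m\<close> the derivative of \<open>z^m + 1\<close> is
  \<open>z ^ (m - 1)\<close>, which can vanish only at 0, and 0 is not a root. So the
  \<open>m\<close> linear factors over the closure are distinct.\<close>

lemma card_roots_of_unity_ac_bit:
  assumes m: "odd m"
  shows "card {z :: ac_bit. z ^ m = 1} = m"
proof -
  define q where "q = Polynomial.monom (1 :: ac_bit) m + 1"
  have m0: "m > 0" using m by (cases m) auto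
  have q: "poly q z = z ^ m + 1" for z by (simp add: q_def poly_monom)
  have root: "poly q z = 0 \<longleftrightarrow> z ^ m = 1" for z
    unfolding q by simp
  have "Polynomial.degree q = m"
    unfolding q_def using m0 by (subst degree_add_eq_left) (auto simp: degree_monom_eq)
  then have deg: "q \<noteq> 0" "Polynomial.degree q = m" using m0 by auto
  obtain A where A: "size A = Polynomial.degree q" "q
      = smult (poly.coeff q (Polynomial.degree q)) (\<Prod>x\<in>#A. [:- x, 1:])"
    using alg_closed_imp_factorization[OF deg(1)] by auto
  have lc: "poly.coeff q (Polynomial.degree q) \<noteq> 0" using deg(1) by (rule leading_coeff_neq_0)
  have count: "count A x \<le> 1" for x
  proof (rule ccontr)
    assume "\<not> count A x \<le> 1"
    then have "count {#x, x#} y \<le> count A y" for y by (cases "x = y") auto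
    then have "{#x, x#} \<subseteq># A" by (rule mset_subset_eqI)
    then obtain B where B: "A = {#x, x#} + B" by (auto simp: mset_subset_eq_exists_conv)
    have "q = [:- x, 1:] * ([:- x, 1:] * smult (poly.coeff q (Polynomial.degree q)) (\<Prod>x\<in>#B. [:- x,
        1:]))"
      by (subst A(2)) (simp only: B image_mset_union image_mset_add_mset image_mset_empty
        prod_mset.add_mset prod_mset.union prod_mset.empty mult_smult_right mult.assoc mult_1)
    then obtain r where r: "q = [:- x, 1:] * ([:- x, 1:] * r)" by blast
    then have "poly (pderiv q) x = 0" by (subst r) (simp only: pderiv_mult, simp)
    moreover have "pderiv q = Polynomial.monom (of_nat m) (m - 1)"
      by (simp add: q_def pderiv_add pderiv_monom)
    ultimately have "x ^ (m - 1) = 0" using ac_bit_of_nat_odd[OF m] by (simp add: poly_monom)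
    then have "x = 0" by simp
    moreover have "poly q x = 0" by (subst r) simp
    ultimately show False using m0 unfolding q by (simp add: power_0_left)
  qed
  have roots: "{z. z ^ m = 1} = set_mset A"
  proof -
    have "poly q z = 0 \<longleftrightarrow> z \<in># A" for z
      by (subst A(2)) (use lc in \<open>auto simp: poly_prod_mset prod_mset_zero_iff image_iff\<close>)
    then have "{z. poly q z = 0} = set_mset A" by blast
    then show ?thesis unfolding root .
  qed
  have "A = mset_set (set_mset A)"
  proof (rule multiset_eqI)
    fix x show "count A x = count (mset_set (set_mset A)) x"
    proof (cases "x \<in># A")
      case True
      then have "count A x > 0" by simp
      then have "count A x = 1" using count[of x] by linarith
      then show ?thesis using True by simp
    next
      case False
      then show ?thesis by (simp add: not_in_iff)
    qed
  qed
  then have "size A = card (set_mset A)" by (metis size_mset_set)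
  then show ?thesis using A(1) deg roots by simp
qed

text \<open>For a prime \<open>p\<close> dividing \<open>m\<close>, the exponent
  \<open>m div p\<close> kills only \<open>m div p\<close> elements, too few to be all
  \<open>m\<close>-th roots of unity.\<close>

lemma exists_primitive_root_ac_bit:
  assumes m: "odd m"
  shows "\<exists>\<zeta> :: ac_bit. \<forall>r. \<zeta> ^ r = 1 \<longleftrightarrow> m dvd r"
proof -
  have m0: "m > 0" using m by (cases m) auto
  interpret annihilation "{z :: ac_bit. z ^ m = 1}" "\<lambda>r z. z ^ r = 1" "(*)" "\<lambda>r z. z ^ r"
  proof (unfold_locales, goal_cases)
    case (2 v r)
    then show ?case by (simp add: power_mult[symmetric] mult.commute) (simp add: power_mult)
  next
    case (3 v r s)
    then show ?case by (auto simp: power_mult elim!: dvdE)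
  next
    case (4 v r s)
    show ?case
    proof (cases "r = 0")
      case False
      \<comment> \<open>Bezout without negative coefficients; it is stated for nonzero
        \<open>r\<close>, hence the case distinction.\<close>
      then obtain x y where "r * x = s * y + gcd r s" using bezout_nat by blast
      then have "v ^ (r * x) = v ^ (s * y) * v ^ gcd r s" by (simp add: power_add)
      then show ?thesis using 4 by (simp add: power_mult)
    qed (use 4 in auto)
  qed (simp_all add: power_mult_distrib power_mult)
  have "\<exists>z\<in>{z :: ac_bit. z ^ m = 1}. \<not> z ^ (m div p)
      = 1" if p: "normalization_semidom_class.prime p" "p dvd m" for p
  proof (rule ccontr)
    assume "\<not> ?thesis"
    then have "{z :: ac_bit. z ^ m = 1} \<subseteq> {z. z ^ (m div p) = 1}" by auto
    moreover have odd: "odd (m div p)" using p m by (metis dvd_mult2 dvd_div_mult_self)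
    then have "card {z :: ac_bit. z ^ (m div p) = 1} = m div p" by (rule card_roots_of_unity_ac_bit)
    moreover have pos: "m div p > 0" using odd by (cases "m div p") auto
    ultimately have "m \<le> m div p" using card_roots_of_unity_ac_bit[OF m]
      by (metis card_mono card_ge_0_finite)
    moreover have "p > 1" using p prime_gt_1_nat by auto
    ultimately show False using m0 by (metis div_less_dividend not_le)
  qed
  moreover have "{z :: ac_bit. z ^ m = 1} \<noteq> {}" using power_one by blast
  ultimately show ?thesis using exists_exact_annihilator[of m] m0 by auto
qed

section \<open>Binary polynomials and their values in the algebraic closure\<close>

lemma bit_poly_add_self: "p + p = (0 :: bit poly)"
proof (rule poly_eqI)
  show "poly.coeff (p + p) k = poly.coeff 0 k" for k
    unfolding coeff_add coeff_0 by (cases "poly.coeff p k") simp_all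
qed

text \<open>In characteristic 2 this is \<open>x^n - 1\<close>.\<close>

definition cyclic_poly :: "nat \<Rightarrow> bit poly"
  where "cyclic_poly n = Polynomial.monom 1 n + 1"

text \<open>The reduced representatives of the units of the quotient ring by
  \<open>cyclic_poly n\<close>.\<close>

definition unit_polys :: "nat \<Rightarrow> bit poly set"
  where "unit_polys n = {p. Polynomial.degree p < n \<and> coprime p (cyclic_poly n)}"

lemma degree_cyclic_poly: "n > 0 \<Longrightarrow> Polynomial.degree (cyclic_poly n) = n"
  unfolding cyclic_poly_def by (subst degree_add_eq_left) (auto simp: degree_monom_eq)

definition ac_eval :: "bit poly \<Rightarrow> ac_bit \<Rightarrow> ac_bit"
  where "ac_eval p = poly (map_poly to_ac p)"

lemma ac_eval_pCons [simp]: "ac_eval (pCons c p) z = to_ac c + z * ac_eval p z"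
  by (simp add: ac_eval_def map_poly_pCons)

lemma ac_eval_0 [simp]: "ac_eval 0 z = 0"
  by (simp add: ac_eval_def)

lemma ac_eval_1 [simp]: "ac_eval 1 z = 1"
  by (simp add: ac_eval_def)

lemma ac_eval_add [simp]: "ac_eval (p + q) z = ac_eval p z + ac_eval q z"
proof (induction p q rule: poly_induct2)
  case (pCons a p b q)
  show ?case unfolding add_pCons ac_eval_pCons to_ac_add pCons by (simp only: distrib_left ac_simps)
qed simp

lemma ac_eval_smult [simp]: "ac_eval (smult c p) z = to_ac c * ac_eval p z"
  by (induction p) (simp_all add: algebra_simps)

lemma ac_eval_mult [simp]: "ac_eval (p * q) z = ac_eval p z * ac_eval q z"
  by (induction p) (simp_all add: algebra_simps)

lemma ac_eval_monom [simp]: "ac_eval (Polynomial.monom c k) z = to_ac c * z ^ k"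
  by (simp add: ac_eval_def map_poly_monom poly_monom)

lemma ac_eval_sum: "ac_eval (\<Sum>i\<in>A. f i) z = (\<Sum>i\<in>A. ac_eval (f i) z)"
  by (induction A rule: infinite_finite_induct) simp_all

lemma ac_eval_cyclic_poly: "ac_eval (cyclic_poly n) z = 0 \<longleftrightarrow> z ^ n = 1"
  by (simp add: cyclic_poly_def)

lemma degree_map_poly_to_ac: "Polynomial.degree (map_poly to_ac (p :: bit poly))
    = Polynomial.degree p"
  by (rule degree_map_poly) simp

lemma card_ac_eval_zeros:
  assumes "p \<noteq> 0"
  shows "finite {z. ac_eval p z = 0}" "card {z. ac_eval p z = 0} \<le> Polynomial.degree p"
proof -
  have "map_poly to_ac p \<noteq> 0" using assms by (simp add: map_poly_eq_0_iff)
  then show "finite {z. ac_eval p z = 0}" "card {z. ac_eval p z = 0} \<le> Polynomial.degree p"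
    unfolding ac_eval_def degree_map_poly_to_ac[symmetric]
        by (rule poly_roots_finite, rule card_poly_roots_bound)
qed

lemma ac_eval_common_zero:
  assumes "\<not> coprime p q" "q \<noteq> 0"
  obtains z where "ac_eval p z = 0" "ac_eval q z = 0"
proof -
  define g where "g = gcd p q"
  have "g \<noteq> 0" using assms(2) by (simp add: g_def)
  moreover have "\<not> is_unit g" using assms(1) by (simp only: g_def is_unit_gcd not_False_eq_True)
  ultimately have "Polynomial.degree g > 0" by (simp add: is_unit_iff_degree)
  then obtain z where "poly (map_poly to_ac g) z = 0"
    using alg_closed_imp_poly_has_root[of "map_poly to_ac g"] by (auto simp: degree_map_poly_to_ac)
  then have "ac_eval g z = 0" by (simp add: ac_eval_def)
  moreover obtain r s where "p = g * r" "q = g * s" unfolding g_def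
      by (meson dvdE gcd_dvd1 gcd_dvd2)
  ultimately show ?thesis using that[of z] by simp
qed

lemma coprime_imp_no_common_zero:
  assumes "coprime p q" "ac_eval p z = 0"
  shows "ac_eval q z \<noteq> 0"
proof
  assume q: "ac_eval q z = 0"
  obtain a b where "bezout_coefficients p q = (a, b)" by fastforce
  then have "a * p + b * q = 1" using bezout_coefficients[of p q a b] assms(1) by simp
  then have "ac_eval (a * p + b * q) z = 1" by simp
  then show False using assms(2) q by simp
qed

lemma inj_on_doubling:
  fixes m :: nat
  assumes "odd m"
  shows "inj_on (\<lambda>i. 2 * i mod m) {..<m}"
proof (rule linorder_inj_onI')
  fix i j assume ij: "i \<in> {..<m}" "j \<in> {..<m}" "i < j"
  show "2 * i mod m \<noteq> 2 * j mod m"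
  proof
    assume "2 * i mod m = 2 * j mod m"
    then have "m dvd 2 * j - 2 * i" using ij(3) mod_eq_dvd_iff_nat[of "2 * i" "2 * j" m] by simp
    then have "m dvd 2 * (j - i)" by (simp add: diff_mult_distrib2)
    moreover have "coprime m 2" using assms by simp
    ultimately have "m dvd j - i" by (simp add: coprime_dvd_mult_right_iff)
    then show False using ij by (auto dest: dvd_imp_le)
  qed
qed

text \<open>
  A polynomial over the two-element field is determined by its values at the m-th roots of unity,
  and the value vectors that occur are those compatible with squaring (discrete Fourier
  transform).
\<close>

lemma card_unit_polys_odd:
  assumes m: "odd m"
  shows "card (unit_polys m) =
    card {v \<in> {..<m} \<rightarrow>\<^sub>E (UNIV - {0 :: ac_bit}). \<forall>i\<in>{..<m}. v (2 * i mod m) = v i ^ 2}"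
    (is "_ = card ?V")
proof -
  have m0: "m > 0" using m by (cases m) auto
  obtain \<zeta> :: ac_bit where \<zeta>: "\<And>r. \<zeta> ^ r = 1 \<longleftrightarrow> m dvd r" using exists_primitive_root_ac_bit[OF m]
      by blast
  have \<zeta>m: "\<zeta> ^ m = 1" using \<zeta> by simp
  have \<zeta>0: "\<zeta> \<noteq> 0" using \<zeta>m m0 by (auto simp: power_0_left)
  have \<zeta>mod: "\<zeta> ^ (r mod m) = \<zeta> ^ r" for r
  proof -
    have "\<zeta> ^ r = \<zeta> ^ (m * (r div m) + r mod m)" by simp
    also have "\<dots> = \<zeta> ^ (r mod m)" by (simp only: power_add power_mult \<zeta>m power_one mult_1)
    finally show ?thesis by simp
  qed
  have inj: "inj_on (\<lambda>i. \<zeta> ^ i) {..<m}"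
  proof (rule linorder_inj_onI')
    fix i j assume ij: "i \<in> {..<m}" "j \<in> {..<m}" "i < j"
    have "\<zeta> ^ j = \<zeta> ^ i * \<zeta> ^ (j - i)" using ij(3) by (simp add: power_add[symmetric])
    moreover have "\<zeta> ^ (j - i) \<noteq> 1" using \<zeta> ij by (auto dest: dvd_imp_le)
    ultimately show "\<zeta> ^ i \<noteq> \<zeta> ^ j" using \<zeta>0 by simp
  qed
  have roots: "(\<lambda>i. \<zeta> ^ i) ` {..<m} = {z. z ^ m = 1}"
  proof (rule card_subset_eq)
    show "finite {z :: ac_bit. z ^ m = 1}" using card_roots_of_unity_ac_bit[OF m] m0
        by (metis card_ge_0_finite)
    show "(\<lambda>i. \<zeta> ^ i) ` {..<m} \<subseteq> {z. z ^ m = 1}"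
      using \<zeta>m by (auto simp: power_mult[symmetric] mult.commute[of _ m]) (simp add: power_mult)
    show "card ((\<lambda>i. \<zeta> ^ i) ` {..<m}) = card {z :: ac_bit. z ^ m = 1}"
      using card_image[OF inj] card_roots_of_unity_ac_bit[OF m] by simp
  qed
  \<comment> \<open>The diagonal sum is \<open>m\<close>, which equals 1 in characteristic 2 because
    \<open>m\<close> is odd. Hence the inverse transform needs no factor 1/m.\<close>
  have orth: "(\<Sum>k<m. (\<zeta> ^ i * inverse \<zeta> ^ j) ^ k) = (if i
      = j then 1 else 0)" if ij: "i < m" "j < m" for i j
  proof (cases "i = j")
    case True
    then show ?thesis using \<zeta>0 ac_bit_of_nat_odd[OF m] by (simp add: power_mult_distrib[symmetric])
  next
    case False
    let ?z = "\<zeta> ^ i * inverse \<zeta> ^ j"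
    have "?z \<noteq> 1"
    proof
      assume "?z = 1"
      then have "\<zeta> ^ i = \<zeta> ^ j" using \<zeta>0 by (simp add: power_inverse field_simps)
      then show False using inj ij False by (auto simp: inj_on_def)
    qed
    moreover have "?z ^ m = 1"
      by (simp add: power_mult_distrib power_mult[symmetric] mult.commute[of _ m])
        (simp add: power_mult \<zeta>m power_inverse)
    ultimately show ?thesis using False by (simp add: geometric_sum del: ac_bit_diff)
  qed
  define ev where "ev p = (\<lambda>i\<in>{..<m}. ac_eval p (\<zeta> ^ i))" for p
  define c where "c v k = (\<Sum>i<m. v i * (inverse \<zeta> ^ i) ^ k)" for v k
  \<comment> \<open>\<open>of_ac\<close> is meaningful on the range of \<open>to_ac\<close> only;
    the coefficients \<open>c v k\<close> are shown below to be 0 or 1.\<close>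
  define ip where "ip v = (\<Sum>k<m. Polynomial.monom (of_ac (c v k)) k)" for v
  have "bij_betw ev (unit_polys m) ?V"
  proof (rule bij_betw_imageI)
    show "inj_on ev (unit_polys m)"
    proof (rule inj_onI)
      fix p q assume pq: "p \<in> unit_polys m" "q \<in> unit_polys m" "ev p = ev q"
      have "ac_eval (p + q) (\<zeta> ^ i) = 0" if "i < m" for i
        using fun_cong[OF pq(3), of i] that by (simp add: ev_def)
      then have sub: "(\<lambda>i. \<zeta> ^ i) ` {..<m} \<subseteq> {z. ac_eval (p + q) z = 0}" by auto
      have "p + q = 0"
      proof (rule ccontr)
        assume ne: "p + q \<noteq> 0"
        have "m \<le> Polynomial.degree (p + q)"
          using card_mono[OF card_ac_eval_zeros(1)[OF ne] sub] card_ac_eval_zeros(2)[OF ne]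
              card_image[OF inj] by simp
        moreover have "Polynomial.degree (p + q) < m" using pq
            by (auto simp: unit_polys_def intro: degree_add_less)
        ultimately show False by simp
      qed
      moreover have "q + q = 0" by (rule bit_poly_add_self)
      ultimately show "p = q" by (metis add_right_imp_eq)
    qed
    show "ev ` unit_polys m = ?V"
    proof (intro equalityI subsetI)
      fix v assume "v \<in> ev ` unit_polys m"
      then obtain p where p: "coprime p (cyclic_poly m)" "v = ev p" by (auto simp: unit_polys_def)
      have "ac_eval p z \<noteq> 0" if "z ^ m = 1" for z
        using coprime_imp_no_common_zero[of "cyclic_poly m" p z] p(1) that ac_eval_cyclic_poly
            by (simp add: coprime_commute)
      moreover have "(\<zeta> ^ i) ^ m = 1" for i by (simp add: power_mult[symmetric] \<zeta>)
      moreover have sq: "ac_eval p (z ^ 2) = ac_eval p z ^ 2" for z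
      proof (induction p)
        case (pCons a p)
        have "to_ac a ^ 2 = (to_ac a :: ac_bit)" by (cases a) simp_all
        then show ?case using pCons by (simp add: ac_bit_square_add power_mult_distrib)
      qed simp
      moreover have "\<zeta> ^ (2 * i mod m) = (\<zeta> ^ i) ^ 2" for i
          by (simp only: \<zeta>mod power_mult[symmetric] mult.commute)
      ultimately show "v \<in> ?V" using m0 by (auto simp: p(2) ev_def)
    next
      fix v assume v: "v \<in> ?V"
      \<comment> \<open>Squaring sends the summand at \<open>i\<close> to the summand at
        \<open>2 * i mod m\<close>. As \<open>m\<close> is odd this permutes the summands, so the
        coefficient is its own square and lies in the prime field.\<close>
      have "c v k ^ 2 = c v k" for k
      proof -
        have "c v k ^ 2 = (\<Sum>i<m. v i ^ 2 * ((inverse \<zeta> ^ i) ^ k) ^ 2)"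
          by (simp add: c_def ac_bit_square_sum power_mult_distrib)
        also have "\<dots> = (\<Sum>i<m. v (2 * i mod m) * (inverse \<zeta> ^ (2 * i mod m)) ^ k)"
        proof (rule sum.cong[OF refl])
          fix i assume "i \<in> {..<m}"
          then have "v (2 * i mod m) = v i ^ 2" using v by blast
          moreover have "inverse \<zeta> ^ (2 * i mod m) = (inverse \<zeta> ^ i) ^ 2"
            by (simp only: power_inverse \<zeta>mod power_mult[symmetric] mult.commute)
          moreover have "(a ^ k) ^ 2 = (a ^ 2) ^ k" for a :: ac_bit
              by (metis power_mult mult.commute)
          ultimately show "v i ^ 2 * ((inverse \<zeta> ^ i) ^ k) ^ 2
              = v (2 * i mod m) * (inverse \<zeta> ^ (2 * i mod m)) ^ k"
            by (simp only:)
        qed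
        also have "\<dots> = (\<Sum>i<m. v i * (inverse \<zeta> ^ i) ^ k)"
        proof (rule sum.reindex_bij_betw[of "\<lambda>i. 2 * i mod m" "{..<m}" "{..<m}" "\<lambda>i. v i *
            (inverse \<zeta> ^ i) ^ k"])
          show "bij_betw (\<lambda>i. 2 * i mod m) {..<m} {..<m}"
            unfolding bij_betw_def using inj_on_doubling[OF m] m0
            by (auto intro!: endo_inj_surj[THEN equalityD2, THEN subsetD])
        qed
        finally show ?thesis by (simp add: c_def)
      qed
      then have "c v k = 0 \<or> c v k = 1" for k
        by (metis power2_eq_square mult_cancel_left2)
      then have c: "to_ac (of_ac (c v k)) = c v k" for k
        by (metis to_ac_0 to_ac_1 of_ac_to_ac)
      have ev: "ac_eval (ip v) (\<zeta> ^ j) = v j" if "j < m" for j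
      proof -
        have "ac_eval (ip v) (\<zeta> ^ j) = (\<Sum>k<m. c v k * (\<zeta> ^ j) ^ k)"
          by (simp add: ip_def ac_eval_sum c)
        also have "\<dots> = (\<Sum>k<m. \<Sum>i<m. v i * (\<zeta> ^ j * inverse \<zeta> ^ i) ^ k)"
          unfolding c_def sum_distrib_right power_mult_distrib
              by (simp only: mult.assoc mult.commute[of "(\<zeta> ^ j) ^ _"])
        also have "\<dots> = (\<Sum>i<m. v i * (\<Sum>k<m. (\<zeta> ^ j * inverse \<zeta> ^ i) ^ k))"
          unfolding sum_distrib_left by (rule sum.swap)
        also have "\<dots> = (\<Sum>i<m. v i * (if j = i then 1 else 0))"
          using that by (intro sum.cong refl) (simp only: orth lessThan_iff)
        also have "\<dots> = v j" using that by (simp add: sum.delta' if_distrib cong: if_cong)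
        finally show ?thesis .
      qed
      have "Polynomial.degree (ip v) \<le> m - 1"
        unfolding ip_def by (rule degree_sum_le) (auto intro: order_trans[OF degree_monom_le])
      then have "Polynomial.degree (ip v) < m" using m0 by simp
      moreover have "coprime (ip v) (cyclic_poly m)"
      proof (rule ccontr)
        assume "\<not> coprime (ip v) (cyclic_poly m)"
        moreover have "cyclic_poly m \<noteq> 0" using degree_cyclic_poly[OF m0] m0 by auto
        ultimately obtain z where z: "ac_eval (ip v) z = 0" "ac_eval (cyclic_poly m) z = 0"
          by (rule ac_eval_common_zero)
        then have "z \<in> (\<lambda>i. \<zeta> ^ i) ` {..<m}" unfolding roots ac_eval_cyclic_poly by simp
        then obtain i where "i < m" "z = \<zeta> ^ i" by auto
        then show False using z(1) ev v by auto
      qed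
      moreover have "ev (ip v) = v"
      proof
        fix i show "ev (ip v) i = v i"
          using v ev by (cases "i < m") (auto simp: ev_def PiE_iff extensional_def)
      qed
      ultimately show "v \<in> ev ` unit_polys m" by (force simp: unit_polys_def)
    qed
  qed
  then show ?thesis by (rule bij_betw_same_card)
qed

text \<open>The cycles of the doubling map with all weights 1 give one and the same product, as a
  number of solutions and as a determinant at 2.\<close>

lemma card_unit_polys_odd_det:
  assumes m: "odd m"
  shows "real (card (unit_polys m)) = doubling_det m 2"
proof -
  have m0: "m > 0" using m by (cases m) auto
  have "(\<lambda>i. 2 * i mod m) ` {..<m} \<subseteq> {..<m}" using m0 by auto
  then obtain cs where cs: "wcycles {..<m} (\<lambda>i. 2 * i mod m) (\<lambda>_. 1) cs"
    using wcycles_exists[OF finite_lessThan inj_on_doubling[OF m]] by blast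
  have "card {z :: ac_bit. z \<noteq> 0 \<and> z ^ 2 ^ c = z} = 2 ^ c - 1" if "c > 0" for c
  proof -
    \<comment> \<open>For nonzero z the equation says \<open>z ^ d = 1\<close> with
      \<open>d = 2 ^ c - 1\<close>, which is odd, so the roots are simple.\<close>
    obtain d where d: "2 ^ c = Suc d" using gr0_implies_Suc[of "2 ^ c"] by auto
    have "even ((2 :: nat) ^ c)" using that by simp
    then have odd: "odd d" by (simp add: d)
    then have "d > 0" by (cases d) auto
    then have "{z :: ac_bit. z \<noteq> 0 \<and> z ^ Suc d = z} = {z. z ^ d = 1}" by (auto simp: power_0_left)
    then show ?thesis using card_roots_of_unity_ac_bit[OF odd] d by simp
  qed
  from wcycles_card_solutions[OF cs this] have "card (unit_polys m) = (\<Prod>c\<leftarrow>cs. 2 ^ c - 1)"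
    unfolding card_unit_polys_odd[OF m] by simp
  moreover have "doubling_det m 2 = (\<Prod>c\<leftarrow>cs. 2 ^ c - 1)"
    unfolding doubling_det_def using wcycles_det[OF cs, of "2 :: real", unfolded power_one_right]
        by simp
  moreover have "real (\<Prod>c\<leftarrow>cs. 2 ^ c - 1) = (\<Prod>c\<leftarrow>cs. 2 ^ c - 1)" for cs
      by (induction cs) (simp_all add: of_nat_diff)
  ultimately show ?thesis by simp
qed

section \<open>Words as polynomials, and the count of units for even length\<close>

lemma bij_betw_Poly:
  assumes "n > 0"
  shows "bij_betw Poly {w :: bit list. length w = n} {p. Polynomial.degree p < n}"
proof (rule bij_betwI[where g = "\<lambda>p. map (poly.coeff p) [0..<n]"], goal_cases)
  case 1
  show ?case
  proof (rule Pi_I)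
    fix w :: "bit list" assume "w \<in> {w. length w = n}"
    then have "Polynomial.degree (Poly w) \<le> n - 1"
      by (intro degree_le) (auto simp: nth_default_def)
    then show "Poly w \<in> {p. Polynomial.degree p < n}" using assms by simp
  qed
next
  case 2
  then show ?case by auto
next
  case (3 w)
  then show ?case by (intro nth_equalityI) (simp_all add: nth_default_def)
next
  case (4 p)
  show ?case
  proof (rule poly_eqI)
    fix k show "poly.coeff (Poly (map (poly.coeff p) [0..<n])) k = poly.coeff p k"
      using 4 by (cases "k < n") (simp_all add: nth_default_def coeff_eq_0)
  qed
qed

lemma finite_bit_words: "finite {w :: bit list. length w = n}"
  and card_bit_words: "card {w :: bit list. length w = n} = 2 ^ n"
proof -
  have "{w :: bit list. length w = n} = {w. set w \<subseteq> {0, 1} \<and> length w = n}"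
    by (auto simp: bit_not_zero_iff)
  moreover have "card {0 :: bit, 1} = 2" by simp
  ultimately show "finite {w :: bit list. length w = n}" "card {w :: bit list. length w = n}
      = 2 ^ n"
    using finite_lists_length_eq[of "{0 :: bit, 1}" n] card_lists_length_eq[of "{0 :: bit, 1}" n]
        by (simp_all add: numeral_2_eq_2)
qed

lemma finite_bit_polys: "n > 0 \<Longrightarrow> finite {p :: bit poly. Polynomial.degree p < n}"
  by (simp add: finite_bit_words bij_betw_finite[OF bij_betw_Poly, symmetric])

lemma card_bit_polys: "n > 0 \<Longrightarrow> card {p :: bit poly. Polynomial.degree p < n} = 2 ^ n"
  by (simp add: card_bit_words bij_betw_same_card[OF bij_betw_Poly, symmetric])

lemma cyclic_poly_double: "cyclic_poly (2 * h) = cyclic_poly h * cyclic_poly h"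
proof -
  let ?x = "Polynomial.monom (1 :: bit) h"
  have "cyclic_poly h * cyclic_poly h = ?x * ?x + (?x + ?x) + 1"
    unfolding cyclic_poly_def by (simp only: distrib_left distrib_right mult_1_left mult_1_right
        ac_simps)
  then show ?thesis by (simp only: bit_poly_add_self cyclic_poly_def mult_monom mult_2 add_0_right
      mult_1_left)
qed

text \<open>The modulus for \<open>2 * h\<close> is the square of \<open>q\<close>, so only
  coprimality to \<open>q\<close> matters. Dividing by \<open>q\<close> leaves a remainder that is a
  unit modulo \<open>q\<close> and an arbitrary quotient of degree below \<open>h\<close>.\<close>

lemma card_unit_polys_double:
  assumes h: "h > 0"
  shows "card (unit_polys (2 * h)) = 2 ^ h * card (unit_polys h)"
proof -
  define q where "q = cyclic_poly h"
  have deg: "Polynomial.degree q = h" unfolding q_def by (rule degree_cyclic_poly[OF h])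
  then have q0: "q \<noteq> 0" using h by auto
  have coprime: "p \<in> unit_polys (2 * h) \<longleftrightarrow> Polynomial.degree p < 2 * h \<and> coprime p q" for p
    by (simp add: unit_polys_def cyclic_poly_double q_def)
  have degree_mod: "Polynomial.degree (p mod q) < h" for p
    using degree_mod_less'[OF q0, of p] deg h by (cases "p mod q = 0") auto
  have "bij_betw (\<lambda>p. (p mod q, p div q)) (unit_polys (2 * h)) (unit_polys h \<times> {p.
      Polynomial.degree p < h})"
  proof (rule bij_betwI[where g = "\<lambda>(r, s). s * q + r"], goal_cases)
    case 1
    show ?case
    proof
      fix p assume p: "p \<in> unit_polys (2 * h)"
      then have "coprime p q" by (simp add: coprime)
      then have "coprime (p mod q) q" using q0 by simp
      moreover have "Polynomial.degree (p div q) < h"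
      proof (cases "p div q = 0")
        case False
        have "p div q * q = p - p mod q" by (simp add: minus_mod_eq_div_mult)
        then have "Polynomial.degree (p div q * q) < 2 * h"
          using p coprime degree_mod[of p] h by (simp only:) (intro degree_diff_less, auto)
        then show ?thesis using False q0 deg by (simp add: degree_mult_eq)
      qed (use h in simp)
      ultimately show "(p mod q, p div q) \<in> unit_polys h \<times> {p. Polynomial.degree p < h}"
        using degree_mod[of p] by (simp add: unit_polys_def q_def)
    qed
  next
    case 2
    show ?case
    proof
      fix x assume "x \<in> unit_polys h \<times> {p :: bit poly. Polynomial.degree p < h}"
      then obtain r s where x: "x = (r, s)" "Polynomial.degree r < h" "coprime r q"
          "Polynomial.degree s < h"
        by (auto simp: unit_polys_def q_def)
      have "Polynomial.degree (s * q) < 2 * h" using degree_mult_le[of s q] x deg by simp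
      then have "Polynomial.degree (s * q + r) < 2 * h" using x by (intro degree_add_less) auto
      moreover have "(s * q + r) mod q = r mod q" by simp
      then have "coprime (s * q + r) q" using x(3) q0 by (metis coprime_mod_left_iff)
      ultimately show "(case x of (r, s) \<Rightarrow> s * q + r) \<in> unit_polys (2 * h)"
          by (simp add: coprime x(1))
    qed
  next
    case (3 p)
    then show ?case by simp
  next
    case (4 x)
    then obtain r s where x: "x = (r, s)" "Polynomial.degree r < h" by (auto simp: unit_polys_def)
    then have "r mod q = r" "r div q = 0" using deg by (auto simp: mod_poly_less div_poly_less)
    then show ?case using q0 by (simp add: x(1) div_plus_div_distrib_dvd_left)
  qed
  then have "card (unit_polys (2 * h)) = card (unit_polys h \<times> {p :: bit poly. Polynomial.degree p
      < h})"
    by (rule bij_betw_same_card)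
  then show ?thesis by (simp only: card_cartesian_product card_bit_polys[OF h] mult.commute)
qed

lemma card_unit_polys:
  assumes "n > 0"
  shows "real (card (unit_polys n)) = doubling_det n 2"
  using assms
proof (induction n rule: less_induct)
  case (less n)
  show ?case
  proof (cases "even n")
    case True
    then obtain h where h: "n = 2 * h" by blast
    then show ?thesis using less.IH[of h] less.prems
        by (simp add: card_unit_polys_double doubling_det_even)
  qed (rule card_unit_polys_odd_det)
qed

lemma card_irreducible_bw_succ_eq:
  assumes n: "n > 0"
  shows "n * card {\<sigma> \<in> {..<n} \<rightarrow>\<^sub>E {0, 1}. irreducible_on {..<2 * n} (bw_succ n \<sigma>)}
      = card (unit_polys n)"
proof -
  let ?E = "card {\<sigma> \<in> {..<n} \<rightarrow>\<^sub>E {0, 1}. irreducible_on {..<2 * n} (bw_succ n \<sigma>)}"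
  have "real (n * ?E) * 2 ^ n = doubling_det (2 * n) 2" by (rule card_irreducible_bw_succ[OF n])
  also have "\<dots> = real (card (unit_polys n)) * 2 ^ n"
    using doubling_det_even[OF n] card_unit_polys[OF n] by simp
  finally have "real (n * ?E) = real (card (unit_polys n))"
      by (rule mult_right_cancel[THEN iffD1, rotated]) simp
  then show ?thesis by (simp only: of_nat_eq_iff)
qed

section \<open>Circulant matrices and invertible necklaces\<close>

text \<open>Applied to words under rotation and to normal elements under conjugation, both with
  classes of size \<open>n\<close>.\<close>

lemma card_equal_classes:
  assumes "finite W" "\<And>x. x \<in> W \<Longrightarrow> x \<in> g x" "\<And>x y. x \<in> W \<Longrightarrow> y \<in> g x \<Longrightarrow> y \<in> W \<and> g y = g x"
    "\<And>x. x \<in> W \<Longrightarrow> card (g x) = n"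
  shows "n * card (g ` W) = card W"
proof -
  have U: "\<Union> (g ` W) = W" using assms(2,3) by blast
  have "n * card (g ` W) = card (\<Union> (g ` W))"
  proof (rule card_partition)
    fix c1 c2 assume c: "c1 \<in> g ` W" "c2 \<in> g ` W" "c1 \<noteq> c2"
    then obtain x y where xy: "x \<in> W" "c1 = g x" "y \<in> W" "c2 = g y" by blast
    have "g z = g x \<and> g z = g y" if "z \<in> c1 \<inter> c2" for z
      using that xy assms(3)[of x z] assms(3)[of y z] by blast
    then show "c1 \<inter> c2 = {}" using c xy by blast
  qed (use assms(1,4) U in auto)
  then show ?thesis using U by simp
qed

lemma invertible_mat_iff_det:
  fixes A :: "'a :: field mat"
  assumes A: "A \<in> carrier_mat n n"
  shows "invertible_mat A \<longleftrightarrow> det A \<noteq> 0"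
proof
  assume "invertible_mat A"
  then obtain B where B: "A * B = 1\<^sub>m n" "B * A = 1\<^sub>m (dim_row B)"
    using A by (auto simp: invertible_mat_def inverts_mat_def)
  have "dim_col B = n" using arg_cong[OF B(1), of dim_col] by simp
  moreover have "dim_row B = n" using arg_cong[OF B(2), of dim_col] A by simp
  ultimately have "B \<in> carrier_mat n n" by auto
  then have "det A * det B = 1" using det_mult[OF A, of B] B(1) by simp
  then show "det A \<noteq> 0" by auto
next
  assume det: "det A \<noteq> 0"
  let ?B = "inverse (det A) \<cdot>\<^sub>m adj_mat A"
  note adj = adj_mat[OF A]
  have "A * ?B = 1\<^sub>m n" using A adj det unfolding mult_smult_distrib[OF A adj(1)] adj(2)
      by (intro eq_matI) auto
  moreover have "?B * A = 1\<^sub>m n" using A adj det unfolding mult_smult_assoc_mat[OF adj(1) A] adj(3)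
      by (intro eq_matI) auto
  moreover have "?B \<in> carrier_mat n n" using adj(1) by simp
  ultimately show "invertible_mat A" using A unfolding invertible_mat_def inverts_mat_def
      by (intro conjI exI[of _ ?B]) auto
qed

lemma cyclic_poly_dvd_monom: "cyclic_poly n dvd Polynomial.monom c e + Polynomial.monom c (e mod n)"
proof -
  have "cyclic_poly n dvd Polynomial.monom c (n * t + s) + Polynomial.monom c s" for t s
  proof (induction t)
    case 0
    then show ?case by (simp only: mult_0_right add_0 bit_poly_add_self dvd_0_right)
  next
    case (Suc t)
    let ?a = "Polynomial.monom c (n * t + s)" and ?b = "Polynomial.monom c s" and ?x
        = "Polynomial.monom 1 n"
    have "Polynomial.monom c (n * Suc t + s) + ?b = ?x * ?a + ?b"
      by (simp add: mult_monom ac_simps)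
    \<comment> \<open>The characteristic 2 form of adding and subtracting the same term.\<close>
    also have "\<dots> = ?x * ?a + ?b + (?x * ?b + ?x * ?b)" by (simp only: bit_poly_add_self add_0_right)
    also have "\<dots> = ?x * (?a + ?b) + ?b * cyclic_poly n"
      by (simp only: cyclic_poly_def distrib_left mult_1_left mult_1_right ac_simps)
    finally have eq: "Polynomial.monom c (n * Suc t + s) + ?b
        = ?x * (?a + ?b) + ?b * cyclic_poly n" .
    show ?case unfolding eq by (rule dvd_add[OF dvd_mult[OF Suc.IH] dvd_triv_right])
  qed
  from this[of "e div n" "e mod n"] show ?thesis by simp
qed

lemma cyclic_poly_dvd_sum_monom_iff:
  assumes n: "n > 0" and A: "finite A"
  shows "cyclic_poly n dvd (\<Sum>a\<in>A. Polynomial.monom (c a) (e a)) \<longleftrightarrow>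
    (\<forall>i<n. (\<Sum>a\<in>A. if e a mod n = i then c a else 0) = 0)"
proof -
  let ?P = "\<Sum>a\<in>A. Polynomial.monom (c a) (e a)" and ?R = "\<Sum>a\<in>A. Polynomial.monom (c a) (e a mod n)"
  have "cyclic_poly n dvd ?P + ?R"
    unfolding sum.distrib[symmetric] by (intro dvd_sum cyclic_poly_dvd_monom)
  then have "cyclic_poly n dvd ?P \<longleftrightarrow> cyclic_poly n dvd ?R"
    using dvd_add_right_iff dvd_add_left_iff by blast
  also have "\<dots> \<longleftrightarrow> ?R = 0"
  proof
    assume "cyclic_poly n dvd ?R"
    moreover have "Polynomial.degree ?R \<le> n - 1"
    proof (rule degree_sum_le[OF A])
      fix a
      have "e a mod n < n" using n by simp
      then show "Polynomial.degree (Polynomial.monom (c a) (e a mod n)) \<le> n - 1"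
        using degree_monom_le[of "c a" "e a mod n"] by linarith
    qed
    then have "Polynomial.degree ?R < Polynomial.degree (cyclic_poly n)" using n
        by (simp add: degree_cyclic_poly)
    ultimately show "?R = 0" using dvd_imp_degree_le not_le by blast
  qed simp
  also have "\<dots> \<longleftrightarrow> (\<forall>i. poly.coeff ?R i = 0)" by (simp add: poly_eq_iff)
  also have "\<dots> \<longleftrightarrow> (\<forall>i<n. poly.coeff ?R i = 0)"
  proof -
    have "poly.coeff ?R i = 0" if "\<not> i < n" for i
      unfolding coeff_sum coeff_monom using that n by (intro sum.neutral) auto
    then show ?thesis by blast
  qed
  finally show ?thesis by (simp only: coeff_sum coeff_monom)
qed

lemma bit_poly_as_sum_monom:
  assumes "Polynomial.degree p < n"
  shows "p = (\<Sum>k<n. Polynomial.monom (poly.coeff p k) k)"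
proof -
  obtain m where "n = Suc m" using assms by (cases n) auto
  then show ?thesis using poly_as_sum_of_monoms'[of p m] assms
      by (simp only: lessThan_Suc_atMost less_Suc_eq_le)
qed

text \<open>Multiplication modulo \<open>x^n - 1\<close> is cyclic convolution. Reading
  \<open>r\<close> backwards turns it into correlation, which fits rows that are left rotations,
  where entry \<open>j\<close> of row \<open>i\<close> is entry \<open>(i + j) mod n\<close> of the
  word.\<close>

lemma cyclic_poly_dvd_mult_iff:
  assumes n: "n > 0" and p: "Polynomial.degree p < n" and r: "Polynomial.degree r < n"
  shows "cyclic_poly n dvd p * r \<longleftrightarrow>
    (\<forall>i<n. (\<Sum>j<n. poly.coeff p ((i + j) mod n) * poly.coeff r (n - 1 - j)) = 0)"
proof -
  define c where "c = (\<lambda>(k, j). poly.coeff p k * poly.coeff r (n - 1 - j))"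
  define e where "e = (\<lambda>(k, j :: nat). k + (n - 1 - j))"
  define A where "A = {..<n} \<times> {..<n}"
  have "r = (\<Sum>k<n. Polynomial.monom (poly.coeff r k) k)" by (rule bit_poly_as_sum_monom[OF r])
  also have "\<dots> = (\<Sum>j<n. Polynomial.monom (poly.coeff r (n - 1 - j)) (n - 1 - j))"
    by (rule sum.reindex_bij_witness[where i = "\<lambda>j. n - 1 - j" and j = "\<lambda>j. n - 1 - j"]) auto
  finally have "p * r = (\<Sum>k<n. Polynomial.monom (poly.coeff p k) k) * (\<Sum>j<n. Polynomial.monom
      (poly.coeff r (n - 1 - j)) (n - 1 - j))"
    using bit_poly_as_sum_monom[OF p] by simp
  also have "\<dots> = (\<Sum>a\<in>A. Polynomial.monom (c a) (e a))"
    unfolding sum_product sum.cartesian_product A_def c_def e_def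
        by (rule sum.cong) (auto simp: mult_monom)
  finally have "cyclic_poly n dvd p * r \<longleftrightarrow> (\<forall>i<n. (\<Sum>a\<in>A. if e a mod n = i then c a else 0) = 0)"
    using cyclic_poly_dvd_sum_monom_iff[OF n, of A c e] by (simp add: A_def)
  \<comment> \<open>The reversal shifts the exponents by \<open>n - 1\<close>; modulo
    \<open>n\<close> this merely permutes the equations.\<close>
  also have "\<dots> \<longleftrightarrow> (\<forall>i<n. (\<Sum>a\<in>A. if e a mod n = (i + (n - 1)) mod n then c a else 0) = 0)"
  proof (intro iffI allI impI)
    fix i assume i: "i < n" and *: "\<forall>i<n. (\<Sum>a\<in>A. if e a mod n
        = (i + (n - 1)) mod n then c a else 0) = 0"
    have "(Suc i mod n + (n - 1)) mod n = (Suc i + (n - 1)) mod n" by (rule mod_add_left_eq)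
    also have "\<dots> = i" using i by simp
    finally have "(Suc i mod n + (n - 1)) mod n = i" .
    with *[rule_format, of "Suc i mod n"] n show "(\<Sum>a\<in>A. if e a mod n = i then c a else 0) = 0"
        by simp
  qed (use n in simp)
  also have "\<dots> \<longleftrightarrow> (\<forall>i<n. (\<Sum>j<n. poly.coeff p ((i + j) mod n) * poly.coeff r (n - 1 - j)) = 0)"
  proof -
    have "(\<Sum>a\<in>A. if e a mod n = (i + (n - 1)) mod n then c a else 0) =
      (\<Sum>j<n. poly.coeff p ((i + j) mod n) * poly.coeff r (n - 1 - j))" if i: "i < n" for i
    proof -
      have eq: "(k + (n - 1 - j)) mod n = (i + (n - 1)) mod n \<longleftrightarrow> k
          = (i + j) mod n" if "k < n" "j < n" for k j
        using that i by (simp add: mod_if) linarith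
      have "(\<Sum>a\<in>A. if e a mod n = (i + (n - 1)) mod n then c a else 0) =
        (\<Sum>k<n. \<Sum>j<n. if k = (i + j) mod n then poly.coeff p k * poly.coeff r (n - 1 - j) else 0)"
        unfolding A_def sum.cartesian_product
      proof (rule sum.cong[OF refl])
        fix a assume "a \<in> {..<n} \<times> {..<n}"
        then obtain k j where a: "a = (k, j)" "k < n" "j < n" by auto
        show "(if e a mod n = (i + (n - 1)) mod n then c a else 0) =
          (case a of (k, j) \<Rightarrow> if k = (i + j) mod n then poly.coeff p k * poly.coeff r (n - 1 - j)
              else 0)"
          using eq[OF a(2,3)] by (simp only: a(1) c_def e_def prod.case)
      qed
      also have "\<dots> = (\<Sum>j<n. \<Sum>k<n. if k = (i + j) mod n then poly.coeff p k * poly.coeff r (n - 1 -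
          j) else 0)"
        by (rule sum.swap)
      also have "\<dots> = (\<Sum>j<n. poly.coeff p ((i + j) mod n) * poly.coeff r (n - 1 - j))"
        using n by (simp add: sum.delta)
      finally show ?thesis .
    qed
    then show ?thesis by auto
  qed
  finally show ?thesis .
qed

text \<open>In the quotient ring, units are the non-zero-divisors: if the gcd g with the modulus is
  nontrivial, the cofactor of g in the modulus is a nonzero residue annihilated by
  \<open>p\<close>.\<close>

lemma coprime_cyclic_poly_iff:
  assumes n: "n > 0"
  shows "coprime p (cyclic_poly n) \<longleftrightarrow> (\<forall>r. Polynomial.degree r < n \<longrightarrow> cyclic_poly n dvd p * r \<longrightarrow> r
      = 0)"
proof (intro iffI allI impI)
  fix r assume "coprime p (cyclic_poly n)" "Polynomial.degree r < n" "cyclic_poly n dvd p * r"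
  then have "cyclic_poly n dvd r" by (simp add: coprime_commute coprime_dvd_mult_right_iff)
  then show "r = 0" using dvd_imp_degree_le[of "cyclic_poly n" r] \<open>Polynomial.degree r < n\<close>
      degree_cyclic_poly[OF n] by auto
next
  assume *: "\<forall>r. Polynomial.degree r < n \<longrightarrow> cyclic_poly n dvd p * r \<longrightarrow> r = 0"
  show "coprime p (cyclic_poly n)"
  proof (rule ccontr)
    assume nc: "\<not> coprime p (cyclic_poly n)"
    define g where "g = gcd p (cyclic_poly n)"
    obtain r s where rs: "p = g * r" "cyclic_poly n = g * s" unfolding g_def
        by (meson dvdE gcd_dvd1 gcd_dvd2)
    have q0: "cyclic_poly n \<noteq> 0" using degree_cyclic_poly[OF n] n by auto
    then have g0: "g \<noteq> 0" "s \<noteq> 0" using rs(2) by auto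
    have "\<not> is_unit g" using nc by (simp only: g_def is_unit_gcd not_False_eq_True)
    then have "Polynomial.degree g > 0" using g0 by (simp add: is_unit_iff_degree)
    moreover have "n = Polynomial.degree g + Polynomial.degree s"
      using degree_mult_eq[OF g0] rs(2) degree_cyclic_poly[OF n] by simp
    ultimately have "Polynomial.degree s < n" by simp
    moreover have "p * s = cyclic_poly n * r" using rs by (metis mult.assoc mult.commute)
    then have "cyclic_poly n dvd p * s" by simp
    ultimately show False using * g0 by blast
  qed
qed

text \<open>Kernel vectors read backwards are the coefficient vectors of the residues annihilated by
  \<open>Poly w\<close>.\<close>

lemma det_circulant:
  assumes n: "n > 0" and w: "length w = n"
  shows "det (mat n n (\<lambda>(i, j). rotate i w ! j)) \<noteq> 0 \<longleftrightarrow> coprime (Poly w) (cyclic_poly n)"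
proof -
  let ?A = "mat n n (\<lambda>(i, j). rotate i w ! j)"
  have A: "?A \<in> carrier_mat n n" by simp
  have deg: "Polynomial.degree (Poly w) < n" using bij_betwE[OF bij_betw_Poly[OF n]] w by auto
  have co: "poly.coeff (Poly w) k = w ! k" if "k < n" for k using that w
      by (simp add: nth_default_def)
  have Av: "?A *\<^sub>v v = 0\<^sub>v n \<longleftrightarrow> (\<forall>i<n. (\<Sum>j<n. w ! ((i + j) mod n) * v $ j)
      = 0)" if "v \<in> carrier_vec n" for v
  proof -
    have "?A *\<^sub>v v = 0\<^sub>v n \<longleftrightarrow> (\<forall>i<n. (?A *\<^sub>v v) $ i = 0)" by (auto simp: vec_eq_iff)
    moreover have "(?A *\<^sub>v v) $ i = (\<Sum>j<n. w ! ((i + j) mod n) * v $ j)" if "i < n" for i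
      using that w \<open>v \<in> carrier_vec n\<close> by (simp add: scalar_prod_def nth_rotate atLeast0LessThan)
    ultimately show ?thesis by simp
  qed
  have key: "cyclic_poly n dvd Poly w * r \<longleftrightarrow> ?A *\<^sub>v v = 0\<^sub>v n"
    if "v \<in> carrier_vec n" "Polynomial.degree r < n" "\<And>j. j < n \<Longrightarrow> poly.coeff r (n - 1 - j)
        = v $ j" for v :: "bit vec" and r
  proof -
    have "(\<Sum>j<n. poly.coeff (Poly w) ((i + j) mod n) * poly.coeff r (n - 1 - j))
        = (\<Sum>j<n. w ! ((i + j) mod n) * v $ j)" for i
      by (rule sum.cong[OF refl]) (use n in \<open>simp only: co that(3) lessThan_iff mod_less_divisor\<close>)
    then show ?thesis unfolding Av[OF that(1)] cyclic_poly_dvd_mult_iff[OF n deg that(2)] by simp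
  qed
  have "det ?A = 0 \<longleftrightarrow> (\<exists>v\<in>carrier_vec n. v \<noteq> 0\<^sub>v n \<and> ?A *\<^sub>v v = 0\<^sub>v n)"
    using det_0_iff_vec_prod_zero[OF A] by auto
  also have "\<dots> \<longleftrightarrow> (\<exists>r. Polynomial.degree r < n \<and> cyclic_poly n dvd Poly w * r \<and> r \<noteq> 0)"
  proof
    assume "\<exists>v\<in>carrier_vec n. v \<noteq> 0\<^sub>v n \<and> ?A *\<^sub>v v = 0\<^sub>v n"
    then obtain v where v: "v \<in> carrier_vec n" "v \<noteq> 0\<^sub>v n" "?A *\<^sub>v v = 0\<^sub>v n" by blast
    define r where "r = Poly (rev (list_of_vec v))"
    have len: "length (list_of_vec v) = n" using v by simp
    have r: "poly.coeff r (n - 1 - j) = v $ j" if "j < n" for j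
      using that v(1) len by (simp add: r_def nth_default_def rev_nth list_of_vec_index)
    have "Polynomial.degree r < n" unfolding r_def using bij_betwE[OF bij_betw_Poly[OF n]] len
        by auto
    moreover from this have "cyclic_poly n dvd Poly w * r"
      using key[OF v(1) _ r] v(3) by blast
    moreover have "r \<noteq> 0"
    proof
      assume "r = 0"
      then have "v $ j = 0" if "j < n" for j using r[OF that] by simp
      then have "v = 0\<^sub>v n" using v(1) by (intro eq_vecI) auto
      then show False using v(2) by simp
    qed
    ultimately show "\<exists>r. Polynomial.degree r < n \<and> cyclic_poly n dvd Poly w * r \<and> r \<noteq> 0" by blast
  next
    assume "\<exists>r. Polynomial.degree r < n \<and> cyclic_poly n dvd Poly w * r \<and> r \<noteq> 0"
    then obtain r where r: "Polynomial.degree r < n" "cyclic_poly n dvd Poly w * r" "r \<noteq> 0" by blast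
    define v where "v = vec n (\<lambda>j. poly.coeff r (n - 1 - j))"
    have v: "v \<in> carrier_vec n" by (simp add: v_def)
    moreover have "?A *\<^sub>v v = 0\<^sub>v n"
      using key[OF v r(1)] r(2) by (simp add: v_def)
    moreover have "v \<noteq> 0\<^sub>v n"
    proof
      assume v0: "v = 0\<^sub>v n"
      have "poly.coeff r k = 0" for k
      proof (cases "k < n")
        case True
        then have "v $ (n - 1 - k) = poly.coeff r k" by (simp add: v_def)
        moreover have "v $ (n - 1 - k) = 0" unfolding v0 using True by simp
        ultimately show ?thesis by simp
      qed (use r(1) in \<open>simp add: coeff_eq_0\<close>)
      then show False using r(3) by (simp add: poly_eq_iff)
    qed
    ultimately show "\<exists>v\<in>carrier_vec n. v \<noteq> 0\<^sub>v n \<and> ?A *\<^sub>v v = 0\<^sub>v n" by blast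
  qed
  finally show ?thesis unfolding coprime_cyclic_poly_iff[OF n] by blast
qed

text \<open>Sorting only permutes the rows of the circulant matrix, which changes the determinant by
  a sign.\<close>

lemma invertible_bw_matrix_iff:
  assumes n: "n > 0" and w: "length w = n"
  shows "invertible_mat (bw_matrix (necklace w)) \<longleftrightarrow> coprime (Poly w) (cyclic_poly n)"
proof -
  define rows where "rows = sort (rotations w)"
  have len: "length rows = n" using w by (simp add: rows_def rotations_def)
  have lenr: "length (rotations w) = n" using w by (simp add: rotations_def)
  have bw: "bw_matrix (necklace w) = mat n n (\<lambda>(i, j). rows ! i ! j)"
    unfolding bw_matrix_def bw_rows_necklace Let_def rows_def[symmetric] len ..
  have "mset rows = mset (rotations w)" by (simp add: rows_def)
  then obtain p where p: "p permutes {..<n}" "permute_list p (rotations w) = rows"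
    using mset_eq_permutation[of rows "rotations w"] lenr by auto
  have p0: "p permutes {0..<n}" using p(1) by (simp add: atLeast0LessThan)
  let ?A = "mat n n (\<lambda>(i, j). rotate i w ! j)"
  have "mat n n (\<lambda>(i, j). rows ! i ! j) = mat n n (\<lambda>(i, j). ?A $$ (p i, j))"
  proof (rule eq_matI, goal_cases)
    case (1 i j)
    then have "p i < n" using permutes_in_image[OF p(1), of i] by simp
    moreover have "rows ! i = rotations w ! p i"
      using permute_list_nth[of p "rotations w" i] p lenr 1 by simp
    ultimately show ?case using 1 w by (simp add: rotations_def)
  qed auto
  then have "det (bw_matrix (necklace w)) = signof p * det ?A"
    unfolding bw using det_permute_rows[OF _ p0, of ?A] by simp
  then have "det (bw_matrix (necklace w)) \<noteq> 0 \<longleftrightarrow> det ?A \<noteq> 0" by (auto simp: sign_def)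
  then show ?thesis using invertible_mat_iff_det[of "bw_matrix (necklace w)" n] det_circulant[OF n
      w]
    by (simp add: bw)
qed

section \<open>Necklaces as rotation classes of units\<close>

lemma necklace_eq_image:
  assumes "w \<noteq> []"
  shows "necklace w = (\<lambda>k. rotate k w) ` {..<length w}"
proof -
  have "rotate k w = rotate (k mod length w) w" for k by (rule rotate_conv_mod)
  moreover have "k mod length w < length w" for k using assms by simp
  ultimately show ?thesis by (auto simp: necklace_def image_iff)
qed

lemma self_in_necklace: "w \<in> necklace w"
  unfolding necklace_def by (metis (mono_tags, lifting) mem_Collect_eq rotate0 id_apply)

lemma necklace_rotate: "necklace (rotate k w) = necklace w"
proof -
  have "rotate i w \<in> necklace (rotate k w)" for i
  proof (cases "w = []")
    case False
    have "k \<le> length w * k" using False by (cases w) auto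
    then have "i + (length w * k - k) + k = i + length w * k" by linarith
    then have "rotate (i + (length w * k - k)) (rotate k w) = rotate (i + length w * k) w"
      by (simp only: rotate_rotate)
    also have "\<dots> = rotate i w" by (metis mod_mult_self2 rotate_conv_mod)
    finally show ?thesis unfolding necklace_def by (metis (mono_tags, lifting) mem_Collect_eq)
  qed (auto simp: necklace_def)
  then show ?thesis by (auto simp: necklace_def rotate_rotate)
qed

lemma card_invertible_necklaces:
  assumes n: "n > 0"
  shows "n * card (invertible_necklaces n) = card (unit_polys n)"
proof -
  define W where "W = {w :: bit list. length w = n \<and> coprime (Poly w) (cyclic_poly n)}"
  have "invertible_necklaces n = necklace ` W"
    using invertible_bw_matrix_iff[OF n] by (auto simp: invertible_necklaces_def necklaces_def
        W_def)
  moreover have "n * card (necklace ` W) = card W"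
  proof (rule card_equal_classes)
    show "finite W" by (rule finite_subset[OF _ finite_bit_words[of n]]) (auto simp: W_def)
    fix x :: "bit list" assume x: "x \<in> W"
    show "x \<in> necklace x" by (rule self_in_necklace)
    show "y \<in> W \<and> necklace y = necklace x" if y: "y \<in> necklace x" for y
    proof -
      obtain k where k: "y = rotate k x" using y by (auto simp: necklace_def)
      then have "necklace y = necklace x" by (simp add: necklace_rotate)
      moreover have "length y = n" using k x by (simp add: W_def)
      ultimately show ?thesis using x invertible_bw_matrix_iff[OF n]
          by (metis (mono_tags, lifting) W_def mem_Collect_eq)
    qed
    show "card (necklace x) = n"
    proof -
      have len: "length x = n" and "coprime (Poly x) (cyclic_poly n)" using x by (auto simp: W_def)
      then have det: "det (mat n n (\<lambda>(i, j). rotate i x ! j)) \<noteq> 0" using det_circulant[OF n]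
          by blast
      have "inj_on (\<lambda>k. rotate k x) {..<n}"
      proof (rule inj_onI, rule ccontr)
        fix i j assume ij: "i \<in> {..<n}" "j \<in> {..<n}" "rotate i x = rotate j x" "i \<noteq> j"
        \<comment> \<open>Two equal rotations would be two equal rows of a nonsingular
          matrix.\<close>
        have "row (mat n n (\<lambda>(i, j). rotate i x ! j)) i = row (mat n n (\<lambda>(i, j). rotate i x ! j)) j"
          using ij by (intro eq_vecI) simp_all
        then show False using det det_identical_rows[of "mat n n (\<lambda>(i, j). rotate i x ! j)" n i j]
            ij by simp
      qed
      then show ?thesis using len n by (subst necklace_eq_image) (auto simp: card_image)
    qed
  qed
  moreover have "card W = card (unit_polys n)"
  proof -
    have "Poly ` W = unit_polys n"
    proof -
      have "Poly ` W = {p \<in> Poly ` {w. length w = n}. coprime p (cyclic_poly n)}"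
          by (auto simp: W_def)
      also have "\<dots> = unit_polys n" unfolding bij_betw_imp_surj_on[OF bij_betw_Poly[OF n]]
          by (auto simp: unit_polys_def)
      finally show ?thesis .
    qed
    moreover have "inj_on Poly W"
      by (rule inj_on_subset[OF bij_betw_imp_inj_on[OF bij_betw_Poly[OF n]]]) (auto simp: W_def)
    ultimately show ?thesis using card_image by metis
  qed
  ultimately show ?thesis by simp
qed

section \<open>Normal bases\<close>

definition (in ring) bit_emb :: "bit \<Rightarrow> 'a"
  where "bit_emb b = (if b = 1 then \<one> else \<zero>)"

text \<open>
  \<open>linearized [c\<^sub>0, c\<^sub>1, \<dots>]\<close> is the map \<open>v \<mapsto> c\<^sub>0 v + c\<^sub>1 v^2 + c\<^sub>2 v^4 + \<dots>\<close>; \<open>twist g g\<close> turns its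
  coefficients into those of \<open>v \<mapsto> linearized cs (g v) + g linearized cs v\<close> in characteristic 2.
\<close>

primrec (in ring) linearized :: "'a list \<Rightarrow> 'a \<Rightarrow> 'a" where
  "linearized [] v = \<zero>"
| "linearized (c # cs) v = c \<otimes> v \<oplus> linearized cs (v \<otimes> v)"

primrec (in ring) twist :: "'a \<Rightarrow> 'a \<Rightarrow> 'a list \<Rightarrow> 'a list" where
  "twist g h [] = []"
| "twist g h (c # cs) = c \<otimes> (h \<oplus> g) # twist g (h \<otimes> h) cs"

definition (in ring) act :: "bit poly \<Rightarrow> 'a \<Rightarrow> 'a"
  where "act p = linearized (map bit_emb (coeffs p))"

locale binary_field = field F for F (structure) +
  fixes n :: nat
  assumes n_pos: "n > 0" and card_carrier: "card (carrier F) = 2 ^ n"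
begin

lemma finite_carrier: "finite (carrier F)"
  using card_carrier by (metis card.infinite power_not_zero zero_neq_numeral)

text \<open>The sum of \<open>2 ^ k\<close> ones is the k-th power of
  \<open>\<one> \<oplus> \<one>\<close>. At k = \<open>n\<close> it is zero because the additive
  group has order \<open>2 ^ n\<close>, and a field has no nonzero nilpotents.\<close>

lemma one_add_one: "\<one> \<oplus> \<one> = \<zero>"
proof -
  let ?t = "\<one> \<oplus> \<one>"
  have "add_pow F (2 ^ k :: nat) \<one> = ?t [^] k" for k :: nat
  proof (induction k)
    case (Suc k)
    have "add_pow F (2 ^ Suc k :: nat) \<one> = add_pow F (2 ^ k :: nat) \<one> \<oplus> add_pow F (2 ^ k :: nat) \<one>"
      by (simp add: mult_2 add.nat_pow_mult)
    also have "\<dots> = ?t [^] k \<otimes> ?t" using Suc by (simp add: r_distr)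
    finally show ?case by simp
  qed simp
  then have "?t [^] n = add_pow F (2 ^ n :: nat) \<one>" by simp
  also have "\<dots> = \<zero>"
    using group.pow_order_eq_1[OF add.is_group, of \<one>] card_carrier
        by (simp add: Coset.order_def add_pow_def)
  finally have "?t [^] n = \<zero>" .
  moreover have "?t [^] k \<noteq> \<zero>" if "?t \<noteq> \<zero>" for k :: nat
    by (induction k) (use that in \<open>auto simp: integral_iff\<close>)
  ultimately show ?thesis by blast
qed

lemma add_self: "x \<in> carrier F \<Longrightarrow> x \<oplus> x = \<zero>"
  using one_add_one l_distr[of \<one> \<one> x] by simp

lemma add_self_left: "x \<in> carrier F \<Longrightarrow> y \<in> carrier F \<Longrightarrow> x \<oplus> (x \<oplus> y) = y"
  using add_self[of x] by (simp add: a_assoc[symmetric])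

lemma add_eq_zero_iff: "x \<in> carrier F \<Longrightarrow> y \<in> carrier F \<Longrightarrow> x \<oplus> y = \<zero> \<longleftrightarrow> x = y"
  using add_self_left[of x y] add_self[of x] by auto

lemma square_add:
  assumes "x \<in> carrier F" "y \<in> carrier F"
  shows "(x \<oplus> y) \<otimes> (x \<oplus> y) = x \<otimes> x \<oplus> y \<otimes> y"
proof -
  have "(x \<oplus> y) \<otimes> (x \<oplus> y) = x \<otimes> x \<oplus> (x \<otimes> y \<oplus> (x \<otimes> y \<oplus> y \<otimes> y))"
    using assms by (simp add: l_distr r_distr a_assoc m_comm)
  then show ?thesis using assms by (simp add: add_self_left)
qed

lemma pow_card: "x \<in> carrier F \<Longrightarrow> x [^] ((2 :: nat) ^ n) = x"
proof (cases "x = \<zero>")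
  case True
  then show ?thesis by (simp add: nat_pow_zero)
next
  case False
  assume x: "x \<in> carrier F"
  then have "x [^]\<^bsub>Multiplicative_Group.mult_of F\<^esub> Coset.order (Multiplicative_Group.mult_of F)
      = \<one>\<^bsub>Multiplicative_Group.mult_of F\<^esub>"
    using False by (intro group.pow_order_eq_1[OF field_mult_group]) auto
  then have "x [^] ((2 :: nat) ^ n - 1) = \<one>"
    by (simp add: Multiplicative_Group.nat_pow_mult_of order_mult_of[OF finite_carrier]
        Coset.order_def card_carrier)
  then have "x [^] Suc (2 ^ n - 1) = x" using x by (simp only: nat_pow_Suc l_one)
  moreover have "Suc (2 ^ n - 1) = (2 :: nat) ^ n" by simp
  ultimately show ?thesis by (simp only:)
qed

lemma pow_pow2_Suc: "x \<in> carrier F \<Longrightarrow> (x \<otimes> x) [^] ((2 :: nat) ^ i) = x [^] ((2 :: nat) ^ Suc i)"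
  using nat_pow_pow[of x 2 "2 ^ i"] by (simp add: numeral_2_eq_2)

lemma square_surj:
  assumes "v \<in> carrier F"
  obtains u where "u \<in> carrier F" "v = u \<otimes> u"
proof
  have "v [^] ((2 :: nat) ^ (n - 1)) \<otimes> v [^] ((2 :: nat) ^ (n - 1))
      = v [^] ((2 :: nat) ^ Suc (n - 1))"
    using assms by (simp add: nat_pow_mult mult_2)
  also have "Suc (n - 1) = n" using n_pos by simp
  also have "v [^] ((2 :: nat) ^ n) = v" by (rule pow_card[OF assms])
  finally show "v = v [^] ((2 :: nat) ^ (n - 1)) \<otimes> v [^] ((2 :: nat) ^ (n - 1))" ..
qed (use assms in simp)

text \<open>A generator of the multiplicative group works: were it fixed by the i-th Frobenius
  power, the group would have at most \<open>2 ^ i - 1\<close> elements. Such an element separates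
  the Frobenius powers in the independence proof.\<close>

lemma exists_frobenius_generic:
  obtains g where "g \<in> carrier F" "\<And>i. 0 < i \<Longrightarrow> i < n \<Longrightarrow> g [^] ((2 :: nat) ^ i) \<noteq> g"
proof -
  obtain g where g: "g \<in> carrier (Multiplicative_Group.mult_of F)" "carrier
      (Multiplicative_Group.mult_of F) = {g [^] i | i :: nat. i \<in> UNIV}"
    using finite_field_mult_group_has_gen[OF finite_carrier] by blast
  have g': "g \<in> carrier F" "g \<noteq> \<zero>" using g(1) by auto
  have "g [^] ((2 :: nat) ^ i) \<noteq> g" if i: "0 < i" "i < n" for i
  proof
    assume eq: "g [^] ((2 :: nat) ^ i) = g"
    define d :: nat where "d = 2 ^ i - 1"
    have d: "2 ^ i = Suc d" by (simp add: d_def)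
    have "(2 :: nat) ^ 1 \<le> 2 ^ i" using i by (intro power_increasing) auto
    then have d0: "d > 0" using d by simp
    have "g [^] d \<otimes> g = \<one> \<otimes> g" using eq g' by (simp add: d)
    then have gd: "g [^] d = \<one>" using g' by (subst (asm) m_rcancel) auto
    have "carrier (Multiplicative_Group.mult_of F) \<subseteq> (\<lambda>k. g [^] k) ` {..<d}"
    proof
      fix x assume "x \<in> carrier (Multiplicative_Group.mult_of F)"
      then obtain k :: nat where k: "x = g [^] k" using g(2) by auto
      have "g [^] k = g [^] (d * (k div d) + k mod d)" by simp
      also have "\<dots> = (g [^] d) [^] (k div d) \<otimes> g [^] (k mod d)"
        using g' by (simp only: nat_pow_mult[symmetric] nat_pow_pow[symmetric])
      also have "\<dots> = g [^] (k mod d)" using g' by (simp add: gd)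
      finally show "x \<in> (\<lambda>k. g [^] k) ` {..<d}" using k d0 by auto
    qed
    then have "card (carrier (Multiplicative_Group.mult_of F)) \<le> card {..<d}"
      by (rule surj_card_le[OF finite_lessThan])
    then have "card (carrier (Multiplicative_Group.mult_of F)) \<le> d" by simp
    moreover have "card (carrier (Multiplicative_Group.mult_of F)) = 2 ^ n - 1"
      using order_mult_of[OF finite_carrier] card_carrier by (simp add: Coset.order_def)
    ultimately have "(2 :: nat) ^ n \<le> 2 ^ i" using d by simp
    moreover have "(2 :: nat) ^ i < 2 ^ n" using i by simp
    ultimately show False by simp
  qed
  then show ?thesis using that g' by blast
qed

lemma linearized_closed [simp]:
  "set cs \<subseteq> carrier F \<Longrightarrow> v \<in> carrier F \<Longrightarrow> linearized cs v \<in> carrier F"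
  by (induction cs arbitrary: v) auto

lemma twist_closed:
  "g \<in> carrier F \<Longrightarrow> h \<in> carrier F \<Longrightarrow> set cs \<subseteq> carrier F \<Longrightarrow> set (twist g h cs) \<subseteq> carrier F"
  by (induction cs arbitrary: h) auto

lemma length_twist [simp]: "length (twist g h cs) = length cs"
  by (induction cs arbitrary: h) auto

lemma linearized_twist:
  assumes "g \<in> carrier F" "h \<in> carrier F" "set cs \<subseteq> carrier F" "v \<in> carrier F"
  shows "linearized (twist g h cs) v = linearized cs (h \<otimes> v) \<oplus> g \<otimes> linearized cs v"
  using assms
proof (induction cs arbitrary: h v)
  case (Cons c cs)
  have eq: "(h \<otimes> v) \<otimes> (h \<otimes> v) = (h \<otimes> h) \<otimes> (v \<otimes> v)" using Cons.prems by (simp add: m_ac)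
  have "c \<otimes> (h \<oplus> g) \<otimes> v \<oplus> (a \<oplus> g \<otimes> b) = (c \<otimes> (h \<otimes> v) \<oplus> a) \<oplus> g \<otimes> (c \<otimes> v \<oplus> b)"
    if "a \<in> carrier F" "b \<in> carrier F" for a b
    using Cons.prems that by (simp add: l_distr r_distr a_ac m_ac)
  then show ?case using Cons by (simp add: eq)
qed simp

text \<open>The twist multiplies coefficient i by the sum of \<open>h [^] (2 ^ i)\<close> and
  \<open>g\<close>, which in characteristic 2 is zero only if the two agree.\<close>

lemma twist_zero:
  assumes "g \<in> carrier F" "h \<in> carrier F" "set cs \<subseteq> carrier F" "set (twist g h cs) \<subseteq> {\<zero>}"
    "\<And>i. i < length cs \<Longrightarrow> h [^] ((2 :: nat) ^ i) \<noteq> g"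
  shows "set cs \<subseteq> {\<zero>}"
  using assms
proof (induction cs arbitrary: h)
  case (Cons c cs)
  have "(h \<otimes> h) [^] ((2 :: nat) ^ i) \<noteq> g" if "i < length cs" for i
    using Cons.prems(5)[of "Suc i"] that Cons.prems(2) pow_pow2_Suc by simp
  then have "set cs \<subseteq> {\<zero>}" using Cons.IH[of "h \<otimes> h"] Cons.prems by simp
  moreover have "h \<oplus> g \<noteq> \<zero>"
    using Cons.prems(1,2) Cons.prems(5)[of 0] by (simp add: add_eq_zero_iff)
  then have "c = \<zero>" using Cons.prems integral_iff[of c "h \<oplus> g"] by auto
  ultimately show ?case by simp
qed simp

lemma linearized_zeros: "set cs \<subseteq> {\<zero>} \<Longrightarrow> v \<in> carrier F \<Longrightarrow> linearized cs v = \<zero>"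
  by (induction cs arbitrary: v) auto

text \<open>
  Dedekind's argument: with g moved by all powers of the Frobenius map in question, the relation
  for g v plus g times the relation for v is shorter by its first coefficient.
\<close>

lemma linearized_zero:
  assumes "set cs \<subseteq> carrier F" "length cs \<le> n" "\<And>v. v \<in> carrier F \<Longrightarrow> linearized cs v = \<zero>"
  shows "set cs \<subseteq> {\<zero>}"
proof -
  obtain g where g: "g \<in> carrier F" "\<And>i. 0 < i \<Longrightarrow> i < n \<Longrightarrow> g [^] ((2 :: nat) ^ i) \<noteq> g"
    using exists_frobenius_generic by blast
  show ?thesis using assms
  proof (induction "length cs" arbitrary: cs)
    case (Suc m)
    then obtain c cs' where cs: "cs = c # cs'" by (cases cs) auto
    have c: "c \<in> carrier F" "set cs' \<subseteq> carrier F" using Suc.prems cs by auto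
    let ?t = "twist g (g \<otimes> g) cs'"
    have t: "set ?t \<subseteq> carrier F" using g c by (intro twist_closed) auto
    have "linearized ?t v = \<zero>" if v: "v \<in> carrier F" for v
    proof -
      \<comment> \<open>Dropping the first coefficient leaves a relation in squares only. The
        Frobenius map is onto, so it holds everywhere.\<close>
      obtain u where u: "u \<in> carrier F" "v = u \<otimes> u" using square_surj[OF v] by blast
      have "linearized (twist g g cs) u = linearized cs (g \<otimes> u) \<oplus> g \<otimes> linearized cs u"
        using g Suc.prems u by (intro linearized_twist) auto
      also have "\<dots> = \<zero>" using Suc.prems g u by simp
      finally have "c \<otimes> (g \<oplus> g) \<otimes> u \<oplus> linearized ?t v = \<zero>" by (simp add: cs u)
      moreover have "g \<oplus> g = \<zero>" using g by (simp add: add_self)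
      ultimately show ?thesis using c t u v by simp
    qed
    then have "set ?t \<subseteq> {\<zero>}" using Suc.hyps(1)[of ?t] Suc.hyps(2) Suc.prems(2) t cs by simp
    moreover have "(g \<otimes> g) [^] ((2 :: nat) ^ i) \<noteq> g" if "i < length cs'" for i
      using g(2)[of "Suc i"] pow_pow2_Suc[OF g(1)] that Suc.prems(2) cs by simp
    ultimately have cs': "set cs' \<subseteq> {\<zero>}" using twist_zero[of g "g \<otimes> g" cs'] g c by auto
    have "c = \<zero>" using Suc.prems(3)[of \<one>] c linearized_zeros[OF cs'] by (simp add: cs)
    then show ?case using cs' cs by simp
  qed simp
qed

section \<open>The polynomial action through the Frobenius map\<close>

lemma bit_emb_closed [simp]: "bit_emb b \<in> carrier F"
  by (simp add: bit_emb_def)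

lemma bit_emb_add: "bit_emb (a + b) = bit_emb a \<oplus> bit_emb b"
  by (cases a; cases b) (simp_all add: bit_emb_def one_add_one)

lemma bit_emb_eq_0_iff: "bit_emb b = \<zero> \<longleftrightarrow> b = 0"
  by (cases b) (simp_all add: bit_emb_def)

lemma act_0 [simp]: "act 0 v = \<zero>"
  by (simp add: act_def)

lemma act_closed [simp]: "v \<in> carrier F \<Longrightarrow> act p v \<in> carrier F"
  unfolding act_def by (rule linearized_closed) auto

lemma act_pCons:
  assumes "v \<in> carrier F"
  shows "act (pCons c p) v = bit_emb c \<otimes> v \<oplus> act p (v \<otimes> v)"
proof (cases "c = 0 \<and> p = 0")
  case True
  then show ?thesis using assms by (simp add: bit_emb_def)
next
  case False
  then have "coeffs (pCons c p) = c # coeffs p" by (cases c) (auto simp: cCons_def)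
  then show ?thesis by (simp add: act_def)
qed

lemma act_1: "v \<in> carrier F \<Longrightarrow> act 1 v = v"
  unfolding one_pCons by (simp add: act_pCons bit_emb_def)

lemma act_add: "v \<in> carrier F \<Longrightarrow> act (p + q) v = act p v \<oplus> act q v"
proof (induction p q arbitrary: v rule: poly_induct2)
  case (pCons a p b q)
  then show ?case unfolding add_pCons
    by (simp only: act_pCons bit_emb_add m_closed)
      (simp add: l_distr a_ac)
qed simp

lemma act_add_right:
  "v \<in> carrier F \<Longrightarrow> w \<in> carrier F \<Longrightarrow> act p (v \<oplus> w) = act p v \<oplus> act p w"
proof (induction p arbitrary: v w)
  case (pCons a p)
  then show ?case by (simp only: act_pCons square_add a_closed m_closed) (simp add: r_distr a_ac)
qed simp

lemma act_zero_right [simp]: "act p \<zero> = \<zero>"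
  by (induction p) (simp_all add: act_pCons)

lemma act_square: "v \<in> carrier F \<Longrightarrow> act p (v \<otimes> v) = act p v \<otimes> act p v"
proof (induction p arbitrary: v)
  case (pCons a p)
  have "bit_emb a \<otimes> (v \<otimes> v) = (bit_emb a \<otimes> v) \<otimes> (bit_emb a \<otimes> v)"
    using pCons.prems by (simp add: bit_emb_def)
  then show ?case using pCons by (simp add: act_pCons square_add)
qed simp

lemma act_smult: "v \<in> carrier F \<Longrightarrow> act (Polynomial.smult c p) v = bit_emb c \<otimes> act p v"
  by (cases c) (simp_all add: bit_emb_def)

lemma act_mult: "v \<in> carrier F \<Longrightarrow> act (p * q) v = act p (act q v)"
proof (induction p arbitrary: v)
  case (pCons a p)
  have "act (pCons a p * q) v = act (Polynomial.smult a q + pCons 0 (p * q)) v" by simp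
  also have "\<dots> = bit_emb a \<otimes> act q v \<oplus> (bit_emb 0 \<otimes> v \<oplus> act (p * q) (v \<otimes> v))"
    using pCons.prems by (simp only: act_add act_smult act_pCons)
  also have "\<dots> = bit_emb a \<otimes> act q v \<oplus> act p (act q v \<otimes> act q v)"
    using pCons by (simp add: bit_emb_def act_square)
  finally show ?case using pCons.prems by (simp add: act_pCons)
qed simp

lemma act_monom: "v \<in> carrier F \<Longrightarrow> act (Polynomial.monom 1 k) v = v [^] ((2 :: nat) ^ k)"
proof (induction k arbitrary: v)
  case 0
  then show ?case by (simp add: act_1)
next
  case (Suc k)
  then show ?case unfolding monom_Suc by (simp only: act_pCons m_closed pow_pow2_Suc) (simp add:
      bit_emb_def)
qed

lemma act_cyclic_poly: "v \<in> carrier F \<Longrightarrow> act (cyclic_poly n) v = \<zero>"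
  unfolding cyclic_poly_def by (simp add: act_add act_monom act_1 pow_card add_self)

lemma act_nonzero:
  assumes "p \<noteq> 0" "Polynomial.degree p < n"
  shows "\<exists>v\<in>carrier F. act p v \<noteq> \<zero>"
proof (rule ccontr)
  assume "\<not> ?thesis"
  then have "set (map bit_emb (coeffs p)) \<subseteq> {\<zero>}"
    using assms by (intro linearized_zero) (auto simp: act_def[symmetric] length_coeffs_degree)
  moreover have "last (coeffs p) \<in> set (coeffs p)" using assms(1) by (intro last_in_set) simp
  moreover have "last (coeffs p) \<noteq> 0"
    unfolding last_coeffs_eq_coeff_degree[OF assms(1)] by (rule leading_coeff_neq_0[OF assms(1)])
  ultimately show False by (auto simp: bit_emb_eq_0_iff)
qed

text \<open>This is the normal basis theorem. For a prime factor p, the quotient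
  \<open>cyclic_poly n div p\<close> has degree below \<open>n\<close>, so by independence of the
  Frobenius powers it does not kill the whole field.\<close>

lemma exists_cyclic_vector:
  obtains \<gamma> where "\<gamma> \<in> carrier F" "\<And>p. act p \<gamma> = \<zero> \<longleftrightarrow> cyclic_poly n dvd p"
proof -
  interpret annihilation "carrier F" "\<lambda>p v. act p v = \<zero>" "(\<oplus>)" "act"
  proof (unfold_locales, goal_cases)
    case (3 v r s)
    then obtain t where "s = t * r" by (metis dvdE mult.commute)
    then show ?case using 3 by (simp add: act_mult)
  next
    case (4 v r s)
    obtain a b where "bezout_coefficients r s = (a, b)" by fastforce
    then have "gcd r s = a * r + b * s" using bezout_coefficients[of r s a b] by simp
    then show ?case using 4 by (simp add: act_add act_mult)
  next
    case (5 v s r)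
    then show ?case by (simp add: act_mult[symmetric] mult.commute)
  qed (simp_all add: act_add_right)
  have q0: "cyclic_poly n \<noteq> 0" using degree_cyclic_poly[OF n_pos] n_pos by auto
  have "\<exists>v\<in>carrier F. act (cyclic_poly n div p) v \<noteq> \<zero>"
    if p: "normalization_semidom_class.prime p" "p dvd cyclic_poly n" for p
  proof -
    have eq: "cyclic_poly n = p * (cyclic_poly n div p)" using p by simp
    have ne: "cyclic_poly n div p \<noteq> 0" using eq q0 by auto
    have p0: "p \<noteq> 0" "\<not> is_unit p" using p(1) by (auto simp: not_prime_unit)
    then have "Polynomial.degree p > 0" by (simp add: is_unit_iff_degree)
    moreover have "n = Polynomial.degree p + Polynomial.degree (cyclic_poly n div p)"
      using degree_mult_eq[OF p0(1) ne] eq degree_cyclic_poly[OF n_pos] by simp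
    ultimately have "Polynomial.degree (cyclic_poly n div p) < n" by simp
    then show ?thesis by (rule act_nonzero[OF ne])
  qed
  then have "\<exists>v\<in>carrier F. \<forall>p. act p v = \<zero> \<longleftrightarrow> cyclic_poly n dvd p"
    using act_cyclic_poly zero_closed by (intro exists_exact_annihilator[OF q0]) auto
  then show ?thesis using that by auto
qed

end

section \<open>Normal elements and their conjugates\<close>

context binary_field
begin

lemma subfield_zero_one: "subfield {\<zero>, \<one>} F"
proof (rule subfieldI')
  show "subring {\<zero>, \<one>} F"
    by (rule subringI) (auto simp: one_add_one add_self intro: minus_equality)
qed simp

definition conjugates :: "'a \<Rightarrow> 'a list"
  where "conjugates \<gamma> = map (\<lambda>i. \<gamma> [^] ((2 :: nat) ^ i)) [0..<n]"

definition normal_elements :: "'a set"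
  where "normal_elements = {\<gamma> \<in> carrier F. \<forall>p. Polynomial.degree p < n \<longrightarrow> act p \<gamma> = \<zero> \<longrightarrow> p = 0}"

lemma combine_pow2:
  assumes "v \<in> carrier F" "set cs \<subseteq> carrier F"
  shows "combine cs (map (\<lambda>i. v [^] ((2 :: nat) ^ i)) [0..<length cs]) = linearized cs v"
  using assms
proof (induction cs arbitrary: v)
  case (Cons c cs)
  have "map (\<lambda>i. v [^] ((2 :: nat) ^ i)) [0..<length (c # cs)]
      = v # map (\<lambda>i. (v \<otimes> v) [^] ((2 :: nat) ^ i)) [0..<length cs]"
    using Cons.prems(1) by (simp add: upt_conv_Cons map_Suc_upt[symmetric] pow_pow2_Suc del:
        upt_Suc)
  then show ?case using Cons by (simp del: upt_Suc)
qed simp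

lemma linearized_bits: "v \<in> carrier F \<Longrightarrow> linearized (map bit_emb ws) v = act (Poly ws) v"
  by (induction ws arbitrary: v) (simp_all add: act_pCons)

lemma combine_conjugates:
  assumes "v \<in> carrier F" "length ws = n"
  shows "combine (map bit_emb ws) (conjugates v) = act (Poly ws) v"
proof -
  have "set (map bit_emb ws) \<subseteq> carrier F" by auto
  then have "combine (map bit_emb ws) (conjugates v) = linearized (map bit_emb ws) v"
    unfolding conjugates_def using combine_pow2[OF assms(1), of "map bit_emb ws"] assms(2) by simp
  then show ?thesis using linearized_bits[OF assms(1)] by simp
qed

lemma bit_list_of:
  assumes "set ks \<subseteq> {\<zero>, \<one>}"
  obtains ws where "ks = map bit_emb ws"
proof
  show "ks = map bit_emb (map (\<lambda>k. if k = \<one> then 1 else 0) ks)"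
    using assms by (induction ks) (auto simp: bit_emb_def)
qed

text \<open>A trivial annihilator makes the \<open>2 ^ n\<close> binary combinations of the
  conjugates distinct. This gives independence, and by counting they fill the field.\<close>

lemma normal_iff:
  assumes \<gamma>: "\<gamma> \<in> carrier F"
  shows "independent {\<zero>, \<one>} (conjugates \<gamma>) \<and> Span {\<zero>, \<one>} (conjugates \<gamma>) = carrier F
      \<longleftrightarrow> \<gamma> \<in> normal_elements"
proof
  assume "independent {\<zero>, \<one>} (conjugates \<gamma>) \<and> Span {\<zero>, \<one>} (conjugates \<gamma>) = carrier F"
  then have ind: "independent {\<zero>, \<one>} (conjugates \<gamma>)" by simp
  have "p = 0" if p: "Polynomial.degree p < n" "act p \<gamma> = \<zero>" for p
  proof -
    obtain ws where ws: "length ws = n" "p = Poly ws"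
      using p(1) bij_betw_Poly[OF n_pos] by (auto simp: bij_betw_def image_iff)
    have "set (map bit_emb ws) \<subseteq> {\<zero>, \<one>}" by (auto simp: bit_emb_def)
    moreover have "combine (map bit_emb ws) (conjugates \<gamma>) = \<zero>"
      using combine_conjugates[OF \<gamma> ws(1)] p(2) ws(2) by simp
    ultimately have "set (take (length (conjugates \<gamma>)) (map bit_emb ws)) \<subseteq> {\<zero>}"
      by (rule independent_imp_trivial_combine[OF subfield_zero_one ind])
    then have "\<forall>b\<in>set ws. b = 0" using ws(1) by (auto simp: conjugates_def bit_emb_eq_0_iff)
    then have "Poly ws = 0" by (induction ws) auto
    then show ?thesis using ws(2) by simp
  qed
  then show "\<gamma> \<in> normal_elements" using \<gamma> by (simp add: normal_elements_def)
next
  assume norm: "\<gamma> \<in> normal_elements"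
  have set: "set (conjugates \<gamma>) \<subseteq> carrier F" using \<gamma> by (auto simp: conjugates_def)
  have len: "length (conjugates \<gamma>) = n" by (simp add: conjugates_def)
  let ?W = "{ws :: bit list. length ws = n}"
  have inj: "inj_on (\<lambda>ws. act (Poly ws) \<gamma>) ?W"
  proof (rule inj_onI)
    fix ws ws' assume w: "ws \<in> ?W" "ws' \<in> ?W" "act (Poly ws) \<gamma> = act (Poly ws') \<gamma>"
    have deg: "Polynomial.degree (Poly ws) < n" "Polynomial.degree (Poly ws') < n"
      using bij_betwE[OF bij_betw_Poly[OF n_pos]] w by auto
    have "act (Poly ws + Poly ws') \<gamma> = \<zero>" using w(3) \<gamma> by (simp add: act_add add_self)
    then have "Poly ws + Poly ws' = 0"
      using norm degree_add_less[OF deg] by (simp add: normal_elements_def)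
    then have "Poly ws = Poly ws'" using bit_poly_add_self[of "Poly ws'"]
        by (metis add_right_imp_eq)
    then show "ws = ws'" using w bij_betw_imp_inj_on[OF bij_betw_Poly[OF n_pos]]
        by (auto simp: inj_on_def)
  qed
  have "independent {\<zero>, \<one>} (conjugates \<gamma>)"
  proof (rule trivial_combine_imp_independent[OF subfield_zero_one set])
    fix ks assume ks: "set ks \<subseteq> {\<zero>, \<one>}" "combine ks (conjugates \<gamma>) = \<zero>"
    have "set ks \<subseteq> carrier F" using ks(1) by auto
    \<comment> \<open>\<open>combine\<close> tolerates coefficient lists of any length; this
      normalizes the list to length \<open>n\<close>, where injectivity applies.\<close>
    from combine_normalize[OF this set ks(2)] obtain ks' where
      ks': "set (take (length (conjugates \<gamma>)) ks) \<subseteq> set ks'" "set ks' \<subseteq> set (take (length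
          (conjugates \<gamma>)) ks) \<union> {\<zero>}"
        "length ks' = length (conjugates \<gamma>)" "combine ks' (conjugates \<gamma>) = \<zero>"
      by blast
    have "set ks' \<subseteq> {\<zero>, \<one>}" using ks(1) ks'(2) by (auto dest: in_set_takeD)
    then obtain ws where ws: "ks' = map bit_emb ws" by (rule bit_list_of)
    have len': "length ws = n" using ks'(3) by (simp add: ws len)
    have "act (Poly ws) \<gamma> = \<zero>" using ks'(4) combine_conjugates[OF \<gamma> len'] ws by simp
    moreover have "Poly (replicate n 0) = (0 :: bit poly)" by simp
    ultimately have "ws = replicate n 0" using inj len' by (auto simp: inj_on_def)
    then have "set ks' \<subseteq> {\<zero>}" using ws by (auto simp: bit_emb_def)
    then show "set (take (length (conjugates \<gamma>)) ks) \<subseteq> {\<zero>}" using ks'(1) by blast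
  qed
  moreover have "Span {\<zero>, \<one>} (conjugates \<gamma>) = carrier F"
  proof (rule card_subset_eq[OF finite_carrier])
    show "Span {\<zero>, \<one>} (conjugates \<gamma>) \<subseteq> carrier F"
      using Span_in_carrier[OF _ set] by auto
    have "Span {\<zero>, \<one>} (conjugates \<gamma>) = (\<lambda>ws. act (Poly ws) \<gamma>) ` ?W"
    proof (intro equalityI subsetI)
      fix x assume "x \<in> Span {\<zero>, \<one>} (conjugates \<gamma>)"
      then obtain ks where ks: "x = combine ks (conjugates \<gamma>)" "length ks = n" "set ks \<subseteq> {\<zero>, \<one>}"
        unfolding Span_eq_combine_set_length_version[OF subfield_zero_one set] len by auto
      obtain ws where ws: "ks = map bit_emb ws" using ks(3) by (rule bit_list_of)
      then show "x \<in> (\<lambda>ws. act (Poly ws) \<gamma>) ` ?W" using combine_conjugates[OF \<gamma>, of ws] ks by auto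
    next
      fix x assume "x \<in> (\<lambda>ws. act (Poly ws) \<gamma>) ` ?W"
      then obtain ws where ws: "length ws = n" "x = act (Poly ws) \<gamma>" by auto
      then have "x = combine (map bit_emb ws) (conjugates \<gamma>)" using combine_conjugates[OF \<gamma>] by simp
      moreover have "set (map bit_emb ws) \<subseteq> {\<zero>, \<one>}" by (auto simp: bit_emb_def)
      moreover have "length (map bit_emb ws) = n" using ws by simp
      ultimately show "x \<in> Span {\<zero>, \<one>} (conjugates \<gamma>)"
        unfolding Span_eq_combine_set_length_version[OF subfield_zero_one set] len by blast
    qed
    then show "card (Span {\<zero>, \<one>} (conjugates \<gamma>)) = card (carrier F)"
      using card_image[OF inj] card_bit_words card_carrier by metis
  qed
  ultimately show "independent {\<zero>, \<one>} (conjugates \<gamma>) \<and> Span {\<zero>, \<one>} (conjugates \<gamma>) = carrier F" ..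
qed

lemma normal_bases_eq: "normal_bases n F = (\<lambda>\<gamma>. set (conjugates \<gamma>)) ` normal_elements"
proof -
  have "normal_bases n F = {set (conjugates \<gamma>) | \<gamma>. \<gamma> \<in> carrier F \<and>
    independent {\<zero>, \<one>} (conjugates \<gamma>) \<and> Span {\<zero>, \<one>} (conjugates \<gamma>) = carrier F}"
    unfolding normal_bases_def conjugates_def by blast
  also have "\<dots> = {set (conjugates \<gamma>) | \<gamma>. \<gamma> \<in> carrier F \<and> \<gamma> \<in> normal_elements}"
    by (intro Collect_cong ex_cong1 conj_cong refl normal_iff)
  also have "\<dots> = (\<lambda>\<gamma>. set (conjugates \<gamma>)) ` normal_elements" by (auto simp: normal_elements_def)
  finally show ?thesis .
qed

lemma act_pow2:
  assumes "v \<in> carrier F"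
  shows "act p (v [^] ((2 :: nat) ^ i)) = act p v [^] ((2 :: nat) ^ i)"
  using assms
proof (induction i arbitrary: v)
  case (Suc i)
  then show ?case
    by (simp only: pow_pow2_Suc[symmetric] Suc.IH act_square m_closed act_closed)
qed simp

lemma set_conjugates_eq:
  assumes v: "v \<in> carrier F"
  shows "set (conjugates v) = range (\<lambda>i. v [^] ((2 :: nat) ^ i))"
proof -
  have "v [^] ((2 :: nat) ^ (n * t + r)) = v [^] ((2 :: nat) ^ r)" for t r
  proof (induction t)
    case (Suc t)
    have "(2 :: nat) ^ (n * Suc t + r) = 2 ^ (n * t + r) * 2 ^ n" by (simp add: power_add)
    then have "v [^] ((2 :: nat) ^ (n * Suc t + r))
        = (v [^] ((2 :: nat) ^ (n * t + r))) [^] ((2 :: nat) ^ n)"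
      using v by (simp only: nat_pow_pow)
    then show ?case using Suc v by (simp add: pow_card)
  qed simp
  from this[of "i div n" "i mod n" for i] have eq: "v [^] ((2 :: nat) ^ i)
      = v [^] ((2 :: nat) ^ (i mod n))" for i by simp
  have "v [^] ((2 :: nat) ^ i) \<in> set (conjugates v)" for i
    unfolding eq[of i] conjugates_def using n_pos by simp
  then show ?thesis by (auto simp: conjugates_def)
qed

lemma conjugate_in_normal_elements:
  assumes \<gamma>: "\<gamma> \<in> normal_elements"
  shows "\<gamma> [^] ((2 :: nat) ^ i) \<in> normal_elements"
    "set (conjugates (\<gamma> [^] ((2 :: nat) ^ i))) \<subseteq> set (conjugates \<gamma>)"
proof -
  have c: "\<gamma> \<in> carrier F" using \<gamma> by (simp add: normal_elements_def)
  have "p = 0" if "Polynomial.degree p < n" "act p (\<gamma> [^] ((2 :: nat) ^ i)) = \<zero>" for p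
  proof -
    have "act p \<gamma> [^] ((2 :: nat) ^ i) = \<zero>" using that c by (simp add: act_pow2)
    moreover have "x [^] k \<noteq> \<zero>" if "x \<noteq> \<zero>" "x \<in> carrier F" for x and k :: nat
      by (induction k) (use that in \<open>auto simp: integral_iff\<close>)
    ultimately have "act p \<gamma> = \<zero>" using c by (metis act_closed)
    then show ?thesis using \<gamma> that(1) by (simp add: normal_elements_def)
  qed
  then show "\<gamma> [^] ((2 :: nat) ^ i) \<in> normal_elements" using c by (simp add: normal_elements_def)
  show "set (conjugates (\<gamma> [^] ((2 :: nat) ^ i))) \<subseteq> set (conjugates \<gamma>)"
    using c by (auto simp: set_conjugates_eq nat_pow_pow power_add[symmetric])
qed

lemma card_conjugates:
  assumes "\<gamma> \<in> normal_elements"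
  shows "card (set (conjugates \<gamma>)) = n"
proof -
  have "independent {\<zero>, \<one>} (conjugates \<gamma>)" using assms normal_iff
      by (auto simp: normal_elements_def)
  then have "distinct (conjugates \<gamma>)" by (rule independent_distinct[OF subfield_zero_one])
  then show ?thesis by (simp add: distinct_card) (simp add: conjugates_def)
qed

text \<open>The map \<open>p \<mapsto> act p \<gamma>\<close> identifies the quotient ring with the
  field as modules. Normality of the image says that \<open>p\<close> is no zero divisor, that is, a
  unit.\<close>

lemma card_normal_elements: "card normal_elements = card (unit_polys n)"
proof -
  obtain \<gamma> where \<gamma>: "\<gamma> \<in> carrier F" "\<And>p. act p \<gamma> = \<zero> \<longleftrightarrow> cyclic_poly n dvd p"
    using exists_cyclic_vector by blast
  let ?D = "{p :: bit poly. Polynomial.degree p < n}"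
  have small: "p = 0" if "Polynomial.degree p < n" "cyclic_poly n dvd p" for p
    using that dvd_imp_degree_le[of "cyclic_poly n" p] degree_cyclic_poly[OF n_pos] by auto
  have inj: "inj_on (\<lambda>p. act p \<gamma>) ?D"
  proof (rule inj_onI)
    fix p q assume pq: "p \<in> ?D" "q \<in> ?D" "act p \<gamma> = act q \<gamma>"
    then have "act (p + q) \<gamma> = \<zero>" using \<gamma>(1) by (simp add: act_add add_self)
    then have "p + q = 0" using \<gamma>(2) small[of "p + q"] pq by (simp add: degree_add_less)
    then show "p = q" using bit_poly_add_self[of q] by (metis add_right_imp_eq)
  qed
  have surj: "(\<lambda>p. act p \<gamma>) ` ?D = carrier F"
    by (rule card_subset_eq[OF finite_carrier])
      (use \<gamma>(1) card_image[OF inj] card_bit_polys[OF n_pos] card_carrier in auto)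
  have normal: "act p \<gamma> \<in> normal_elements \<longleftrightarrow> coprime p (cyclic_poly n)" for p
    unfolding coprime_cyclic_poly_iff[OF n_pos] normal_elements_def
    using \<gamma> by (simp add: act_mult[symmetric] mult.commute)
  have "normal_elements = (\<lambda>p. act p \<gamma>) ` unit_polys n"
  proof (intro equalityI subsetI)
    fix x assume x: "x \<in> normal_elements"
    then have "x \<in> (\<lambda>p. act p \<gamma>) ` ?D" unfolding surj by (simp add: normal_elements_def)
    then show "x \<in> (\<lambda>p. act p \<gamma>) ` unit_polys n" using x normal by (auto simp: unit_polys_def)
  qed (use normal in \<open>auto simp: unit_polys_def\<close>)
  moreover have "inj_on (\<lambda>p. act p \<gamma>) (unit_polys n)"
    by (rule inj_on_subset[OF inj]) (auto simp: unit_polys_def)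
  ultimately show ?thesis by (simp add: card_image)
qed

lemma card_normal_bases: "n * card (normal_bases n F) = card (unit_polys n)"
proof -
  have "n * card ((\<lambda>\<gamma>. set (conjugates \<gamma>)) ` normal_elements) = card normal_elements"
  proof (rule card_equal_classes)
    show "finite normal_elements"
      by (rule finite_subset[OF _ finite_carrier]) (auto simp: normal_elements_def)
    fix \<gamma> assume \<gamma>: "\<gamma> \<in> normal_elements"
    then have c: "\<gamma> \<in> carrier F" by (simp add: normal_elements_def)
    have "\<gamma> [^] ((2 :: nat) ^ 0) = \<gamma>" using c by simp
    then show "\<gamma> \<in> set (conjugates \<gamma>)" unfolding set_conjugates_eq[OF c] by (metis rangeI)
    show "card (set (conjugates \<gamma>)) = n" by (rule card_conjugates[OF \<gamma>])
    show "\<delta> \<in> normal_elements \<and> set (conjugates \<delta>) = set (conjugates \<gamma>)" if mem: "\<delta> \<in> set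
        (conjugates \<gamma>)" for \<delta>
    proof -
      obtain i where i: "\<delta> = \<gamma> [^] ((2 :: nat) ^ i)" using mem unfolding set_conjugates_eq[OF c]
          by blast
      have \<delta>: "\<delta> \<in> normal_elements" unfolding i by (rule conjugate_in_normal_elements(1)[OF \<gamma>])
      have "set (conjugates \<delta>) \<subseteq> set (conjugates \<gamma>)" unfolding i
          by (rule conjugate_in_normal_elements(2)[OF \<gamma>])
      moreover have "card (set (conjugates \<delta>)) = card (set (conjugates \<gamma>))"
        using card_conjugates[OF \<gamma>] card_conjugates[OF \<delta>] by simp
      ultimately show ?thesis using \<delta> card_subset_eq[OF finite_set] by blast
    qed
  qed
  then show ?thesis by (simp add: normal_bases_eq card_normal_elements)
qed

end

section \<open>The Burrows--Wheeler transform of generalized de Bruijn words\<close>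

text \<open>Each block supplies one 0 and one 1, so the first column of the sorted matrix is
  \<open>n\<close> zeros followed by \<open>n\<close> ones.\<close>

definition first_letter :: "nat \<Rightarrow> nat \<Rightarrow> bit"
  where "first_letter n j = (if j < n then 0 else 1)"

definition bw_word :: "nat \<Rightarrow> (nat \<Rightarrow> nat) \<Rightarrow> bit list"
  where "bw_word n \<sigma> = map (\<lambda>p. if p mod 2 = \<sigma> (p div 2) then 0 else 1) [0..<2 * n]"

text \<open>Passing to \<open>bw_succ\<close> amounts to a left rotation, so the letters of a row
  are the first letters met along the orbit. The free length \<open>t\<close> serves the induction
  that proves the rows sorted.\<close>

definition bw_prefix :: "nat \<Rightarrow> (nat \<Rightarrow> nat) \<Rightarrow> nat \<Rightarrow> nat \<Rightarrow> bit list"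
  where "bw_prefix n \<sigma> t j = map (\<lambda>s. first_letter n ((bw_succ n \<sigma> ^^ s) j)) [0..<t]"

lemma bw_prefix_Suc: "bw_prefix n \<sigma> (Suc t) j = first_letter n j # bw_prefix n \<sigma> t (bw_succ n \<sigma> j)"
  unfolding bw_prefix_def
  by (simp add: upt_conv_Cons map_Suc_upt[symmetric] funpow_swap1 del: upt_Suc)

lemma length_bw_prefix [simp]: "length (bw_prefix n \<sigma> t j) = t"
  by (simp add: bw_prefix_def)

lemma rotate1_last_butlast: "xs \<noteq> [] \<Longrightarrow> rotate1 (last xs # butlast xs) = xs"
  by simp

lemma last_butlast_rotate1: "xs \<noteq> [] \<Longrightarrow> last (rotate1 xs) # butlast (rotate1 xs) = xs"
  by (cases xs) auto

lemma butlast_mono_lex: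
  fixes xs ys :: "'a :: linorder list"
  assumes "length xs = length ys" "xs \<le> ys"
  shows "butlast xs \<le> butlast ys"
  using assms
proof (induction xs ys rule: list_induct2)
  case (Cons x xs y ys)
  then show ?case by (cases xs; cases ys) auto
qed simp

lemma nth_eq_hd_rotate: "t < length xs \<Longrightarrow> xs ! t = hd (rotate t xs)"
  by (metis add_0_right hd_conv_nth length_greater_0_conv list.size(3) mod_less not_less_zero
      nth_rotate rotate_is_Nil_conv)

locale bw_choice =
  fixes n :: nat and \<sigma> :: "nat \<Rightarrow> nat"
  assumes n_pos: "n > 0" and choice: "\<sigma> \<in> {..<n} \<rightarrow>\<^sub>E {0, 1}"
begin

abbreviation (input) "\<psi> \<equiv> bw_succ n \<sigma>"

definition row :: "nat \<Rightarrow> bit list" where "row = bw_prefix n \<sigma> (2 * n)"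

lemma choice_cases: "i < n \<Longrightarrow> \<sigma> i = 0 \<or> \<sigma> i = 1"
  using choice by (auto simp: PiE_iff)

lemma length_bw_word [simp]: "length (bw_word n \<sigma>) = 2 * n"
  by (simp add: bw_word_def)

lemma bw_word_succ:
  assumes "j < 2 * n"
  shows "bw_word n \<sigma> ! bw_succ n \<sigma> j = first_letter n j"
proof (cases "j < n")
  case True
  then show ?thesis using choice_cases[of j] bw_succ_less[OF choice assms]
    by (auto simp: bw_word_def bw_succ_def first_letter_def)
next
  case False
  then have "j - n < n" using assms by simp
  then show ?thesis using choice_cases[of "j - n"] bw_succ_less[OF choice assms] False
    by (auto simp: bw_word_def bw_succ_def first_letter_def)
qed

lemma bw_succ_mono:
  assumes "j \<le> k" "k < 2 * n" "first_letter n j = first_letter n k"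
  shows "bw_succ n \<sigma> j \<le> bw_succ n \<sigma> k"
proof (cases "j = k")
  case False
  then have less: "j < k" using assms by simp
  show ?thesis
  proof (cases "k < n")
    case True
    then show ?thesis using less choice_cases[of j] by (auto simp: bw_succ_def)
  next
    case False
    then have "j \<ge> n" using assms(3) by (auto simp: first_letter_def split: if_splits)
    then show ?thesis using less False by (auto simp: bw_succ_def)
  qed
qed simp

lemma bw_succ_perm: "bij_betw \<psi> {..<2 * n} {..<2 * n}"
  unfolding bij_betw_def
proof
  show inj: "inj_on \<psi> {..<2 * n}" by (rule inj_on_bw_succ[OF choice])
  show "\<psi> ` {..<2 * n} = {..<2 * n}"
    by (rule endo_inj_surj[OF _ _ inj]) (use bw_succ_less[OF choice] in auto)
qed

lemma funpow_less: "j < 2 * n \<Longrightarrow> (\<psi> ^^ k) j < 2 * n"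
  by (induction k) (use bw_succ_less[OF choice] in auto)

lemma bw_prefix_mono:
  "j \<le> k \<Longrightarrow> k < 2 * n \<Longrightarrow> bw_prefix n \<sigma> t j \<le> bw_prefix n \<sigma> t k"
proof (induction t arbitrary: j k)
  case 0
  then show ?case by (simp add: bw_prefix_def)
next
  case (Suc t)
  show ?case
  proof (cases "first_letter n j = first_letter n k")
    case True
    then show ?thesis unfolding bw_prefix_Suc
      using Suc.IH[OF bw_succ_mono[OF Suc.prems True] bw_succ_less[OF choice Suc.prems(2)]] by simp
  next
    case False
    then have "first_letter n j < first_letter n k" using Suc.prems
        by (auto simp: first_letter_def less_bit_def split: if_splits)
    then show ?thesis unfolding bw_prefix_Suc by simp
  qed
qed

lemma sorted_rows: "sorted (map row [0..<2 * n])"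
  unfolding row_def sorted_iff_nth_mono by (auto intro: bw_prefix_mono)

end

section \<open>Every irreducible choice is realized by a necklace\<close>

locale bw_cycle = bw_choice +
  assumes irreducible: "irreducible_on {..<2 * n} (bw_succ n \<sigma>)"
begin

lemma orbit_zero: "(\<lambda>k. (\<psi> ^^ k) 0) ` UNIV = {..<2 * n}"
proof -
  let ?T = "(\<lambda>k. (\<psi> ^^ k) 0) ` UNIV"
  have "\<psi> ((\<psi> ^^ k) 0) \<in> ?T" for k using rangeI[of "\<lambda>k. (\<psi> ^^ k) 0" "Suc k"] by simp
  then have "\<psi> ` ?T \<subseteq> ?T" by blast
  moreover have "?T \<subseteq> {..<2 * n}" using funpow_less[of 0] n_pos by auto
  ultimately show ?thesis using irreducible unfolding irreducible_on_def by blast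
qed

lemma no_short_period:
  assumes "(\<psi> ^^ d) 0 = 0" "0 < d"
  shows "2 * n \<le> d"
proof -
  have "(\<psi> ^^ k) 0 = (\<psi> ^^ (k mod d)) 0" for k
  proof -
    have "(\<psi> ^^ (d * q)) 0 = 0" for q by (induction q) (simp_all add: funpow_add assms(1))
    then have "(\<psi> ^^ (k mod d + d * (k div d))) 0 = (\<psi> ^^ (k mod d)) 0"
        by (simp only: funpow_add o_apply)
    then show ?thesis by simp
  qed
  then have "(\<lambda>k. (\<psi> ^^ k) 0) ` UNIV \<subseteq> (\<lambda>k. (\<psi> ^^ k) 0) ` {..<d}"
    using assms(2) by (auto simp: image_iff) (metis lessThan_iff mod_less_divisor)
  then have "{..<2 * n} \<subseteq> (\<lambda>k. (\<psi> ^^ k) 0) ` {..<d}" unfolding orbit_zero .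
  then have "card {..<2 * n} \<le> card {..<d}" by (rule surj_card_le[OF finite_lessThan])
  then show ?thesis by simp
qed

lemma funpow_cancel:
  assumes "(\<psi> ^^ a) 0 = (\<psi> ^^ b) 0" "a \<le> b"
  shows "(\<psi> ^^ (b - a)) 0 = 0"
proof -
  have "inj_on (\<psi> ^^ a) {..<2 * n}" using bij_betw_funpow[OF bw_succ_perm] bij_betw_imp_inj_on
      by blast
  moreover have "(\<psi> ^^ a) 0 = (\<psi> ^^ a) ((\<psi> ^^ (b - a)) 0)"
    using assms by (metis funpow_add le_add_diff_inverse o_apply)
  moreover have "0 \<in> {..<2 * n}" using n_pos by simp
  moreover have "(\<psi> ^^ (b - a)) 0 \<in> {..<2 * n}"
    unfolding lessThan_iff by (rule funpow_less) (use n_pos in simp)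
  ultimately show ?thesis by (metis inj_onD)
qed

lemma inj_orbit: "inj_on (\<lambda>k. (\<psi> ^^ k) 0) {..<2 * n}"
proof (rule linorder_inj_onI')
  fix a b assume ab: "a \<in> {..<2 * n}" "b \<in> {..<2 * n}" "a < b"
  show "(\<psi> ^^ a) 0 \<noteq> (\<psi> ^^ b) 0"
    using funpow_cancel[of a b] no_short_period[of "b - a"] ab by auto
qed

lemma orbit_lessThan: "(\<lambda>k. (\<psi> ^^ k) 0) ` {..<2 * n} = {..<2 * n}"
  by (rule card_subset_eq) (use funpow_less[of 0] n_pos card_image[OF inj_orbit] in auto)

text \<open>By pigeonhole the iterate \<open>2 * n\<close> repeats an earlier iterate k; cancelling
  gives the period \<open>2 * n - k\<close>, and a positive period below \<open>2 * n\<close> is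
  impossible.\<close>

lemma full_period: "(\<psi> ^^ (2 * n)) 0 = 0"
proof -
  have "(\<psi> ^^ (2 * n)) 0 \<in> (\<lambda>k. (\<psi> ^^ k) 0) ` {..<2 * n}"
    unfolding orbit_lessThan using funpow_less[of 0 "2 * n"] n_pos by simp
  then obtain k where k: "k < 2 * n" "(\<psi> ^^ k) 0 = (\<psi> ^^ (2 * n)) 0" by auto
  then have "2 * n \<le> 2 * n - k" using funpow_cancel[OF k(2)] no_short_period[of "2 * n - k"] by simp
  then show ?thesis using k n_pos by (cases "k = 0") auto
qed

lemma funpow_full_period: "j < 2 * n \<Longrightarrow> (\<psi> ^^ (2 * n)) j = j"
proof -
  assume "j < 2 * n"
  then obtain k where k: "j = (\<psi> ^^ k) 0" using orbit_zero
      by (metis (no_types, lifting) imageE lessThan_iff)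
  have "(\<psi> ^^ (2 * n)) ((\<psi> ^^ k) 0) = (\<psi> ^^ k) ((\<psi> ^^ (2 * n)) 0)"
    by (metis add.commute funpow_add o_apply)
  then show ?thesis using full_period k by simp
qed

lemma rotate1_row:
  assumes j: "j < 2 * n"
  shows "rotate1 (row j) = row (\<psi> j)"
proof -
  obtain m where m: "2 * n = Suc m" using n_pos by (cases "2 * n") auto
  have "row j = first_letter n j # bw_prefix n \<sigma> m (\<psi> j)" unfolding row_def m
      by (rule bw_prefix_Suc)
  then have "rotate1 (row j) = bw_prefix n \<sigma> m (\<psi> j) @ [first_letter n j]" by simp
  also have "(\<psi> ^^ m) (\<psi> j) = j" using funpow_full_period[OF j] unfolding m
      by (simp add: funpow_swap1)
  then have "bw_prefix n \<sigma> m (\<psi> j) @ [first_letter n j] = row (\<psi> j)"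
    unfolding row_def m bw_prefix_def by simp
  finally show ?thesis .
qed

lemma rotate_row: "rotate k (row 0) = row ((\<psi> ^^ k) 0)"
  by (induction k) (use n_pos funpow_less[of 0] rotate1_row in auto)

lemma bw_rows_cycle: "bw_rows (necklace (row 0)) = map row [0..<2 * n]"
proof -
  have len: "length (row 0) = 2 * n" by (simp add: row_def)
  have "rotations (row 0) = map row (map (\<lambda>k. (\<psi> ^^ k) 0) [0..<2 * n])"
    unfolding rotations_def len rotate_row by simp
  moreover have "mset (map (\<lambda>k. (\<psi> ^^ k) 0) [0..<2 * n]) = mset [0..<2 * n]"
  proof (subst set_eq_iff_mset_eq_distinct[symmetric])
    show "distinct (map (\<lambda>k. (\<psi> ^^ k) 0) [0..<2 * n])"
      unfolding distinct_map using inj_orbit by (simp add: atLeast0LessThan)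
    show "(set (map (\<lambda>k. (\<psi> ^^ k) 0) [0..<2 * n]) = set [0..<2 * n])"
      using orbit_lessThan by (simp add: atLeast0LessThan)
  qed simp
  ultimately have "mset (map row [0..<2 * n]) = mset (rotations (row 0))" by (simp only: mset_map)
  then show ?thesis unfolding bw_rows_necklace by (rule properties_for_sort[OF _ sorted_rows])
qed

lemma BWT_cycle: "BWT (necklace (row 0)) = bw_word n \<sigma>"
proof (rule nth_equalityI)
  show "length (BWT (necklace (row 0))) = length (bw_word n \<sigma>)"
    by (simp add: BWT_def bw_rows_cycle)
  fix j assume "j < length (BWT (necklace (row 0)))"
  then have j: "j < 2 * n" by (simp add: BWT_def bw_rows_cycle)
  obtain m where m: "2 * n = Suc m" using n_pos by (cases "2 * n") auto
  have "BWT (necklace (row 0)) ! j = last (row j)" using j by (simp add: BWT_def bw_rows_cycle)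
  \<comment> \<open>The last letter of a row is the first letter of its predecessor, reached after
    \<open>m = 2 * n - 1\<close> steps around the cycle.\<close>
  also have "\<dots> = first_letter n ((\<psi> ^^ m) j)" unfolding row_def m bw_prefix_def by simp
  also have "\<dots> = bw_word n \<sigma> ! \<psi> ((\<psi> ^^ m) j)" by (rule bw_word_succ[OF funpow_less[OF j],
      symmetric])
  also have "\<psi> ((\<psi> ^^ m) j) = j" using funpow_full_period[OF j] unfolding m by simp
  finally show "BWT (necklace (row 0)) ! j = bw_word n \<sigma> ! j" .
qed

end

section \<open>Recovering the rows from the transform\<close>

lemma image_rotate1_rotations: "image_mset rotate1 (mset (rotations w)) = mset (rotations w)"
proof -
  have "map rotate1 (rotations w) = rotations (rotate1 w)"
    by (simp add: rotations_def rotate1_rotate_swap)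
  then show ?thesis by (metis mset_map mset_rotations_rotate1)
qed

context bw_choice
begin

lemma bw_word_0_1: "bw_word n \<sigma> ! 0 \<noteq> bw_word n \<sigma> ! 1"
proof -
  have "0 < 2 * n" "1 < 2 * n" using n_pos by simp_all
  then show ?thesis using choice_cases[OF n_pos] by (auto simp: bw_word_def)
qed

text \<open>
  Rotating every row to the right sends the sorted list of rows to itself as a multiset, and it
  keeps the order of rows with the same last letter; hence it moves rows according to bw_succ.
\<close>

lemma rows_determined:
  assumes w: "length w = 2 * n" and BWT: "BWT (necklace w) = bw_word n \<sigma>" and i: "i < 2 * n"
  shows "rotate1 (bw_rows (necklace w) ! i) = bw_rows (necklace w) ! \<psi> i"
    "hd (bw_rows (necklace w) ! i) = first_letter n i"
proof -
  define rows where "rows = bw_rows (necklace w)"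
  define rr where "rr x = last x # butlast x" for x :: "bit list"
  have rows: "rows = sort (rotations w)" by (simp add: rows_def bw_rows_necklace)
  have len: "length rows = 2 * n" by (simp add: rows rotations_def w)
  have sorted: "sorted rows" by (simp add: rows)
  have row_len: "length x = 2 * n" if "x \<in> set rows" for x
    using that w by (auto simp: rows rotations_def)
  have ne: "x \<noteq> []" if "x \<in> set rows" for x using row_len[OF that] n_pos by auto
  have last: "last (rows ! \<psi> k) = first_letter n k" if "k < 2 * n" for k
  proof -
    have "last (rows ! \<psi> k) = BWT (necklace w) ! \<psi> k"
      using bw_succ_less[OF choice that] len by (simp add: BWT_def rows_def)
    then show ?thesis using bw_word_succ[OF that] BWT by simp
  qed
  have "image_mset rr (mset rows) = mset rows"
  proof -
    have "image_mset rr (mset rows) = image_mset rr (image_mset rotate1 (mset rows))"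
      by (simp add: rows image_rotate1_rotations)
    also have "\<dots> = image_mset (\<lambda>x. rr (rotate1 x)) (mset rows)"
        by (simp add: multiset.map_comp o_def)
    also have "\<dots> = image_mset (\<lambda>x. x) (mset rows)"
    proof (rule image_mset_cong)
      fix x assume "x \<in># mset rows"
      then show "rr (rotate1 x) = x" unfolding rr_def using last_butlast_rotate1[OF ne] by simp
    qed
    finally show ?thesis by simp
  qed
  moreover have "mset (map (\<lambda>k. rows ! \<psi> k) [0..<2 * n]) = mset rows"
  proof -
    have "mset (map \<psi> [0..<2 * n]) = mset [0..<2 * n]"
    proof (subst set_eq_iff_mset_eq_distinct[symmetric])
      show "distinct (map \<psi> [0..<2 * n])"
        unfolding distinct_map using bij_betw_imp_inj_on[OF bw_succ_perm]
            by (simp add: atLeast0LessThan)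
      show "(set (map \<psi> [0..<2 * n]) = set [0..<2 * n])"
        using bij_betw_imp_surj_on[OF bw_succ_perm] by (simp add: atLeast0LessThan)
    qed simp
    moreover have "map (\<lambda>k. rows ! \<psi> k) [0..<2 * n] = map ((!) rows) (map \<psi> [0..<2 * n])" by simp
    moreover have "map ((!) rows) [0..<2 * n] = rows" using map_nth[of rows] len by simp
    ultimately show ?thesis by (metis mset_map)
  qed
  ultimately have mset: "mset (map (\<lambda>k. rr (rows ! \<psi> k)) [0..<2 * n]) = mset rows"
    by (metis (mono_tags, lifting) list.map_comp map_eq_conv mset_map o_apply)
  have "sorted (map (\<lambda>k. rr (rows ! \<psi> k)) [0..<2 * n])"
    unfolding sorted_iff_nth_mono
  proof (intro allI impI)
    fix j k assume jk: "j \<le> k" "k < length (map (\<lambda>k. rr (rows ! \<psi> k)) [0..<2 * n])"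
    then have k: "k < 2 * n" "j < 2 * n" by simp_all
    have "rr (rows ! \<psi> j) \<le> rr (rows ! \<psi> k)"
    proof (cases "first_letter n j = first_letter n k")
      case True
      have "\<psi> j \<le> \<psi> k" by (rule bw_succ_mono[OF jk(1) k(1) True])
      moreover have less: "\<psi> j < length rows" "\<psi> k < length rows"
          using bw_succ_less[OF choice] k len by simp_all
      ultimately have "rows ! \<psi> j \<le> rows ! \<psi> k" using sorted by (simp add: sorted_iff_nth_mono)
      moreover have "length (rows ! \<psi> j) = length (rows ! \<psi> k)" using row_len less by simp
      ultimately show ?thesis using True last k butlast_mono_lex by (simp add: rr_def)
    next
      case False
      then have "first_letter n j < first_letter n k" using jk(1)
        by (auto simp: first_letter_def less_bit_def split: if_splits)
      then show ?thesis using last k by (simp add: rr_def)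
    qed
    then show "map (\<lambda>k. rr (rows ! \<psi> k)) [0..<2 * n] ! j \<le> map (\<lambda>k. rr (rows ! \<psi> k)) [0..<2 * n] !
        k"
      using k by simp
  qed
  \<comment> \<open>A multiset has only one sorted list, so the two lists agree entry by entry even
    where rows repeat.\<close>
  with mset have "sort rows = map (\<lambda>k. rr (rows ! \<psi> k)) [0..<2 * n]" by (rule properties_for_sort)
  moreover have "sort rows = rows" using sorted by (rule sorted_sort_id)
  ultimately have "rows = map (\<lambda>k. rr (rows ! \<psi> k)) [0..<2 * n]" by simp
  then have rr: "rows ! i = rr (rows ! \<psi> i)" using i
      by (metis (no_types, lifting) add_0 diff_zero length_upt nth_map nth_upt)
  have "rows ! \<psi> i \<in> set rows" using bw_succ_less[OF choice i] len by simp
  then have "rotate1 (rows ! i) = rows ! \<psi> i" unfolding rr rr_def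
      by (rule rotate1_last_butlast[OF ne])
  then show "rotate1 (bw_rows (necklace w) ! i) = bw_rows (necklace w) ! \<psi> i"
      by (simp add: rows_def)
  have "hd (rows ! i) = first_letter n i" unfolding rr rr_def using last[OF i] by simp
  then show "hd (bw_rows (necklace w) ! i) = first_letter n i" by (simp add: rows_def)
qed

lemma rows_eq:
  assumes w: "length w = 2 * n" and BWT: "BWT (necklace w) = bw_word n \<sigma>"
  shows "bw_rows (necklace w) = map row [0..<2 * n]"
    and "i < 2 * n \<Longrightarrow> rotate k (bw_rows (necklace w) ! i) = bw_rows (necklace w) ! (\<psi> ^^ k) i"
proof -
  define rows where "rows = bw_rows (necklace w)"
  have len: "length rows = 2 * n" by (simp add: rows_def bw_rows_necklace rotations_def w)
  have row_len: "length (rows ! i) = 2 * n" if "i < 2 * n" for i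
  proof -
    have "rows ! i \<in> set rows" using that len by simp
    then show ?thesis by (auto simp: rows_def bw_rows_necklace rotations_def w)
  qed
  have rot: "rotate k (rows ! i) = rows ! (\<psi> ^^ k) i" if "i < 2 * n" for i k
    by (induction k) (use rows_determined(1)[OF w BWT] funpow_less[OF that] in \<open>simp_all add:
        rows_def\<close>)
  then show "i < 2 * n \<Longrightarrow> rotate k (bw_rows (necklace w) ! i) = bw_rows (necklace w) ! (\<psi> ^^ k) i"
    by (simp add: rows_def)
  have "rows ! i = row i" if i: "i < 2 * n" for i
  proof (rule nth_equalityI)
    show "length (rows ! i) = length (row i)" using row_len[OF i] by (simp add: row_def)
    fix t assume "t < length (rows ! i)"
    then have t: "t < 2 * n" using row_len[OF i] by simp
    have "rows ! i ! t = hd (rows ! (\<psi> ^^ t) i)"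
      using nth_eq_hd_rotate[of t "rows ! i"] t row_len[OF i] rot[OF i] by simp
    also have "\<dots> = first_letter n ((\<psi> ^^ t) i)"
      using rows_determined(2)[OF w BWT funpow_less[OF i]] by (simp add: rows_def)
    finally show "rows ! i ! t = row i ! t" using t by (simp add: row_def bw_prefix_def)
  qed
  then have "rows = map row [0..<2 * n]" using len by (intro nth_equalityI) simp_all
  then show "bw_rows (necklace w) = map row [0..<2 * n]" by (simp add: rows_def)
qed

text \<open>A repetition anywhere means that a nontrivial rotation fixes every row, in particular
  the smallest one. That row then occurs twice, and sorting puts a second copy in position 1. But
  the last letters of rows 0 and 1 form the first block of the transform, and they differ.\<close>

lemma distinct_rows:
  assumes w: "length w = 2 * n" and BWT: "BWT (necklace w) = bw_word n \<sigma>"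
  shows "distinct (bw_rows (necklace w))"
proof (rule ccontr)
  assume nd: "\<not> distinct (bw_rows (necklace w))"
  define rows where "rows = bw_rows (necklace w)"
  define r where "r = rows ! 0"
  have rows: "rows = sort (rotations w)" by (simp add: rows_def bw_rows_necklace)
  have len: "length rows = 2 * n" by (simp add: rows rotations_def w)
  have "r \<in> set rows" using len n_pos by (simp add: r_def)
  then obtain k0 where k0: "r = rotate k0 w" by (auto simp: rows rotations_def)
  have lenr: "length r = 2 * n" by (simp add: k0 w)
  have mset: "mset rows = mset (rotations r)" by (simp add: rows k0 mset_rotations_rotate)
  then have "\<not> distinct (rotations r)" using nd mset_eq_imp_distinct_iff rows_def by blast
  then obtain a b where ab: "a < b" "b < 2 * n" "rotate a r = rotate b r"
    unfolding distinct_conv_nth by (auto simp: rotations_def lenr) (metis linorder_neqE_nat)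
  have "rotate a (rotate (b - a) r) = rotate a r" using ab by (simp add: rotate_rotate)
  moreover have "rotate (2 * n - a) (rotate a y) = y" if "length y = 2 * n" for y :: "bit list"
    using ab that by (simp add: rotate_rotate rotate_id)
  ultimately have rot: "rotate (b - a) r = r" using lenr by (metis length_rotate)
  \<comment> \<open>Both the rotation by 0 and the one by \<open>b - a\<close> give
    \<open>r\<close>.\<close>
  have "card {0, b - a} \<le> card {i. i < length (rotations r) \<and> rotations r ! i = r}"
    by (rule card_mono) (use ab rot lenr n_pos in \<open>auto simp: rotations_def\<close>)
  also have "\<dots> = length (filter (\<lambda>x. x = r) (rotations r))" by (simp only: length_filter_conv_card)
  also have "\<dots> = length (filter (\<lambda>x. x = r) rows)" using mset by (metis mset_filter size_mset)
  also have "\<dots> = card {i. i < length rows \<and> rows ! i = r}" by (simp only: length_filter_conv_card)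
  finally have "2 \<le> card {i. i < length rows \<and> rows ! i = r}" using ab by simp
  then have "card {i. i < length rows \<and> rows ! i = r} > card {0 :: nat}" by simp
  then have "\<not> {i. i < length rows \<and> rows ! i = r} \<subseteq> {0}" by (meson card_mono finite.intros not_le)
  then obtain j where j: "j < length rows" "rows ! j = r" "j \<noteq> 0" by auto
  have "sorted rows" by (simp add: rows)
  then have "rows ! 0 \<le> rows ! 1" "rows ! 1 \<le> rows ! j" using j by (auto intro!: sorted_nth_mono)
  then have "rows ! 1 = rows ! 0" using j(2) by (simp add: r_def)
  moreover have "BWT (necklace w) ! i = last (rows ! i)" if "i < 2 * n" for i
    using that len by (simp add: BWT_def rows_def)
  ultimately have "bw_word n \<sigma> ! 0 = bw_word n \<sigma> ! 1" using n_pos BWT by simp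
  then show False using bw_word_0_1 by simp
qed

text \<open>Any two rows are rotations of each other and rotation moves rows by
  \<open>\<psi>\<close>; since the rows are distinct, any index is reached from any other, so a
  nonempty closed set is everything.\<close>

lemma BWT_imp_irreducible:
  assumes w: "length w = 2 * n" and BWT: "BWT (necklace w) = bw_word n \<sigma>"
  shows "irreducible_on {..<2 * n} (bw_succ n \<sigma>)" "necklace w = necklace (row 0)"
proof -
  define rows where "rows = bw_rows (necklace w)"
  have rows: "rows = sort (rotations w)" by (simp add: rows_def bw_rows_necklace)
  have len: "length rows = 2 * n" by (simp add: rows rotations_def w)
  have wne: "w \<noteq> []" using w n_pos by auto
  have neck: "necklace (rows ! i) = necklace w" if "i < 2 * n" for i
  proof -
    have "rows ! i \<in> set rows" using that len by simp
    then obtain k where "rows ! i = rotate k w" by (auto simp: rows rotations_def)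
    then show ?thesis by (simp add: necklace_rotate)
  qed
  show "necklace w = necklace (row 0)"
    using neck[of 0] n_pos rows_eq(1)[OF w BWT] by (simp add: rows_def)
  show "irreducible_on {..<2 * n} (bw_succ n \<sigma>)"
    unfolding irreducible_on_def
  proof (intro allI impI equalityI)
    fix T assume T: "T \<subseteq> {..<2 * n}" "T \<noteq> {}" "\<psi> ` T \<subseteq> T"
    show "{..<2 * n} \<subseteq> T"
    proof
      fix j assume "j \<in> {..<2 * n}"
      then have j: "j < 2 * n" by simp
      obtain i where i: "i \<in> T" "i < 2 * n" using T by auto
      have "rows ! j \<in> necklace (rows ! i)"
        unfolding neck[OF i(2)] neck[OF j, symmetric] by (rule self_in_necklace)
      then obtain k where "rows ! j = rotate k (rows ! i)" by (auto simp: necklace_def)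
      then have "rows ! j = rows ! (\<psi> ^^ k) i" using rows_eq(2)[OF w BWT i(2)]
          by (simp add: rows_def)
      then have "j = (\<psi> ^^ k) i"
        using distinct_rows[OF w BWT] j funpow_less[OF i(2)] len
            by (simp add: nth_eq_iff_index_eq rows_def)
      moreover have "(\<psi> ^^ k) i \<in> T" by (induction k) (use i T(3) in auto)
      ultimately show "j \<in> T" by simp
    qed
  qed
qed

end

section \<open>Comparing the three counts\<close>

lemma concat_pairs: "concat (map (\<lambda>i. [f (2 * i), f (2 * i + 1)]) [0..<n]) = map f [0..<2 * n]"
  by (induction n) simp_all

lemma bw_word_eq_concat:
  assumes "\<sigma> \<in> {..<n} \<rightarrow>\<^sub>E {0, 1}"
  shows "bw_word n \<sigma> = concat (map (\<lambda>i. if \<sigma> i = 0 then [0, 1] else [1, 0]) [0..<n])"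
proof -
  have "bw_word n \<sigma> = concat (map (\<lambda>i. [(if 2 * i mod 2 = \<sigma> (2 * i div 2) then 0 else 1),
      (if (2 * i + 1) mod 2 = \<sigma> ((2 * i + 1) div 2) then 0 else 1)]) [0..<n])"
    unfolding bw_word_def by (rule concat_pairs[symmetric])
  also have "\<dots> = concat (map (\<lambda>i. if \<sigma> i = 0 then [0, 1] else [1, 0]) [0..<n])"
  proof (intro arg_cong[where f = concat] map_cong refl, goal_cases)
    case (1 i)
    then have "\<sigma> i = 0 \<or> \<sigma> i = 1" using assms by (auto simp: PiE_iff)
    then show ?case by auto
  qed
  finally show ?thesis .
qed

lemma card_generalized_de_bruijn_words:
  assumes n: "n > 0"
  shows "card (generalized_de_bruijn_words n) =
    card {\<sigma> \<in> {..<n} \<rightarrow>\<^sub>E {0, 1}. irreducible_on {..<2 * n} (bw_succ n \<sigma>)}"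
proof -
  let ?S = "{\<sigma> \<in> {..<n} \<rightarrow>\<^sub>E {0, 1}. irreducible_on {..<2 * n} (bw_succ n \<sigma>)}"
  define g where "g \<sigma> = necklace (bw_prefix n \<sigma> (2 * n) 0)" for \<sigma>
  have choice: "bw_choice n \<sigma>" if "\<sigma> \<in> {..<n} \<rightarrow>\<^sub>E {0, 1}" for \<sigma>
    using that n by (simp add: bw_choice_def)
  have BWT: "BWT (g \<sigma>) = bw_word n \<sigma>" if "\<sigma> \<in> ?S" for \<sigma>
  proof -
    interpret bw_cycle n \<sigma> using that choice by (auto simp: bw_cycle_def bw_cycle_axioms_def)
    show ?thesis using BWT_cycle by (simp add: g_def row_def)
  qed
  have "bij_betw g ?S (generalized_de_bruijn_words n)"
  proof (rule bij_betw_imageI)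
    show "inj_on g ?S"
    proof (rule inj_onI)
      fix \<sigma> \<tau> assume st: "\<sigma> \<in> ?S" "\<tau> \<in> ?S" "g \<sigma> = g \<tau>"
      then have eq: "bw_word n \<sigma> = bw_word n \<tau>" using BWT by metis
      show "\<sigma> = \<tau>"
      proof (rule PiE_ext[of _ "{..<n}" "\<lambda>_. {0, 1}"])
        fix i assume "i \<in> {..<n}"
        then have i: "i < n" by simp
        have "bw_word n \<sigma> ! (2 * i) = bw_word n \<tau> ! (2 * i)" using eq by simp
        then have "(0 = \<sigma> i) = (0 = \<tau> i)" using i by (auto simp: bw_word_def split: if_splits)
        moreover have "\<sigma> i = 0 \<or> \<sigma> i = 1" "\<tau> i = 0 \<or> \<tau> i = 1" using st i by (auto simp: PiE_iff)
        ultimately show "\<sigma> i = \<tau> i" by auto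
      qed (use st in auto)
    qed
    show "g ` ?S = generalized_de_bruijn_words n"
    proof (intro equalityI subsetI)
      fix C assume "C \<in> g ` ?S"
      then obtain \<sigma> where \<sigma>: "\<sigma> \<in> ?S" "C = g \<sigma>" by auto
      have "C \<in> necklaces (2 * n)" using \<sigma>(2) by (auto simp: necklaces_def g_def)
      moreover have "BWT C = concat (map (\<lambda>i. if \<sigma> i = 0 then [0, 1] else [1, 0]) [0..<n])"
        using BWT[OF \<sigma>(1)] bw_word_eq_concat[of \<sigma> n] \<sigma> by simp
      moreover have "set (map (\<lambda>i. if \<sigma> i = 0 then [0, 1] else [1, 0]) [0..<n]) \<subseteq> {[0, 1], [1, 0
          :: bit]}" by auto
      moreover have "length (map (\<lambda>i. if \<sigma> i = 0 then [0, 1] else [1, 0 :: bit]) [0..<n]) = n"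
          by simp
      ultimately show "C \<in> generalized_de_bruijn_words n"
        unfolding generalized_de_bruijn_words_def by blast
    next
      fix C assume "C \<in> generalized_de_bruijn_words n"
      then obtain w xs where w: "C = necklace w" "length w = 2 * n" "length xs
          = n" "set xs \<subseteq> {[0, 1], [1, 0]}" "BWT C = concat xs"
        by (auto simp: generalized_de_bruijn_words_def necklaces_def)
      define \<sigma> where "\<sigma> = (\<lambda>i\<in>{..<n}. if xs ! i = [0, 1] then 0 else 1 :: nat)"
      have \<sigma>: "\<sigma> \<in> {..<n} \<rightarrow>\<^sub>E {0, 1}" by (auto simp: \<sigma>_def)
      have "xs = map (\<lambda>i. if \<sigma> i = 0 then [0, 1] else [1, 0]) [0..<n]"
      proof (rule nth_equalityI)
        fix i assume "i < length xs"
        then have "xs ! i \<in> {[0, 1], [1, 0]}" using w(4) nth_mem by blast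
        then show "xs ! i = map (\<lambda>i. if \<sigma> i = 0 then [0, 1] else [1, 0]) [0..<n] ! i"
          using \<open>i < length xs\<close> w(3) by (auto simp: \<sigma>_def)
      qed (use w(3) in simp)
      then have B: "BWT (necklace w) = bw_word n \<sigma>" using bw_word_eq_concat[OF \<sigma>] w(1,5) by metis
      interpret bw_choice n \<sigma> by (rule choice[OF \<sigma>])
      have "C = g \<sigma>" using BWT_imp_irreducible(2)[OF w(2) B] w(1) by (simp add: g_def row_def)
      moreover have "\<sigma> \<in> ?S" using BWT_imp_irreducible(1)[OF w(2) B] \<sigma> by blast
      ultimately show "C \<in> g ` ?S" by blast
    qed
  qed
  then show ?thesis by (rule bij_betw_same_card[symmetric])
qed

text \<open>Positivity of \<open>c\<close> excludes infinite sets, whose \<open>card\<close> is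
  0.\<close>

lemma exists_bij_betw_of_card:
  fixes n :: nat
  assumes "n * card A = c" "n * card B = c" "n > 0" "c > 0"
  shows "\<exists>f. bij_betw f A B"
proof -
  have "card A = card B" using assms by auto
  moreover have "finite A" "finite B" using assms by (auto intro!: card_ge_0_finite gr0I)
  ultimately show ?thesis by (simp add: finite_same_card_bij)
qed

theorem theorem28:
  fixes n :: nat
  assumes "n \<ge> 1"
  shows "(\<exists>f. bij_betw f (generalized_de_bruijn_words n) (invertible_necklaces n)) \<and>
    (\<forall>F :: ('a, 'b) ring_scheme. field F \<longrightarrow> card (carrier F) = 2 ^ n \<longrightarrow>
      (\<exists>g. bij_betw g (invertible_necklaces n) (normal_bases n F)) \<and>
      (\<exists>h. bij_betw h (generalized_de_bruijn_words n) (normal_bases n F)))"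
proof -
  have n: "n > 0" using assms by simp
  have words: "n * card (generalized_de_bruijn_words n) = card (unit_polys n)"
    unfolding card_generalized_de_bruijn_words[OF n] by (rule card_irreducible_bw_succ_eq[OF n])
  have necklaces: "n * card (invertible_necklaces n) = card (unit_polys n)"
    by (rule card_invertible_necklaces[OF n])
  have bases: "n * card (normal_bases n F) = card (unit_polys n)"
    if "field F" "card (carrier F) = 2 ^ n" for F :: "('a, 'b) ring_scheme"
  proof -
    have "binary_field F n" using that n by (simp add: binary_field_def binary_field_axioms_def)
    then show ?thesis by (rule binary_field.card_normal_bases)
  qed
  \<comment> \<open>A witness that the common count is positive.\<close>
  have "1 \<in> unit_polys n" using n by (simp add: unit_polys_def)
  moreover have "finite (unit_polys n)"
    by (rule finite_subset[OF _ finite_bit_polys[OF n]]) (auto simp: unit_polys_def)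
  ultimately have pos: "card (unit_polys n) > 0" by (auto simp: card_gt_0_iff)
  show ?thesis
  proof (intro conjI allI impI)
    show "\<exists>f. bij_betw f (generalized_de_bruijn_words n) (invertible_necklaces n)"
      by (rule exists_bij_betw_of_card[OF words necklaces n pos])
    fix F :: "('a, 'b) ring_scheme" assume "field F" "card (carrier F) = 2 ^ n"
    note bases = bases[OF this]
    show "\<exists>g. bij_betw g (invertible_necklaces n) (normal_bases n F)"
      by (rule exists_bij_betw_of_card[OF necklaces bases n pos])
    show "\<exists>h. bij_betw h (generalized_de_bruijn_words n) (normal_bases n F)"
      by (rule exists_bij_betw_of_card[OF words bases n pos])
  qed
qed

end
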